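(* Let $k=k_n$ and $q=q_n$ depend on $n$ and suppose that $k\to+\infty$, $k/n\to0$ and $q\to+\infty$ as $n\to+\infty$, that $0<\mu\leq M$ on $[0,1]$ for a constant $M$, and that $s$ is $C$-Lipschitz on $[0,1]$. Then the risk of a purely uniformly random forest (PURF) satisfies $$\mathbb{E}\big[(\hat{s}(X)-s(X))^2\big]\leq\frac{3}{4}\,\frac{\sigma^2(k+1)}{n}+\frac{6MC^2}{(k+1)^2}+o\Big(\frac{k}{n}\Big)\quad (n\to+\infty).$$
   Context: Model: $(X_1,Y_1),\dots,(X_n,Y_n)$ are i.i.d. copies of $(X,Y)$ (the learning sample $\mathcal{L}_n$), with $Y_i=s(X_i)+\varepsilon_i$, where $s:[0,1]\to\mathbb{R}$ is the (fixed, unknown) regression function, $X\in[0,1]$ has a continuous density $\mu$ on $[0,1]$, and $\varepsilon_1,\dots,\varepsilon_n$ are i.i.d. copies of a real random variable $\varepsilon$, independent of $(X_1,\dots,X_n)$, with $\mathbb{E}[\varepsilon]=0$ and $\mathrm{Var}(\varepsilon)=\sigma^2$. In risks, $X$ denotes a new point with density $\mu$, independent of $\mathcal{L}_n$ and of the random partitions. Trees: for a natural integer $k$ and a vector $\mathbb{U}=(U_1,\dots,U_k)$ of i.i.d. uniform variables on $[0,1]$, independent of $\mathcal{L}_n$ and $X$, with order statistics $U_{(1)}\leq\dots\leq U_{(k)}$ and $U_{(0)}=0$, $U_{(k+1)}=1$, set for $x\in[0,1]$ $$\hat{s}_{\mathbb{U}}(x)=\sum_{j=0}^k\hat\beta_j\mathbf{1}_{U_{(j)}<x\leq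 U_{(j+1)}},$$ where $\hat\beta_j$ is the average of the $Y_i$ over the indices $i$ with $U_{(j)}<X_i\leq U_{(j+1)}$ (and $\hat\beta_j=0$ if there are none). Forest: $\mathbb{U}^1,\dots,\mathbb{U}^q$ are i.i.d. copies of $\mathbb{U}$, independent of $\mathcal{L}_n$ and $X$, and the purely uniformly random forest (PURF) is $\hat{s}(x)=\frac1q\sum_{l=1}^q\hat{s}_{\mathbb{U}^l}(x)$. The notation $o(k/n)$ denotes a function $f(n)$ with $f(n)/(k/n)\to0$ as $n\to+\infty$. *)

theory Defs
  imports "HOL-Probability.Probability" "HOL-Library.Landau_Symbols"
begin

text \<open>Samples and vectors are functions on indices starting at 1: the sample is
  \<open>(x 1, y 1), \<dots>, (x n, y n)\<close>, the cut points of a tree are \<open>u 1, \<dots>, u k\<close>, and those of the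
  \<open>l\<close>-th tree of a forest are \<open>u l 1, \<dots>, u l k\<close>.\<close>

definition order_stat :: "nat \<Rightarrow> (nat \<Rightarrow> real) \<Rightarrow> nat \<Rightarrow> real" where
  "order_stat k u j =
    (if j = 0 then 0 else if j = k + 1 then 1 else sort (map u [1..<k + 1]) ! (j - 1))"

definition cell :: "nat \<Rightarrow> (nat \<Rightarrow> real) \<Rightarrow> nat \<Rightarrow> real set" where
  "cell k u j = {order_stat k u j <.. order_stat k u (j + 1)}"

definition cell_mean :: "nat \<Rightarrow> (nat \<Rightarrow> real) \<Rightarrow> (nat \<Rightarrow> real) \<Rightarrow> real set \<Rightarrow> real" where
  "cell_mean n x y A =
    (let I = {i \<in> {1..n}. x i \<in> A} in if I = {} then 0 else (\<Sum>i\<in>I. y i) / real (card I))"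

definition tree_est ::
    "nat \<Rightarrow> (nat \<Rightarrow> real) \<Rightarrow> (nat \<Rightarrow> real) \<Rightarrow> nat \<Rightarrow> (nat \<Rightarrow> real) \<Rightarrow> real \<Rightarrow> real" where
  "tree_est n x y k u t =
    (\<Sum>j = 0..k. cell_mean n x y (cell k u j) * indicator (cell k u j) t)"

definition forest_est ::
    "nat \<Rightarrow> (nat \<Rightarrow> real) \<Rightarrow> (nat \<Rightarrow> real) \<Rightarrow> nat \<Rightarrow> nat \<Rightarrow> (nat \<Rightarrow> nat \<Rightarrow> real) \<Rightarrow> real \<Rightarrow> real" where
  "forest_est n x y k q u t = (1 / real q) * (\<Sum>l = 1..q. tree_est n x y k (u l) t)"

text \<open>Labels for the sources of randomness at a given sample size, so that their joint
  independence is a single statement about one indexed family.\<close>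

datatype source = Design nat | Noise nat | Cut nat nat | New_Point

definition sources :: "nat \<Rightarrow> nat \<Rightarrow> nat \<Rightarrow> source set" where
  "sources n k q = Design ` {1..n} \<union> Noise ` {1..n} \<union>
    {Cut l j | l j. l \<in> {1..q} \<and> j \<in> {1..k}} \<union> {New_Point}"

end

theory Submission
  imports Defs "HOL-Real_Asymp.Real_Asymp"
begin

text \<open>
  The forest is a weighted mean of the responses, and its weights depend only on the design, the cuts
  and the new point \<open>x\<close>. So its error is a bias, computed from values of \<open>s\<close>, plus a weighted sum of
  noise variables. As the noise is centred and independent of everything else, the mean squares of
  these two parts add up (\<open>risk_eq\<close>).

  Bias. By convexity the forest is at most as bad as a single tree. If the cell of \<open>x\<close> contains an
  observation, the tree averages values of \<open>s\<close> at points of this cell, and its error is at most \<open>C\<close> times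
  the distance from \<open>x\<close> to one of them. The squared distances to the two ends of the cell have mean at
  most \<open>2 / ((k + 1) (k + 2))\<close> each (\<open>mean_sq_reach_le\<close>). This gives \<open>4 C\<^sup>2 / ((k + 1) (k + 2))\<close>, and
  \<open>4 \<le> 6 M\<close> because a density on the unit interval that is bounded by \<open>M\<close> forces \<open>M \<ge> 1\<close>. If the cell
  contains no observation, the error is \<open>s x\<close>, which is bounded, and the probability of this event is
  \<open>o(k / n)\<close> (\<open>prob_empty_cell_le\<close>, \<open>empty_remainder_le\<close>).

  Noise. The variance of the weighted sum is \<open>\<sigma>\<^sup>2 / q\<^sup>2\<close> times a sum over pairs of trees. For two cells
  \<open>A\<close> and \<open>B\<close> of \<open>x\<close> with counts \<open>N A\<close> and \<open>N B\<close>, the term is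
  \<open>N (A \<inter> B) / (N A * N B) \<le> 1 / N (A \<union> B)\<close> (\<open>sum_weight_mult_le\<close>). A tree paired with itself yields a
  mean of order \<open>k / n\<close>, but only \<open>q\<close> of the \<open>q\<^sup>2\<close> pairs are of this kind, so they disappear as \<open>q\<close>
  grows. For two different trees, each arm of the union \<open>A \<union> B\<close> is the larger of two gaps, and a gap is
  nearly an exponential variable of rate \<open>k\<close>. If \<open>L\<close> is the sum of two such maxima, the mean of \<open>1 / L\<close>
  is the integral of the square of the Laplace transform \<open>2 k\<^sup>2 / ((t + k) (t + 2 k))\<close> of one arm, that is
  \<open>(6 - 8 ln 2) k\<close> or about \<open>0.455 k\<close>. The room between \<open>0.455\<close> and \<open>3 / 4\<close> allows for convenient
  estimates: \<open>9 / 16\<close> for the integral, a factor \<open>10 / 9\<close> for the variation of the density within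
  a short distance \<open>\<delta>\<close>, and another one for the comparison of gaps with exponential variables. Together
  they give \<open>25 / 36 < 3 / 4\<close>.

  To reach the mean of \<open>1 / N\<close> for a count \<open>N\<close>, \<open>1 / N\<close> is bounded by the integral of
  \<open>(1 + 3 v) (1 - v) ^ N\<close> over the unit interval. For fixed cuts and fixed \<open>x\<close> the mean of \<open>(1 - v) ^ N\<close> is
  at most \<open>exp (- n v p)\<close> with the mass \<open>p\<close> of the cell, and \<open>p \<ge> 9 / 10 \<mu> x\<close> times the length of the
  part of the cell near \<open>x\<close>. Averaging over the cuts leads to the Laplace transform of this length
  (\<open>void_power_le\<close>). Finally the integral over \<open>x\<close> with density \<open>\<mu>\<close> is taken: after the substitution
  \<open>t = 9 / 10 n v \<mu> x\<close> the density cancels (\<open>rescale_le\<close>), and only the ends of the unit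
  interval, where a cell may lack one of its arms, leave terms of smaller order.
\<close>

section \<open>Cells and weights\<close>

text \<open>Two points of the unit interval lie in the same cell exactly when no cut separates them. This form avoids order statistics, and the cut points enter it only through
  comparisons, which makes measurability and the effect of single cuts easy to read off.\<close>
definition cell_of :: "nat \<Rightarrow> (nat \<Rightarrow> real) \<Rightarrow> real \<Rightarrow> real set" where
  "cell_of k u x = {y. 0 < y \<and> y \<le> 1 \<and> (\<forall>j\<in>{1..k}. u j < x \<longleftrightarrow> u j < y)}"

lemma sorted_nth_less_iff:
  fixes xs :: "'a::linorder list"
  assumes "sorted xs" "i < length xs"
  shows "xs ! i < x \<longleftrightarrow> i < length (filter (\<lambda>v. v < x) xs)"
  using assms
proof (induction xs arbitrary: i)
  case (Cons a xs)
  show ?case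
  proof (cases "a < x")
    case True
    then show ?thesis using Cons by (cases i) auto
  next
    case False
    then have "filter (\<lambda>v. v < x) xs = []"
      using Cons.prems(1) by (auto simp: filter_empty_conv)
    moreover have "\<not> (a # xs) ! i < x"
      using False Cons.prems by (cases i) (auto simp: not_less, meson nth_mem order_trans)
    ultimately show ?thesis using False by simp
  qed
qed auto

text \<open>The cell with index \<open>j\<close> consists of the points with exactly \<open>j\<close> cuts strictly to their left.
  So the cell of \<open>x\<close> is the one whose index is the rank of \<open>x\<close>, and two points of equal rank have the
  same cuts to their left because the sets of these cuts are nested.\<close>
lemma tree_est_eq_cell_mean:
  assumes u: "\<And>j. j \<in> {1..k} \<Longrightarrow> u j \<in> {0..1}" and x: "0 < x" "x \<le> 1"
  shows "tree_est n X Y k u x = cell_mean n X Y (cell_of k u x)"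
proof -
  define us where "us = sort (map u [1..<k + 1])"
  define rank where "rank y = length (filter (\<lambda>v. v < y) us)" for y
  have len: "length us = k" and "sorted us" by (auto simp: us_def)
  have set_us: "set us = u ` {1..k}" by (auto simp: us_def)
  have us01: "us ! i \<in> {0..1}" if "i < k" for i
    using that u set_us nth_mem[of i us] len by fastforce
  have nth: "us ! i < y \<longleftrightarrow> i < rank y" if "i < k" for i y
    using sorted_nth_less_iff[OF \<open>sorted us\<close>] that len by (simp add: rank_def)
  have rank_le: "rank y \<le> k" for y
    using length_filter_le[of "\<lambda>v. v < y" us] len by (simp add: rank_def)
  have stat: "order_stat k u 0 = 0" "order_stat k u (k + 1) = 1"
    "\<And>j. 0 < j \<Longrightarrow> j \<le> k \<Longrightarrow> order_stat k u j = us ! (j - 1)"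
    by (auto simp: order_stat_def us_def)
  have low: "order_stat k u j < y \<longleftrightarrow> j \<le> rank y" if "0 < y" "j \<le> k" for j y
    using that nth[of "j - 1" y] by (cases "j = 0") (auto simp: stat)
  have up: "y \<le> order_stat k u (j + 1) \<longleftrightarrow> rank y \<le> j" if "y \<le> 1" "j \<le> k" for j y
    using that nth[of j y] rank_le[of y] stat(2)
    by (cases "j = k") (auto simp: stat(3) not_less[symmetric])
  have stat01: "order_stat k u j \<in> {0..1}" if "j \<le> k + 1" for j
    using that us01[of "j - 1"] stat by (cases "j = 0"; cases "j = k + 1") auto
  have cell_iff: "y \<in> cell k u j \<longleftrightarrow> 0 < y \<and> y \<le> 1 \<and> rank y = j" if "j \<le> k" for y j
  proof (cases "0 < y \<and> y \<le> 1")
    case True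
    then show ?thesis
      using low[of y j] up[of y j] that by (auto simp: cell_def)
  next
    case False
    then show ?thesis
      using stat01[of j] stat01[of "j + 1"] that by (auto simp: cell_def)
  qed
  \<comment> \<open>The cuts below a point form an initial segment of the sorted list, so its length determines it.\<close>
  have rank_eq: "rank y = rank x \<longleftrightarrow> (\<forall>j\<in>{1..k}. u j < x \<longleftrightarrow> u j < y)" for y
  proof
    assume *: "rank y = rank x"
    have "v < x \<longleftrightarrow> v < y" if "v \<in> set us" for v
      using that * nth by (metis in_set_conv_nth len)
    then show "\<forall>j\<in>{1..k}. u j < x \<longleftrightarrow> u j < y" by (simp add: set_us)
  next
    assume "\<forall>j\<in>{1..k}. u j < x \<longleftrightarrow> u j < y"
    then have "filter (\<lambda>v. v < y) us = filter (\<lambda>v. v < x) us"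
      by (intro filter_cong) (auto simp: set_us)
    then show "rank y = rank x" by (simp add: rank_def)
  qed
  have "cell k u (rank x) = cell_of k u x"
    using cell_iff[OF rank_le] rank_eq by (auto simp: cell_of_def)
  moreover have "tree_est n X Y k u x =
      (\<Sum>j = 0..k. if j = rank x then cell_mean n X Y (cell k u j) else 0)"
    unfolding tree_est_def using x by (intro sum.cong) (auto simp: cell_iff indicator_def)
  ultimately show ?thesis using rank_le[of x] by simp
qed

text \<open>Division by zero yields zero, so an empty cell gives all observations weight zero; this
  reproduces the convention that the tree predicts zero there. The count is written as a sum of indicators
  to keep the weight measurable by construction.\<close>
definition weight :: "nat \<Rightarrow> (nat \<Rightarrow> real) \<Rightarrow> real set \<Rightarrow> nat \<Rightarrow> real" where
  "weight n x A i = indicator A (x i) / (\<Sum>i'\<in>{1..n}. indicator A (x i'))"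

abbreviation count_in :: "nat \<Rightarrow> (nat \<Rightarrow> real) \<Rightarrow> real set \<Rightarrow> nat" where
  "count_in n x A \<equiv> card {i \<in> {1..n}. x i \<in> A}"

lemma real_count_in: "real (count_in n x A) = (\<Sum>i\<in>{1..n}. indicator A (x i))"
  by (simp add: indicator_def if_distrib sum.If_cases Int_def cong: if_cong)

lemma weight_eq: "weight n x A i = indicator A (x i) / count_in n x A"
  by (simp only: weight_def real_count_in)

lemma cell_mean_eq_weights:
  "cell_mean n x y A = (\<Sum>i\<in>{1..n}. weight n x A i * y i)"
proof -
  have "(\<Sum>i\<in>{1..n}. weight n x A i * y i) = (\<Sum>i\<in>{1..n}. indicator A (x i) * y i) / count_in n x A"
    unfolding weight_eq sum_divide_distrib by (intro sum.cong) auto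
  also have "(\<Sum>i\<in>{1..n}. indicator A (x i) * y i) = sum y {i \<in> {1..n}. x i \<in> A}"
    unfolding sum.inter_filter[OF finite_atLeastAtMost] by (intro sum.cong) auto
  finally show ?thesis by (auto simp: cell_mean_def Let_def)
qed

lemma sum_weight: "(\<Sum>i\<in>{1..n}. weight n x A i) = (if count_in n x A = 0 then 0 else 1)"
  unfolding weight_def sum_divide_distrib[symmetric] real_count_in[symmetric] by simp

text \<open>This is what averaging two trees gains. The sum is \<open>c / ((a + c) (b + c))\<close>, where \<open>c\<close> observations
  lie in both cells and \<open>a\<close>, \<open>b\<close> in only one of them, and \<open>c (a + b + c) \<le> (a + c) (b + c)\<close>. The bound
  is a function of a single count, to which the computation for one set applies unchanged.\<close>
lemma sum_weight_mult_le:
  "(\<Sum>i\<in>{1..n}. weight n x A i * weight n x B i) \<le> 1 / count_in n x (A \<union> B)"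
proof -
  define a b c where "a = count_in n x (A - B)" and "b = count_in n x (B - A)"
    and "c = count_in n x (A \<inter> B)"
  have A: "count_in n x A = a + c"
    unfolding a_def c_def by (subst card_Un_disjoint[symmetric]) (auto intro!: arg_cong[of _ _ card])
  have B: "count_in n x B = b + c"
    unfolding b_def c_def by (subst card_Un_disjoint[symmetric]) (auto intro!: arg_cong[of _ _ card])
  have "count_in n x (A \<union> B) = count_in n x A + b"
    unfolding b_def by (subst card_Un_disjoint[symmetric]) (auto intro!: arg_cong[of _ _ card])
  then have AB: "count_in n x (A \<union> B) = a + b + c" using A by simp
  have "(\<Sum>i\<in>{1..n}. weight n x A i * weight n x B i)
      = (\<Sum>i\<in>{1..n}. indicator (A \<inter> B) (x i)) / ((a + c) * (b + c))"
    unfolding weight_eq A B sum_divide_distrib by (intro sum.cong) (auto simp: indicator_def)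
  also have "(\<Sum>i\<in>{1..n}. indicator (A \<inter> B) (x i)) = real c"
    by (simp only: c_def real_count_in)
  also have "real c / ((a + c) * (b + c)) \<le> 1 / (a + b + c)"
  proof (cases "c = 0")
    case False
    \<comment> \<open>The difference of the two sides is \<open>a * b\<close>.\<close>
    have "c * (a + b + c) \<le> (a + c) * (b + c)" by (simp add: algebra_simps)
    then have "real c * (a + b + c) \<le> (a + c) * (b + c)"
      by (metis (mono_tags) of_nat_le_iff of_nat_mult)
    then show ?thesis using False by (simp add: divide_simps)
  qed simp
  finally show ?thesis by (simp only: AB)
qed

section \<open>Powers of counts\<close>

lemma interval_FTC:
  fixes F f :: "real \<Rightarrow> real"
  assumes "a \<le> b" "f \<in> borel_measurable borel"
    and "\<And>x. a \<le> x \<Longrightarrow> x \<le> b \<Longrightarrow> DERIV F x :> f x"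
    and "\<And>x. a \<le> x \<Longrightarrow> x \<le> b \<Longrightarrow> 0 \<le> f x"
  shows "(\<integral>\<^sup>+x\<in>{a..b}. ennreal (f x) \<partial>lborel) = ennreal (F b - F a)"
proof -
  have "(\<integral>\<^sup>+x\<in>{a..b}. ennreal (f x) \<partial>lborel) = F b - F a"
    by (rule nn_integral_FTC_Icc) (use assms has_vector_derivative_at_within
         in \<open>auto simp: has_real_derivative_iff_has_vector_derivative\<close>)
  then show ?thesis by simp
qed

text \<open>The integral is \<open>1 / (N + 1) + 3 / ((N + 1) (N + 2))\<close>. Powers of \<open>1 - v\<close> are used since
  \<open>(1 - v) ^ N\<close> factorises over independent observations when \<open>N\<close> counts them. The weight \<open>1 + 3 v\<close> is close to 1 for the
  small \<open>v\<close> that matter when \<open>N\<close> is large, so that no constant factor is lost to first order.\<close>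
lemma inverse_le_integral_power:
  "ennreal (1 / real N) \<le> (\<integral>\<^sup>+v\<in>{0..1}. ennreal ((1 + 3 * v) * (1 - v) ^ N) \<partial>lborel)"
proof (cases "N = 0")
  case False
  define F where "F v = - 4 * (1 - v) ^ (N + 1) / (N + 1) + 3 * (1 - v) ^ (N + 2) / (N + 2)" for v :: real
  have der: "DERIV F v :> (1 + 3 * v) * (1 - v) ^ N" for v
  proof -
    have "DERIV F v :> 4 * (1 - v) ^ N - 3 * (1 - v) ^ (N + 1)"
      unfolding F_def by (rule derivative_eq_intros refl | simp add: divide_simps)+ 
    then show ?thesis by (simp add: algebra_simps)
  qed
  have "(\<integral>\<^sup>+v\<in>{0..1}. ennreal ((1 + 3 * v) * (1 - v) ^ N) \<partial>lborel) = ennreal (F 1 - F 0)"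
    by (rule interval_FTC) (auto intro: der)
  moreover have "1 / real N \<le> F 1 - F 0"
    using False by (simp add: F_def divide_simps) (simp add: algebra_simps)
  ultimately show ?thesis by (simp add: ennreal_leI)
qed simp

section \<open>Independence and uniform cuts\<close>

text \<open>Independent sources may be sampled separately: Fubini's theorem without leaving the given
  probability space. All conditioning below takes this form.\<close>
lemma (in prob_space) nn_integral_indep_var:
  assumes AB: "indep_var S A T B" and f: "f \<in> borel_measurable (S \<Otimes>\<^sub>M T)"
  shows "(\<integral>\<^sup>+\<omega>. f (A \<omega>, B \<omega>) \<partial>M) = (\<integral>\<^sup>+\<omega>. \<integral>\<^sup>+\<omega>'. f (A \<omega>, B \<omega>') \<partial>M \<partial>M)"
proof -
  have A: "A \<in> measurable M S" and B: "B \<in> measurable M T"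
    using AB by (auto dest: indep_var_rv1 indep_var_rv2)
  interpret D: prob_space "distr M T B" by (rule prob_space_distr) (rule B)
  have f': "f \<in> borel_measurable (S \<Otimes>\<^sub>M distr M T B)"
    using f by (simp cong: measurable_cong_sets sets_pair_measure_cong)
  have "(\<integral>\<^sup>+\<omega>. f (A \<omega>, B \<omega>) \<partial>M) = (\<integral>\<^sup>+z. f z \<partial>distr M (S \<Otimes>\<^sub>M T) (\<lambda>\<omega>. (A \<omega>, B \<omega>)))"
    using A B f by (subst nn_integral_distr) auto
  also have "\<dots> = (\<integral>\<^sup>+z. f z \<partial>(distr M S A \<Otimes>\<^sub>M distr M T B))"
    using AB by (simp add: indep_var_distribution_eq)
  also have "\<dots> = (\<integral>\<^sup>+a. \<integral>\<^sup>+b. f (a, b) \<partial>distr M T B \<partial>distr M S A)"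
    using f by (intro D.nn_integral_fst[symmetric]) (simp cong: measurable_cong_sets sets_pair_measure_cong)
  also have "\<dots> = (\<integral>\<^sup>+\<omega>. \<integral>\<^sup>+b. f (A \<omega>, b) \<partial>distr M T B \<partial>M)"
    using A D.borel_measurable_nn_integral_fst[OF f'] by (subst nn_integral_distr) auto
  also have "\<dots> = (\<integral>\<^sup>+\<omega>. \<integral>\<^sup>+\<omega>'. f (A \<omega>, B \<omega>') \<partial>M \<partial>M)"
    using A B f by (intro nn_integral_cong nn_integral_distr) (auto dest: measurable_space)
  finally show ?thesis .
qed

lemma (in prob_space) prob_avoid:
  assumes V: "indep_vars (\<lambda>_. borel) V J" "finite J"
    and unif: "\<And>j. j \<in> J \<Longrightarrow> distr M lborel (V j) = uniform_measure lborel {0..1::real}"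
    and S: "S \<in> sets borel" "S \<subseteq> {0..1}"
  shows "prob {\<omega> \<in> space M. \<forall>j\<in>J. V j \<omega> \<notin> S} = (1 - measure lborel S) ^ card J"
proof (cases "J = {}")
  case False
  have "prob (V j -` (- S) \<inter> space M) = 1 - measure lborel S" if "j \<in> J" for j
  proof -
    have [measurable]: "V j \<in> borel_measurable M"
      using V(1) that by (auto simp: indep_vars_def)
    have "prob (V j -` (- S) \<inter> space M) = measure (distr M lborel (V j)) (- S)"
      using S by (subst measure_distr) auto
    also have "\<dots> = measure lborel ({0..1} - S)"
      using S unfolding unif[OF that] measure_def by (simp add: Diff_eq divide_ennreal_def)
    also have "\<dots> = measure lborel {0..1::real} - measure lborel S"
      using S by (intro measure_Diff) auto
    finally show ?thesis by simp
  qed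
  moreover have "{\<omega> \<in> space M. \<forall>j\<in>J. V j \<omega> \<notin> S} = (\<Inter>j\<in>J. V j -` (- S) \<inter> space M)"
    using False by auto
  ultimately show ?thesis
    using indep_varsD_finite[OF V(1) False V(2), of "\<lambda>_. - S"] S by simp
qed (simp add: prob_space)

lemma (in prob_space) prob_hit:
  assumes V: "indep_vars (\<lambda>_. borel) V J" "finite J"
    and unif: "\<And>j. j \<in> J \<Longrightarrow> distr M lborel (V j) = uniform_measure lborel {0..1::real}"
    and A: "A \<in> sets borel" "A \<subseteq> {0..1}"
  shows "prob {\<omega> \<in> space M. \<exists>j\<in>J. V j \<omega> \<in> A} = 1 - (1 - measure lborel A) ^ card J"
proof -
  have [measurable]: "V j \<in> borel_measurable M" if "j \<in> J" for j
    using V(1) that by (auto simp: indep_vars_def)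
  have "{\<omega> \<in> space M. \<exists>j\<in>J. V j \<omega> \<in> A} = space M - {\<omega> \<in> space M. \<forall>j\<in>J. V j \<omega> \<notin> A}"
    by auto
  moreover have "{\<omega> \<in> space M. \<forall>j\<in>J. V j \<omega> \<notin> A} \<in> events" using A V(2) by measurable
  ultimately show ?thesis
    by (simp add: prob_compl prob_avoid[OF V unif A])
qed

text \<open>Hitting one set makes it less likely that the other is hit as well: avoiding both has
  probability \<open>(1 - a - b) ^ k \<le> (1 - a) ^ k (1 - b) ^ k\<close>. So the gaps to the left and to the right of a
  point can be treated as if they were independent.\<close>
lemma (in prob_space) prob_hit_both:
  assumes V: "indep_vars (\<lambda>_. borel) V J" "finite J"
    and unif: "\<And>j. j \<in> J \<Longrightarrow> distr M lborel (V j) = uniform_measure lborel {0..1::real}"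
    and A: "A \<in> sets borel" "A \<subseteq> {0..1}" and B: "B \<in> sets borel" "B \<subseteq> {0..1}"
    and "A \<inter> B = {}"
  shows "prob {\<omega> \<in> space M. (\<exists>j\<in>J. V j \<omega> \<in> A) \<and> (\<exists>j\<in>J. V j \<omega> \<in> B)}
    \<le> (1 - (1 - measure lborel A) ^ card J) * (1 - (1 - measure lborel B) ^ card J)"
proof -
  define a b where "a = measure lborel A" and "b = measure lborel B"
  have [measurable]: "V j \<in> borel_measurable M" if "j \<in> J" for j
    using V(1) that by (auto simp: indep_vars_def)
  have fm: "A \<in> fmeasurable lborel" "B \<in> fmeasurable lborel"
    by (rule fmeasurableI2[of "{0..1}"]; use A B in \<open>simp add: fmeasurable_def\<close>)+
  have AB: "measure lborel (A \<union> B) = a + b"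
    unfolding a_def b_def using fm assms(8) by (subst measure_Un3) auto
  have "measure lborel (A \<union> B) \<le> measure lborel {0..1::real}"
    using A B by (intro measure_mono_fmeasurable) (auto simp: fmeasurable_def)
  then have "a + b \<le> 1" by (simp add: AB)
  moreover have "0 \<le> a" "0 \<le> b" by (auto simp: a_def b_def)
  ultimately have power: "(1 - a - b) ^ card J \<le> (1 - a) ^ card J * (1 - b) ^ card J"
    unfolding power_mult_distrib[symmetric] by (intro power_mono) (auto simp: algebra_simps)
  let ?hit = "\<lambda>S. {\<omega> \<in> space M. \<exists>j\<in>J. V j \<omega> \<in> S}"
  have ev: "?hit S \<in> events" if "S \<in> sets borel" for S
    using that V(2) by measurable
  have "prob (?hit A \<union> ?hit B) = prob (?hit A) + prob (?hit B) - prob (?hit A \<inter> ?hit B)"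
    using ev A B by (intro measure_Un3) (auto simp: fmeasurable_eq_sets)
  moreover have "?hit A \<union> ?hit B = ?hit (A \<union> B)" by auto
  moreover have "?hit A \<inter> ?hit B = {\<omega> \<in> space M. (\<exists>j\<in>J. V j \<omega> \<in> A) \<and> (\<exists>j\<in>J. V j \<omega> \<in> B)}"
    by auto
  ultimately have "prob {\<omega> \<in> space M. (\<exists>j\<in>J. V j \<omega> \<in> A) \<and> (\<exists>j\<in>J. V j \<omega> \<in> B)}
      = 1 - (1 - a) ^ card J - (1 - b) ^ card J + (1 - a - b) ^ card J"
    using prob_hit[OF V unif A] prob_hit[OF V unif B] prob_hit[OF V unif, of "A \<union> B"] A B
    by (simp add: AB a_def b_def algebra_simps)
  with power show ?thesis by (simp add: a_def b_def algebra_simps)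
qed

text \<open>The cuts of different trees form independent blocks.\<close>
lemma (in prob_space) prob_trees_product:
  assumes U: "indep_vars (\<lambda>_. borel) (\<lambda>(l, j). U l j) (T \<times> J)" "finite T" "finite J"
    and Q: "Measurable.pred (PiM J (\<lambda>_. borel)) Q"
  shows "prob {\<omega> \<in> space M. \<forall>l\<in>T. Q (\<lambda>j\<in>J. U l j \<omega>)}
    = (\<Prod>l\<in>T. prob {\<omega> \<in> space M. Q (\<lambda>j\<in>J. U l j \<omega>)})"
proof (cases "T = {}")
  case False
  have "indep_vars (\<lambda>l. PiM ({l} \<times> J) (\<lambda>_. borel))
      (\<lambda>l \<omega>. restrict (\<lambda>i. (case i of (l, j) \<Rightarrow> U l j) \<omega>) ({l} \<times> J)) T"
    using U(1) by (rule indep_vars_restrict) (auto simp: disjoint_family_on_def)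
  then have "indep_vars (\<lambda>l. PiM J (\<lambda>_. borel))
      (\<lambda>l \<omega>. (\<lambda>f. \<lambda>j\<in>J. f (l, j)) (restrict (\<lambda>i. (case i of (l, j) \<Rightarrow> U l j) \<omega>) ({l} \<times> J))) T"
    by (rule indep_vars_compose2) (intro measurable_restrict measurable_component_singleton, simp)
  then have "indep_vars (\<lambda>l. PiM J (\<lambda>_. borel)) (\<lambda>l \<omega>. \<lambda>j\<in>J. U l j \<omega>) T"
    by (simp cong: restrict_cong)
  from indep_varsD_finite[OF this False U(2), of "\<lambda>_. {u \<in> space (PiM J (\<lambda>_. borel)). Q u}"]
  have "prob (\<Inter>l\<in>T. (\<lambda>\<omega>. \<lambda>j\<in>J. U l j \<omega>) -` {u \<in> space (PiM J (\<lambda>_. borel)). Q u} \<inter> space M)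
      = (\<Prod>l\<in>T. prob ((\<lambda>\<omega>. \<lambda>j\<in>J. U l j \<omega>) -` {u \<in> space (PiM J (\<lambda>_. borel)). Q u} \<inter> space M))"
    using Q by simp
  moreover have "(\<lambda>\<omega>. \<lambda>j\<in>J. U l j \<omega>) -` {u \<in> space (PiM J (\<lambda>_. borel)). Q u} \<inter> space M
      = {\<omega> \<in> space M. Q (\<lambda>j\<in>J. U l j \<omega>)}" for l
    by (auto simp: space_PiM)
  moreover have "(\<Inter>l\<in>T. {\<omega> \<in> space M. Q (\<lambda>j\<in>J. U l j \<omega>)})
      = {\<omega> \<in> space M. \<forall>l\<in>T. Q (\<lambda>j\<in>J. U l j \<omega>)}"
    using False by auto
  ultimately show ?thesis by (simp only:)
qed (simp add: prob_space)

text \<open>Layer-cake form of a mean of products. It turns a bound on the joint distribution function of two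
  lengths by a product into the corresponding bound on the mean of a product of decreasing functions.\<close>
lemma (in prob_space) nn_integral_mult_layers:
  fixes w :: "real \<Rightarrow> ennreal"
  assumes [measurable]: "w \<in> borel_measurable borel"
    and [measurable]: "Measurable.pred (M \<Otimes>\<^sub>M borel) (\<lambda>(\<omega>, a). P \<omega> a)"
    and [measurable]: "Measurable.pred (M \<Otimes>\<^sub>M borel) (\<lambda>(\<omega>, b). Q \<omega> b)"
    and le: "\<And>a b. 0 < a \<Longrightarrow> 0 < b \<Longrightarrow> prob {\<omega> \<in> space M. P \<omega> a \<and> Q \<omega> b} \<le> F a * G b"
    and nn: "\<And>a. 0 < a \<Longrightarrow> 0 \<le> F a" "\<And>b. 0 < b \<Longrightarrow> 0 \<le> G b"
    and [measurable]: "F \<in> borel_measurable borel" "G \<in> borel_measurable borel"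
  shows "(\<integral>\<^sup>+\<omega>. (\<integral>\<^sup>+a\<in>{0<..}. w a * indicator {a. P \<omega> a} a \<partial>lborel) *
            (\<integral>\<^sup>+b\<in>{0<..}. w b * indicator {b. Q \<omega> b} b \<partial>lborel) \<partial>M)
    \<le> (\<integral>\<^sup>+a\<in>{0<..}. w a * ennreal (F a) \<partial>lborel) * (\<integral>\<^sup>+b\<in>{0<..}. w b * ennreal (G b) \<partial>lborel)"
    (is "?lhs \<le> _")
proof -
  interpret L: pair_sigma_finite M lborel ..
  have [measurable]: "(\<lambda>(\<omega>, a). indicator {a. P \<omega> a} a :: ennreal) \<in> borel_measurable (M \<Otimes>\<^sub>M borel)"
    "(\<lambda>(\<omega>, b). indicator {b. Q \<omega> b} b :: ennreal) \<in> borel_measurable (M \<Otimes>\<^sub>M borel)"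
    unfolding indicator_def by measurable
  define p where "p \<omega> a = w a * indicator {a. P \<omega> a} a * indicator {0<..} a" for \<omega> a
  define r where "r \<omega> b = w b * indicator {b. Q \<omega> b} b * indicator {0<..} b" for \<omega> b
  have [measurable]: "(\<lambda>(\<omega>, a). p \<omega> a) \<in> borel_measurable (M \<Otimes>\<^sub>M borel)"
    "(\<lambda>(\<omega>, b). r \<omega> b) \<in> borel_measurable (M \<Otimes>\<^sub>M borel)"
    unfolding p_def r_def by measurable
  have [measurable]: "(\<lambda>\<omega>. p \<omega> a) \<in> borel_measurable M" "(\<lambda>b. r \<omega> b) \<in> borel_measurable borel" 
    "(\<lambda>\<omega>. r \<omega> a) \<in> borel_measurable M" "(\<lambda>b. p \<omega> b) \<in> borel_measurable borel" if "\<omega> \<in> space M" for a \<omega>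
    using that by measurable
  have "?lhs = (\<integral>\<^sup>+\<omega>. (\<integral>\<^sup>+a. p \<omega> a \<partial>lborel) * (\<integral>\<^sup>+b. r \<omega> b \<partial>lborel) \<partial>M)"
    by (simp add: p_def r_def)
  also have "\<dots> = (\<integral>\<^sup>+\<omega>. \<integral>\<^sup>+a. \<integral>\<^sup>+b. p \<omega> a * r \<omega> b \<partial>lborel \<partial>lborel \<partial>M)"
    by (intro nn_integral_cong) (simp add: nn_integral_cmult nn_integral_multc)
  also have "\<dots> = (\<integral>\<^sup>+a. \<integral>\<^sup>+\<omega>. \<integral>\<^sup>+b. p \<omega> a * r \<omega> b \<partial>lborel \<partial>M \<partial>lborel)"
    by (rule L.Fubini'[symmetric]) measurable
  also have "\<dots> = (\<integral>\<^sup>+a. \<integral>\<^sup>+b. \<integral>\<^sup>+\<omega>. p \<omega> a * r \<omega> b \<partial>M \<partial>lborel \<partial>lborel)"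
    by (intro nn_integral_cong L.Fubini'[symmetric]) measurable
  also have "\<dots> \<le> (\<integral>\<^sup>+a. \<integral>\<^sup>+b. (w a * ennreal (F a) * indicator {0<..} a) *
      (w b * ennreal (G b) * indicator {0<..} b) \<partial>lborel \<partial>lborel)"
  proof (intro nn_integral_mono)
    fix a b :: real
    show "(\<integral>\<^sup>+\<omega>. p \<omega> a * r \<omega> b \<partial>M) \<le>
        w a * ennreal (F a) * indicator {0<..} a * (w b * ennreal (G b) * indicator {0<..} b)"
    proof (cases "0 < a \<and> 0 < b")
      case True
      let ?E = "{\<omega> \<in> space M. P \<omega> a \<and> Q \<omega> b}"
      have "(\<integral>\<^sup>+\<omega>. p \<omega> a * r \<omega> b \<partial>M) = (\<integral>\<^sup>+\<omega>. w a * w b * indicator ?E \<omega> \<partial>M)"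
        using True by (intro nn_integral_cong) (auto simp: p_def r_def indicator_def)
      also have "\<dots> = w a * w b * emeasure M ?E"
        by (intro nn_integral_cmult_indicator) measurable
      also have "\<dots> \<le> w a * w b * ennreal (F a * G b)"
        using le[of a b] True by (intro mult_left_mono) (auto simp: emeasure_eq_measure intro: ennreal_leI)
      finally show ?thesis
        using True nn by (simp add: ennreal_mult' mult_ac)
    qed (auto simp: p_def r_def)
  qed
  also have "\<dots> = (\<integral>\<^sup>+a\<in>{0<..}. w a * ennreal (F a) \<partial>lborel) *
      (\<integral>\<^sup>+b\<in>{0<..}. w b * ennreal (G b) \<partial>lborel)"
    by (simp add: nn_integral_cmult nn_integral_multc)
  finally show ?thesis .
qed

section \<open>Laplace transforms of gaps\<close>

text \<open>The probability that \<open>k\<close> cuts leave a gap longer than \<open>a\<close> is \<open>(1 - a) ^ k\<close>. So up to \<open>\<delta>\<close>, a gap is stochastically at least as long as an exponential variable of rate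
  \<open>k / (1 - \<delta>)\<close>.\<close>
lemma one_minus_power_ge_exp:
  fixes a \<delta> :: real
  assumes "0 \<le> a" "a \<le> \<delta>" "\<delta> < 1"
  shows "exp (- (real k / (1 - \<delta>)) * a) \<le> (1 - a) ^ k"
proof -
  have "1 / (1 - a) = 1 + a / (1 - a)" using assms by (simp add: field_simps)
  also have "\<dots> \<le> exp (a / (1 - a))" by (rule exp_ge_add_one_self)
  also have "\<dots> \<le> exp (a / (1 - \<delta>))" using assms by (auto intro!: divide_left_mono)
  finally have "exp (- (a / (1 - \<delta>))) \<le> 1 - a"
    using assms by (simp add: exp_minus field_simps)
  then have "exp (- (a / (1 - \<delta>))) ^ k \<le> (1 - a) ^ k" by (intro power_mono) auto
  then show ?thesis by (simp add: exp_of_nat_mult[symmetric])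
qed

text \<open>Laplace transform, at \<open>t\<close>, of an exponential variable of rate \<open>\<kappa>\<close>.\<close>
definition exp_laplace :: "real \<Rightarrow> real \<Rightarrow> real" where
  "exp_laplace \<kappa> t = \<kappa> / (t + \<kappa>)"

text \<open>Laplace transform, at \<open>t\<close>, of the maximum of two independent exponential variables of rate \<open>\<kappa>\<close>.\<close>
definition max_exp_laplace :: "real \<Rightarrow> real \<Rightarrow> real" where
  "max_exp_laplace \<kappa> t = 2 * \<kappa>\<^sup>2 / ((t + \<kappa>) * (t + 2 * \<kappa>))"

lemma nn_integral_exp_tail:
  fixes t c :: real
  assumes "0 < t"
  shows "(\<integral>\<^sup>+a\<in>{c..}. ennreal (t * exp (- t * a)) \<partial>lborel) = ennreal (exp (- t * c))"
proof -
  have "((\<lambda>a. - exp (- t * a)) \<longlongrightarrow> 0) at_top"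
    using assms by real_asymp
  then have "(\<integral>\<^sup>+a\<in>{c..}. ennreal (t * exp (- t * a)) \<partial>lborel) = ennreal (0 - - exp (- t * c))"
    using assms by (intro nn_integral_FTC_atLeast) (auto intro!: derivative_eq_intros)
  then show ?thesis by simp
qed

lemma exp_decay: "((\<lambda>a. exp (- t * a)) \<longlongrightarrow> 0) at_top" if "0 < t" for t :: real
  using that by real_asymp

lemma DERIV_scaled_exp:
  fixes c s a :: real
  shows "DERIV (\<lambda>a. c * exp (- s * a)) a :> - (c * s * exp (- s * a))"
  by (auto intro!: derivative_eq_intros)

text \<open>Integration by parts expresses the Laplace transform through the distribution function.\<close>
lemma exp_laplace_eq:
  fixes t \<kappa> :: real
  assumes "0 < t" "0 < \<kappa>"
  shows "(\<integral>\<^sup>+a\<in>{0..}. ennreal (t * exp (- t * a) * (1 - exp (- \<kappa> * a))) \<partial>lborel) = ennreal (exp_laplace \<kappa> t)"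
proof -
  define F where "F a = - exp (- t * a) + t / (t + \<kappa>) * exp (- (t + \<kappa>) * a)" for a
  have "(F \<longlongrightarrow> 0) at_top"
    using tendsto_add[OF tendsto_minus[OF exp_decay[of t]]
        tendsto_mult_left[OF exp_decay[of "t + \<kappa>"], of "t / (t + \<kappa>)"]] assms
    unfolding F_def by simp
  moreover have "DERIV F a :> t * exp (- t * a) * (1 - exp (- \<kappa> * a))" for a
  proof -
    have "DERIV F a :> t * exp (- t * a) - t / (t + \<kappa>) * (t + \<kappa>) * exp (- (t + \<kappa>) * a)"
      using DERIV_add[OF DERIV_minus[OF DERIV_scaled_exp[of 1 t a]]
        DERIV_scaled_exp[of "t / (t + \<kappa>)" "t + \<kappa>" a]] unfolding F_def by simp
    also have "exp (- (t + \<kappa>) * a) = exp (- t * a) * exp (- \<kappa> * a)"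
      by (simp add: exp_add[symmetric] algebra_simps)
    also have "t / (t + \<kappa>) * (t + \<kappa>) = t" using assms by simp
    finally show ?thesis by (simp add: algebra_simps)
  qed
  ultimately have "(\<integral>\<^sup>+a\<in>{0..}. ennreal (t * exp (- t * a) * (1 - exp (- \<kappa> * a))) \<partial>lborel) = ennreal (0 - F 0)"
    using assms by (intro nn_integral_FTC_atLeast) auto
  also have "0 - F 0 = exp_laplace \<kappa> t" using assms by (simp add: F_def exp_laplace_def field_simps)
  finally show ?thesis .
qed

lemma max_exp_laplace_eq:
  fixes t \<kappa> :: real
  assumes "0 < t" "0 < \<kappa>"
  shows "(\<integral>\<^sup>+a\<in>{0..}. ennreal (t * exp (- t * a) * (1 - exp (- \<kappa> * a))\<^sup>2) \<partial>lborel) = ennreal (max_exp_laplace \<kappa> t)"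
proof -
  define F where "F a = - exp (- t * a) + 2 * t / (t + \<kappa>) * exp (- (t + \<kappa>) * a)
     - t / (t + 2 * \<kappa>) * exp (- (t + 2 * \<kappa>) * a)" for a
  have "(F \<longlongrightarrow> 0) at_top"
    using tendsto_diff[OF tendsto_add[OF tendsto_minus[OF exp_decay[of t]]
        tendsto_mult_left[OF exp_decay[of "t + \<kappa>"], of "2 * t / (t + \<kappa>)"]]
        tendsto_mult_left[OF exp_decay[of "t + 2 * \<kappa>"], of "t / (t + 2 * \<kappa>)"]] assms
    unfolding F_def by simp
  moreover have "DERIV F a :> t * exp (- t * a) * (1 - exp (- \<kappa> * a))\<^sup>2" for a
  proof -
    have "DERIV F a :> t * exp (- t * a) - 2 * t / (t + \<kappa>) * (t + \<kappa>) * exp (- (t + \<kappa>) * a)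
        + t / (t + 2 * \<kappa>) * (t + 2 * \<kappa>) * exp (- (t + 2 * \<kappa>) * a)"
      using DERIV_diff[OF DERIV_add[OF DERIV_minus[OF DERIV_scaled_exp[of 1 t a]]
        DERIV_scaled_exp[of "2 * t / (t + \<kappa>)" "t + \<kappa>" a]]
        DERIV_scaled_exp[of "t / (t + 2 * \<kappa>)" "t + 2 * \<kappa>" a]] unfolding F_def by simp
    also have "2 * t / (t + \<kappa>) * (t + \<kappa>) = 2 * t" using assms by simp
    also have "t / (t + 2 * \<kappa>) * (t + 2 * \<kappa>) = t" using assms by simp
    also have "exp (- (t + \<kappa>) * a) = exp (- t * a) * exp (- \<kappa> * a)"
      by (simp add: exp_add[symmetric] algebra_simps)
    also have "exp (- (t + 2 * \<kappa>) * a) = exp (- t * a) * (exp (- \<kappa> * a))\<^sup>2"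
      by (simp add: exp_add[symmetric] algebra_simps exp_double[symmetric])
    finally show ?thesis by (simp add: algebra_simps power2_eq_square)
  qed
  ultimately have "(\<integral>\<^sup>+a\<in>{0..}. ennreal (t * exp (- t * a) * (1 - exp (- \<kappa> * a))\<^sup>2) \<partial>lborel) = ennreal (0 - F 0)"
    using assms by (intro nn_integral_FTC_atLeast) auto
  also have "0 - F 0 = max_exp_laplace \<kappa> t"
    using assms by (simp add: F_def max_exp_laplace_def divide_simps add_nonneg_eq_0_iff) (simp add: algebra_simps power2_eq_square)
  finally show ?thesis .
qed

lemma max_exp_laplace_le_exp_laplace:
  assumes "0 \<le> t" "0 < \<kappa>"
  shows "max_exp_laplace \<kappa> t \<le> exp_laplace \<kappa> t"
proof -
  have "max_exp_laplace \<kappa> t = exp_laplace \<kappa> t * (2 * \<kappa> / (t + 2 * \<kappa>))"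
    using assms by (simp add: exp_laplace_def max_exp_laplace_def power2_eq_square)
  also have "\<dots> \<le> exp_laplace \<kappa> t * 1"
    using assms by (intro mult_left_mono) (auto simp: exp_laplace_def)
  finally show ?thesis by simp
qed

text \<open>The constant \<open>4 / 3\<close> is a convenient rational below \<open>sqrt 2\<close>, the largest \<open>c\<close> with
  \<open>(t + c \<kappa>)\<^sup>2 \<le> (t + \<kappa>) (t + 2 \<kappa>)\<close>. A pure power is easy to integrate and costs little: it
  yields \<open>9 / 16\<close> below where the exact value is \<open>6 - 8 ln 2\<close>.\<close>
lemma max_exp_laplace_le_square:
  assumes "0 \<le> t" "0 < \<kappa>"
  shows "max_exp_laplace \<kappa> t \<le> 2 * \<kappa>\<^sup>2 / (t + 4 / 3 * \<kappa>)\<^sup>2"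
proof -
  have "(t + 4 / 3 * \<kappa>)\<^sup>2 + \<kappa> * t / 3 + 2 / 9 * \<kappa>\<^sup>2 = (t + \<kappa>) * (t + 2 * \<kappa>)"
    by (simp add: power2_eq_square field_simps)
  moreover have "0 \<le> \<kappa> * t" using assms by simp
  ultimately have "(t + 4 / 3 * \<kappa>)\<^sup>2 \<le> (t + \<kappa>) * (t + 2 * \<kappa>)"
    using zero_le_power2[of \<kappa>] by linarith
  moreover have "0 < t + 4 / 3 * \<kappa>" using assms by simp
  ultimately show ?thesis
    unfolding max_exp_laplace_def using assms
    by (intro divide_left_mono mult_pos_pos zero_less_power) auto
qed

lemma nn_integral_inverse_power:
  fixes a :: real and m :: nat
  assumes "0 < a"
  shows "(\<integral>\<^sup>+t\<in>{0..}. ennreal (1 / (t + a) ^ (m + 2)) \<partial>lborel) = ennreal (1 / (real (m + 1) * a ^ (m + 1)))"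
proof -
  define F where "F t = - (1 / real (m + 1)) * inverse (t + a) ^ (m + 1)" for t
  have "((\<lambda>t. inverse (t + a)) \<longlongrightarrow> 0) at_top"
    by real_asymp
  then have "((\<lambda>t. inverse (t + a) ^ (m + 1)) \<longlongrightarrow> 0) at_top"
    using tendsto_power[of "\<lambda>t. inverse (t + a)" 0 at_top "m + 1"] by simp
  then have "(F \<longlongrightarrow> 0) at_top"
    unfolding F_def by (rule tendsto_mult_right_zero)
  moreover have "DERIV F t :> 1 / (t + a) ^ (m + 2)" if "0 \<le> t" for t
  proof -
    have "t + a \<noteq> 0" using that assms by simp
    then have "DERIV (\<lambda>t. inverse (t + a)) t :> - (inverse (t + a))\<^sup>2"
      by (auto intro!: derivative_eq_intros simp: power2_eq_square)
    from DERIV_cmult[OF DERIV_power[OF this, of "m + 1"], of "- (1 / real (m + 1))"]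
    have "DERIV F t :> - (1 / real (m + 1)) * (real (m + 1) * (- (inverse (t + a))\<^sup>2 * inverse (t + a) ^ m))"
      unfolding F_def by simp
    also have "- (1 / real (m + 1)) * (real (m + 1) * (- (inverse (t + a))\<^sup>2 * inverse (t + a) ^ m))
        = 1 / (t + a) ^ (m + 2)"
      by (simp add: field_simps power_add power2_eq_square del: of_nat_add of_nat_Suc)
    finally show ?thesis .
  qed
  ultimately have "(\<integral>\<^sup>+t\<in>{0..}. ennreal (1 / (t + a) ^ (m + 2)) \<partial>lborel) = ennreal (0 - F 0)"
    using assms by (intro nn_integral_FTC_atLeast) auto
  then show ?thesis by (simp add: F_def field_simps)
qed

lemma nn_integral_exp_laplace_square:
  assumes "0 < \<kappa>"
  shows "(\<integral>\<^sup>+t\<in>{0..}. ennreal ((exp_laplace \<kappa> t)\<^sup>2) \<partial>lborel) = ennreal \<kappa>"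
proof -
  have "(\<integral>\<^sup>+t\<in>{0..}. ennreal ((exp_laplace \<kappa> t)\<^sup>2) \<partial>lborel) =
      (\<integral>\<^sup>+t. ennreal (\<kappa>\<^sup>2) * (ennreal (1 / (t + \<kappa>) ^ (0 + 2)) * indicator {0..} t) \<partial>lborel)"
    by (intro nn_integral_cong) (auto simp: exp_laplace_def indicator_def ennreal_mult[symmetric] power_divide power2_eq_square)
  also have "\<dots> = ennreal (\<kappa>\<^sup>2) * ennreal (1 / (real (0 + 1) * \<kappa> ^ (0 + 1)))"
    by (subst nn_integral_cmult) (auto simp only: nn_integral_inverse_power[OF assms], measurable)
  also have "\<dots> = ennreal \<kappa>"
    using assms by (simp add: ennreal_mult[symmetric] power2_eq_square)
  finally show ?thesis .
qed

text \<open>The first integral is the mean inverse of the sum of two independent maxima of two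
  exponential variables, which models the length of the union of two cells. The constant \<open>9 / 16\<close> is the
  source of the final constant \<open>3 / 4\<close>.\<close>
lemma nn_integral_max_exp_laplace_square:
  assumes "0 < \<kappa>"
  shows "(\<integral>\<^sup>+t\<in>{0..}. ennreal ((max_exp_laplace \<kappa> t)\<^sup>2) \<partial>lborel) \<le> ennreal (9 / 16 * \<kappa>)"
    and "(\<integral>\<^sup>+t\<in>{0..}. ennreal (t * (max_exp_laplace \<kappa> t)\<^sup>2) \<partial>lborel) \<le> ennreal (9 / 8 * \<kappa>\<^sup>2)"
proof -
  have sq: "(max_exp_laplace \<kappa> t)\<^sup>2 \<le> 4 * \<kappa> ^ 4 * (1 / (t + 4 / 3 * \<kappa>) ^ 4)" if "0 \<le> t" for t
  proof -
    have "(max_exp_laplace \<kappa> t)\<^sup>2 \<le> (2 * \<kappa>\<^sup>2 / (t + 4 / 3 * \<kappa>)\<^sup>2)\<^sup>2"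
      using that assms by (intro power_mono max_exp_laplace_le_square) (auto simp: max_exp_laplace_def)
    then show ?thesis by (simp add: power_divide power_mult_distrib)
  qed
  have "(\<integral>\<^sup>+t\<in>{0..}. ennreal ((max_exp_laplace \<kappa> t)\<^sup>2) \<partial>lborel) \<le>
      (\<integral>\<^sup>+t. ennreal (4 * \<kappa> ^ 4) * (ennreal (1 / (t + 4 / 3 * \<kappa>) ^ (2 + 2)) * indicator {0..} t) \<partial>lborel)"
    by (intro nn_integral_mono)
       (use sq assms in \<open>auto simp: indicator_def ennreal_mult[symmetric] intro!: ennreal_leI\<close>)
  also have "\<dots> = ennreal (4 * \<kappa> ^ 4) * ennreal (1 / (real (2 + 1) * (4 / 3 * \<kappa>) ^ (2 + 1)))"
    using assms by (subst nn_integral_cmult) (auto simp only: nn_integral_inverse_power, measurable)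
  also have "\<dots> = ennreal (9 / 16 * \<kappa>)"
    using assms by (simp add: ennreal_mult[symmetric] power_mult_distrib power_divide eval_nat_numeral)
  finally show "(\<integral>\<^sup>+t\<in>{0..}. ennreal ((max_exp_laplace \<kappa> t)\<^sup>2) \<partial>lborel) \<le> ennreal (9 / 16 * \<kappa>)" .
  have sq': "t * (max_exp_laplace \<kappa> t)\<^sup>2 \<le> 4 * \<kappa> ^ 4 * (1 / (t + 4 / 3 * \<kappa>) ^ 3)" if "0 \<le> t" for t
  proof -
    have "t * (max_exp_laplace \<kappa> t)\<^sup>2 \<le> (t + 4 / 3 * \<kappa>) * (4 * \<kappa> ^ 4 * (1 / (t + 4 / 3 * \<kappa>) ^ 4))"
      using that assms by (intro mult_mono sq) auto
    also have "\<dots> = 4 * \<kappa> ^ 4 * (1 / (t + 4 / 3 * \<kappa>) ^ 3)"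
      using that assms by (simp add: eval_nat_numeral)
    finally show ?thesis .
  qed
  have "(\<integral>\<^sup>+t\<in>{0..}. ennreal (t * (max_exp_laplace \<kappa> t)\<^sup>2) \<partial>lborel) \<le>
      (\<integral>\<^sup>+t. ennreal (4 * \<kappa> ^ 4) * (ennreal (1 / (t + 4 / 3 * \<kappa>) ^ (1 + 2)) * indicator {0..} t) \<partial>lborel)"
    by (intro nn_integral_mono)
       (use sq' assms in \<open>auto simp: indicator_def ennreal_mult[symmetric] power3_eq_cube mult.assoc intro!: ennreal_leI\<close>)
  also have "\<dots> = ennreal (4 * \<kappa> ^ 4) * ennreal (1 / (real (1 + 1) * (4 / 3 * \<kappa>) ^ (1 + 1)))"
    using assms by (subst nn_integral_cmult) (auto simp only: nn_integral_inverse_power, measurable)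
  also have "\<dots> = ennreal (9 / 8 * \<kappa>\<^sup>2)"
    using assms by (simp add: ennreal_mult[symmetric] power_mult_distrib power_divide eval_nat_numeral)
  finally show "(\<integral>\<^sup>+t\<in>{0..}. ennreal (t * (max_exp_laplace \<kappa> t)\<^sup>2) \<partial>lborel) \<le> ennreal (9 / 8 * \<kappa>\<^sup>2)" .
qed

text \<open>Used near the ends of the unit interval, where only half a power of \<open>\<kappa>\<close> is affordable.\<close>
lemma exp_laplace_le_sqrt:
  assumes "0 < t" "0 < \<kappa>"
  shows "exp_laplace \<kappa> t \<le> sqrt \<kappa> / (2 * sqrt t)"
proof -
  have "2 * (sqrt t * sqrt \<kappa>) \<le> t + \<kappa>"
    using sum_squares_bound[of "sqrt t" "sqrt \<kappa>"] assms by simp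
  then have "\<kappa> / (t + \<kappa>) \<le> \<kappa> / (2 * (sqrt t * sqrt \<kappa>))"
    using assms by (intro divide_left_mono) auto
  also have "\<dots> = sqrt \<kappa> / (2 * sqrt t)"
    using assms by (simp add: field_simps)
  finally show ?thesis by (simp add: exp_laplace_def)
qed

text \<open>Near an end of the unit interval a cell may be cut off on one side, and then only the other gap
  makes it long. The factor \<open>min 1 (1 / (t \<delta>))\<close> is the proportion of such points at scale \<open>1 / t\<close>. The
  result grows like \<open>sqrt \<kappa>\<close>, which is negligible against \<open>\<kappa>\<close>.\<close>
lemma nn_integral_exp_laplace_boundary:
  assumes "0 < \<kappa>" "0 < \<delta>"
  shows "(\<integral>\<^sup>+t\<in>{0<..}. ennreal (exp_laplace \<kappa> t * min 1 (1 / (t * \<delta>))) \<partial>lborel) \<le> ennreal (1 + sqrt \<kappa> / \<delta>)"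
proof -
  define F where "F t = - (sqrt \<kappa> / \<delta>) / sqrt t" for t
  define f where "f t = sqrt \<kappa> / \<delta> / (2 * t * sqrt t)" for t :: real
  have [measurable]: "f \<in> borel_measurable borel"
    unfolding f_def[abs_def] by measurable
  have "(F \<longlongrightarrow> 0) at_top" unfolding F_def using assms by real_asymp
  moreover have "DERIV F t :> f t" if "1 \<le> t" for t
    unfolding F_def f_def using that assms
    by (auto intro!: derivative_eq_intros simp: field_simps power2_eq_square)
  ultimately have F: "(\<integral>\<^sup>+t\<in>{1..}. ennreal (f t) \<partial>lborel) = ennreal (0 - F 1)"
    using assms by (intro nn_integral_FTC_atLeast) (auto simp: f_def)
  have "(\<integral>\<^sup>+t\<in>{0<..}. ennreal (exp_laplace \<kappa> t * min 1 (1 / (t * \<delta>))) \<partial>lborel) \<le>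
      (\<integral>\<^sup>+t. indicator {0..1} t + ennreal (f t) * indicator {1..} t \<partial>lborel)"
  proof (intro nn_integral_mono)
    fix t :: real
    have "exp_laplace \<kappa> t * min 1 (1 / (t * \<delta>)) \<le> 1 * 1" if "0 < t"
      using that assms by (intro mult_mono) (auto simp: exp_laplace_def)
    moreover have "exp_laplace \<kappa> t * min 1 (1 / (t * \<delta>)) \<le> f t" if "1 \<le> t"
    proof -
      have "exp_laplace \<kappa> t * min 1 (1 / (t * \<delta>)) \<le> sqrt \<kappa> / (2 * sqrt t) * (1 / (t * \<delta>))"
        using that assms by (intro mult_mono exp_laplace_le_sqrt) auto
      then show ?thesis by (simp add: f_def mult_ac)
    qed
    ultimately show "ennreal (exp_laplace \<kappa> t * min 1 (1 / (t * \<delta>))) * indicator {0<..} t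
        \<le> indicator {0..1} t + ennreal (f t) * indicator {1..} t"
      by (cases "t \<le> 0"; cases "t < 1") (auto intro: ennreal_leI add_increasing)
  qed
  also have "\<dots> = 1 + ennreal (sqrt \<kappa> / \<delta>)"
    by (subst nn_integral_add) (auto simp: F F_def)
  also have "\<dots> = ennreal (1 + sqrt \<kappa> / \<delta>)"
    using assms by (simp add: ennreal_plus flip: ennreal_1)
  finally show ?thesis .
qed

lemma nn_integral_exp_unit_le:
  assumes "0 < t" "0 < \<delta>"
  shows "(\<integral>\<^sup>+x\<in>{0..1}. ennreal (exp (- t * (\<delta> * x))) \<partial>lborel) \<le> ennreal (min 1 (1 / (t * \<delta>)))"
proof -
  have "(\<integral>\<^sup>+x\<in>{0..1}. ennreal (exp (- t * (\<delta> * x))) \<partial>lborel) \<le> (\<integral>\<^sup>+x. indicator {0..1::real} x \<partial>lborel)"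
    using assms by (intro nn_integral_mono) (auto simp: indicator_def)
  moreover have "(\<integral>\<^sup>+x\<in>{0..1}. ennreal (exp (- t * (\<delta> * x))) \<partial>lborel)
      = ennreal (- exp (- t * (\<delta> * 1)) / (t * \<delta>) - - exp (- t * (\<delta> * 0)) / (t * \<delta>))"
    using assms by (intro interval_FTC) (auto intro!: derivative_eq_intros)
  moreover have "\<dots> \<le> ennreal (1 / (t * \<delta>))"
    using assms by (intro ennreal_leI) (auto simp: divide_simps)
  ultimately show ?thesis by (simp add: min_def)
qed

lemma nn_integral_reflect_unit:
  "(\<integral>\<^sup>+x\<in>{0..1}. f (1 - x) \<partial>lborel) = (\<integral>\<^sup>+x\<in>{0..1::real}. f x \<partial>lborel)"
  if [measurable]: "f \<in> borel_measurable borel"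
proof -
  have "(\<integral>\<^sup>+x. f x * indicator {0..1} x \<partial>lborel)
      = ennreal \<bar>- 1\<bar> * (\<integral>\<^sup>+x. f (1 + - 1 * x) * indicator {0..1} (1 + - 1 * x) \<partial>lborel)"
    by (rule nn_integral_real_affine) auto
  then show ?thesis by (auto simp: indicator_def intro!: nn_integral_cong)
qed

section \<open>Lengths of merged cells\<close>

lemma bex_restrict_iff: "(\<exists>j\<in>J. restrict f J j \<in> S) \<longleftrightarrow> (\<exists>j\<in>J. f j \<in> S)"
  by auto

text \<open>One sample size. All random variables are collected in one family indexed by their sources. The
  density is taken on the whole line, bounded below by \<open>m\<close>, and it varies by a factor of at most
  \<open>10 / 9\<close> over distances up to \<open>\<delta>\<close>; the constants \<open>9 / 10\<close> and \<open>1 / 10\<close> are chosen such that the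
  losses they cause still fit under \<open>3 / 4\<close>.\<close>
locale forest_model = prob_space M
  for M :: "'w measure" +
  fixes Z :: "source \<Rightarrow> 'w \<Rightarrow> real" and n k q :: nat and \<mu> :: "real \<Rightarrow> real" and m \<delta> :: real
  assumes indep: "indep_vars (\<lambda>_. borel) Z (sources n k q)"
    and size_pos: "1 \<le> n" "1 \<le> k" "1 \<le> q"
    and design_density: "\<And>i. i \<in> {1..n} \<Longrightarrow>
      distributed M lborel (Z (Design i)) (\<lambda>x. ennreal (\<mu> x * indicator {0..1} x))"
    and point_density: "distributed M lborel (Z New_Point) (\<lambda>x. ennreal (\<mu> x * indicator {0..1} x))"
    and cut_uniform: "\<And>l j. l \<in> {1..q} \<Longrightarrow> j \<in> {1..k} \<Longrightarrow>
      distr M lborel (Z (Cut l j)) = uniform_measure lborel {0..1}"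
    and density_measurable [measurable]: "\<mu> \<in> borel_measurable borel"
    and density_pos: "0 < m" "\<And>x. m \<le> \<mu> x"
    and scale: "0 < \<delta>" "\<delta> \<le> 1 / 10"
    and density_local: "\<And>x y. \<bar>x - y\<bar> \<le> \<delta> \<Longrightarrow> 9 / 10 * \<mu> x \<le> \<mu> y"
begin

definition rate :: real where "rate = real k / (1 - \<delta>)"

lemma rate_pos: "0 < rate"
  using scale size_pos by (simp add: rate_def)

lemma density_gt_0: "0 < \<mu> x"
  using density_pos(1) density_pos(2)[of x] by linarith

definition cuts :: "nat set \<Rightarrow> source set" where
  "cuts T = (\<lambda>(l, j). Cut l j) ` (T \<times> {1..k})"

text \<open>The union of the cells of the same point in several trees. The variance involves it for one tree
  and for two trees; both cases are treated together.\<close>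
definition merged_cell :: "nat set \<Rightarrow> (nat \<Rightarrow> nat \<Rightarrow> real) \<Rightarrow> real \<Rightarrow> real set" where
  "merged_cell T u x = (\<Union>l\<in>T. cell_of k (u l) x)"

abbreviation the_cuts :: "'w \<Rightarrow> nat \<Rightarrow> nat \<Rightarrow> real" where
  "the_cuts \<omega> \<equiv> \<lambda>l j. Z (Cut l j) \<omega>"

abbreviation the_design :: "'w \<Rightarrow> nat \<Rightarrow> real" where
  "the_design \<omega> \<equiv> \<lambda>i. Z (Design i) \<omega>"

lemma source_measurable: "v \<in> sources n k q \<Longrightarrow> Z v \<in> borel_measurable M"
  using indep by (auto simp: indep_vars_def)

lemma design_measurable [measurable]: "i \<in> {1..n} \<Longrightarrow> Z (Design i) \<in> borel_measurable M"
  by (rule source_measurable) (auto simp: sources_def)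

lemma point_measurable [measurable]: "Z New_Point \<in> borel_measurable M"
  by (rule source_measurable) (auto simp: sources_def)

lemma cut_measurable: "l \<in> {1..q} \<Longrightarrow> j \<in> {1..k} \<Longrightarrow> Z (Cut l j) \<in> borel_measurable M"
  by (rule source_measurable) (auto simp: sources_def)

lemma cell_of_borel [measurable]: "cell_of k v x \<in> sets borel"
  unfolding cell_of_def by measurable

lemma merged_cell_borel: "finite T \<Longrightarrow> merged_cell T u x \<in> sets borel"
  unfolding merged_cell_def by (intro sets.finite_UN) auto

text \<open>The events that the merged cell ends within distance \<open>a\<close> on the left of \<open>x\<close>, respectively
  within \<open>b\<close> on the right: every tree has a cut there. Beyond the truncation lengths
  \<open>\<delta> x\<close> and \<open>\<delta> (1 - x)\<close> the events always hold. These lengths keep all points inside the unit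
  interval and within \<open>\<delta>\<close> of \<open>x\<close>, where the density is under control, and they add up to \<open>\<delta>\<close>
  for every \<open>x\<close>.\<close>
definition left_hit :: "nat set \<Rightarrow> (nat \<Rightarrow> nat \<Rightarrow> real) \<Rightarrow> real \<Rightarrow> real \<Rightarrow> bool" where
  "left_hit T u x a \<longleftrightarrow> \<delta> * x < a \<or> (\<forall>l\<in>T. \<exists>j\<in>{1..k}. x - a \<le> u l j \<and> u l j < x)"

definition right_hit :: "nat set \<Rightarrow> (nat \<Rightarrow> nat \<Rightarrow> real) \<Rightarrow> real \<Rightarrow> real \<Rightarrow> bool" where
  "right_hit T u x b \<longleftrightarrow> \<delta> * (1 - x) < b \<or> (\<forall>l\<in>T. \<exists>j\<in>{1..k}. x \<le> u l j \<and> u l j < x + b)"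

definition left_part :: "nat set \<Rightarrow> (nat \<Rightarrow> nat \<Rightarrow> real) \<Rightarrow> real \<Rightarrow> real set" where
  "left_part T u x = merged_cell T u x \<inter> {x - \<delta> * x<..x}"

definition right_part :: "nat set \<Rightarrow> (nat \<Rightarrow> nat \<Rightarrow> real) \<Rightarrow> real \<Rightarrow> real set" where
  "right_part T u x = merged_cell T u x \<inter> {x<..x + \<delta> * (1 - x)}"

text \<open>Passage from the length \<open>\<alpha>\<close> of an arm to events about cuts: layers above \<open>\<alpha>\<close> carry exactly
  the mass \<open>exp (- t \<alpha>)\<close>, and on these layers the event occurs.\<close>
lemma exp_length_le_layers:
  fixes t \<alpha> :: real
  assumes "0 < t" "0 \<le> \<alpha>" and hit: "\<And>a. \<alpha> < a \<Longrightarrow> P a"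
  shows "ennreal (exp (- t * \<alpha>)) \<le> (\<integral>\<^sup>+a\<in>{0<..}. ennreal (t * exp (- t * a)) * indicator {a. P a} a \<partial>lborel)"
proof -
  have "ennreal (exp (- t * \<alpha>)) = (\<integral>\<^sup>+a\<in>{\<alpha>..}. ennreal (t * exp (- t * a)) \<partial>lborel)"
    using nn_integral_exp_tail[OF \<open>0 < t\<close>] by simp
  also have "\<dots> \<le> (\<integral>\<^sup>+a\<in>{0<..}. ennreal (t * exp (- t * a)) * indicator {a. P a} a \<partial>lborel)"
    using AE_lborel_singleton[of \<alpha>]
    by (intro nn_integral_mono_AE, eventually_elim) (use assms in \<open>auto simp: indicator_def\<close>)
  finally show ?thesis .
qed

lemma left_part_fmeasurable: "finite T \<Longrightarrow> left_part T u x \<in> fmeasurable lborel"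
  by (rule fmeasurableI2[of "{x - \<delta> * x..x}"])
     (auto simp: left_part_def fmeasurable_def emeasure_lborel_Icc_eq intro: merged_cell_borel)

lemma right_part_fmeasurable: "finite T \<Longrightarrow> right_part T u x \<in> fmeasurable lborel"
  by (rule fmeasurableI2[of "{x..x + \<delta> * (1 - x)}"])
     (auto simp: right_part_def fmeasurable_def emeasure_lborel_Icc_eq intro: merged_cell_borel)

text \<open>If some tree has no cut in the interval of length \<open>a\<close> to the left of \<open>x\<close>, its cell contains that
  interval.\<close>
lemma left_length_hit:
  assumes x: "0 \<le> x" "x \<le> 1" and T: "finite T" and a: "measure lborel (left_part T u x) < a"
  shows "left_hit T u x a"
proof (rule ccontr)
  assume "\<not> left_hit T u x a"
  then obtain l where a': "a \<le> \<delta> * x" and l: "l \<in> T" "\<forall>j\<in>{1..k}. u l j < x - a \<or> x \<le> u l j"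
    by (auto simp: left_hit_def not_le not_less)
  have "0 < a" using a measure_nonneg[of lborel "left_part T u x"] by linarith
  have "\<delta> * x \<le> x" using x scale mult_right_mono[of \<delta> 1 x] by simp
  have "{x - a<..x} \<subseteq> cell_of k (u l) x"
  proof
    fix y assume y: "y \<in> {x - a<..x}"
    then have "0 < y" "y \<le> 1" using a' \<open>\<delta> * x \<le> x\<close> x by auto
    moreover have "u l j < x \<longleftrightarrow> u l j < y" if "j \<in> {1..k}" for j
      using bspec[OF l(2) that] y by auto
    ultimately show "y \<in> cell_of k (u l) x" by (simp add: cell_of_def)
  qed
  then have "{x - a<..x} \<subseteq> left_part T u x"
    using l(1) a' by (auto simp: left_part_def merged_cell_def)
  then have "measure lborel {x - a<..x} \<le> measure lborel (left_part T u x)"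
    using left_part_fmeasurable[OF T] by (intro measure_mono_fmeasurable) auto
  then show False using a \<open>0 < a\<close> by simp
qed

lemma right_length_hit:
  assumes x: "0 \<le> x" "x \<le> 1" and T: "finite T" and a: "measure lborel (right_part T u x) < a"
  shows "right_hit T u x a"
proof (rule ccontr)
  assume "\<not> right_hit T u x a"
  then obtain l where a': "a \<le> \<delta> * (1 - x)" and l: "l \<in> T" "\<forall>j\<in>{1..k}. u l j < x \<or> x + a \<le> u l j"
    by (auto simp: right_hit_def not_le not_less)
  have "0 < a" using a measure_nonneg[of lborel "right_part T u x"] by linarith
  have "\<delta> * (1 - x) \<le> 1 - x" using x scale mult_right_mono[of \<delta> 1 "1 - x"] by simp
  have "{x<..x + a} \<subseteq> cell_of k (u l) x"
  proof
    fix y assume y: "y \<in> {x<..x + a}"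
    then have "0 < y" "y \<le> 1" using a' \<open>\<delta> * (1 - x) \<le> 1 - x\<close> x by auto
    moreover have "u l j < x \<longleftrightarrow> u l j < y" if "j \<in> {1..k}" for j
      using bspec[OF l(2) that] y by auto
    ultimately show "y \<in> cell_of k (u l) x" by (simp add: cell_of_def)
  qed
  then have "{x<..x + a} \<subseteq> right_part T u x"
    using l(1) a' by (auto simp: right_part_def merged_cell_def)
  then have "measure lborel {x<..x + a} \<le> measure lborel (right_part T u x)"
    using right_part_fmeasurable[OF T] by (intro measure_mono_fmeasurable) auto
  then show False using a \<open>0 < a\<close> by simp
qed

lemma cuts_indep:
  assumes "T \<subseteq> {1..q}"
  shows "indep_vars (\<lambda>_. borel) (\<lambda>(l, j). Z (Cut l j)) (T \<times> {1..k})"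
proof -
  have "indep_vars (\<lambda>p. PiM {Cut (fst p) (snd p)} (\<lambda>_. borel))
      (\<lambda>p \<omega>. restrict (\<lambda>v. Z v \<omega>) {Cut (fst p) (snd p)}) (T \<times> {1..k})"
    using indep assms
    by (intro indep_vars_restrict) (auto simp: sources_def disjoint_family_on_def)
  then have "indep_vars (\<lambda>_. borel)
      (\<lambda>p \<omega>. (\<lambda>f. f (Cut (fst p) (snd p))) (restrict (\<lambda>v. Z v \<omega>) {Cut (fst p) (snd p)})) (T \<times> {1..k})"
    by (rule indep_vars_compose2) simp
  then show ?thesis by (simp add: case_prod_beta')
qed

lemma tree_indep: "l \<in> {1..q} \<Longrightarrow> indep_vars (\<lambda>_. borel) (\<lambda>j. Z (Cut l j)) {1..k}"
proof -
  assume l: "l \<in> {1..q}"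
  have "indep_vars (\<lambda>j. PiM {Cut l j} (\<lambda>_. borel)) (\<lambda>j \<omega>. restrict (\<lambda>v. Z v \<omega>) {Cut l j}) {1..k}"
    using indep l by (intro indep_vars_restrict) (auto simp: sources_def disjoint_family_on_def)
  then have "indep_vars (\<lambda>_. borel) (\<lambda>j \<omega>. (\<lambda>f. f (Cut l j)) (restrict (\<lambda>v. Z v \<omega>) {Cut l j})) {1..k}"
    by (rule indep_vars_compose2) simp
  then show ?thesis by simp
qed

lemma prob_trees:
  assumes T: "T \<subseteq> {1..q}" and Q: "Measurable.pred (PiM {1..k} (\<lambda>_. borel)) Q"
    and le: "\<And>l. l \<in> T \<Longrightarrow> prob {\<omega> \<in> space M. Q (\<lambda>j\<in>{1..k}. Z (Cut l j) \<omega>)} \<le> p"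
  shows "prob {\<omega> \<in> space M. \<forall>l\<in>T. Q (\<lambda>j\<in>{1..k}. Z (Cut l j) \<omega>)} \<le> p ^ card T"
proof -
  have "prob {\<omega> \<in> space M. \<forall>l\<in>T. Q (\<lambda>j\<in>{1..k}. Z (Cut l j) \<omega>)}
      = (\<Prod>l\<in>T. prob {\<omega> \<in> space M. Q (\<lambda>j\<in>{1..k}. Z (Cut l j) \<omega>)})"
    by (rule prob_trees_product[OF cuts_indep[OF T] _ _ Q]) (use T finite_subset in auto)
  also have "\<dots> \<le> (\<Prod>l\<in>T. p)" by (intro prod_mono) (use le in auto)
  finally show ?thesis by simp
qed

text \<open>The distribution function of the maximum of \<open>r\<close> exponential variables, set to 1 beyond the
  truncation point \<open>c\<close>.\<close>
definition hit_bound :: "nat \<Rightarrow> real \<Rightarrow> real \<Rightarrow> real" where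
  "hit_bound r c a = (if a \<le> c then (1 - exp (- rate * a)) ^ r else 1)"

text \<open>Within a tree the two sides are negatively correlated, and the trees are independent; so the
  joint probability is bounded by a product of the \<open>card T\<close>-th powers. The cases are those of the
  truncation on either side.\<close>
lemma hit_prob_le:
  assumes T: "T \<subseteq> {1..q}" and x: "0 \<le> x" "x \<le> 1" and ab: "0 < a" "0 < b"
  shows "prob {\<omega> \<in> space M. left_hit T (the_cuts \<omega>) x a \<and> right_hit T (the_cuts \<omega>) x b}
    \<le> hit_bound (card T) (\<delta> * x) a * hit_bound (card T) (\<delta> * (1 - x)) b"
proof -
  note [measurable] = cut_measurable
  define \<phi> where "\<phi> a = 1 - exp (- rate * a)" for a
  have \<phi>01: "0 \<le> \<phi> a" if "0 \<le> a" for a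
    using rate_pos that by (simp add: \<phi>_def)
  have le\<phi>: "1 - (1 - a) ^ k \<le> \<phi> a" if "0 \<le> a" "a \<le> \<delta>" for a
    using one_minus_power_ge_exp[of a \<delta> k] that scale by (simp add: \<phi>_def rate_def)
  have \<delta>x: "\<delta> * x \<le> x" "\<delta> * x \<le> \<delta>" "\<delta> * (1 - x) \<le> 1 - x" "\<delta> * (1 - x) \<le> \<delta>"
    using x scale mult_right_mono[of \<delta> 1 x] mult_right_mono[of \<delta> 1 "1 - x"]
      mult_left_mono[of x 1 \<delta>] mult_left_mono[of "1 - x" 1 \<delta>] by auto
  have hit: "prob {\<omega> \<in> space M. \<exists>j\<in>{1..k}. Z (Cut l j) \<omega> \<in> {c..<c + d}} \<le> \<phi> d"
    if "l \<in> T" "0 \<le> c" "c + d \<le> 1" "0 \<le> d" "d \<le> \<delta>" for l c d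
    using prob_hit[OF tree_indep, of l "{c..<c + d}"] le\<phi>[of d] that T cut_uniform by force
  have unif: "\<And>j. j \<in> {1..k} \<Longrightarrow> distr M lborel (Z (Cut l j)) = uniform_measure lborel {0..1}" if "l \<in> T" for l
    using cut_uniform T that by auto
  consider "\<delta> * x < a" "\<delta> * (1 - x) < b" | "\<delta> * x < a" "b \<le> \<delta> * (1 - x)"
    | "a \<le> \<delta> * x" "\<delta> * (1 - x) < b" | "a \<le> \<delta> * x" "b \<le> \<delta> * (1 - x)"
    by linarith
  then show ?thesis
  proof cases
    case 1
    then show ?thesis by (simp add: hit_bound_def)
  next
    case 2
    have "prob {\<omega> \<in> space M. \<forall>l\<in>T. \<exists>j\<in>{1..k}. (\<lambda>j\<in>{1..k}. Z (Cut l j) \<omega>) j \<in> {x..<x + b}} \<le> \<phi> b ^ card T"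
      using 2 ab x \<delta>x by (intro prob_trees[OF T], measurable)
        (unfold bex_restrict_iff, intro hit, auto)
    moreover have "{\<omega> \<in> space M. left_hit T (the_cuts \<omega>) x a \<and> right_hit T (the_cuts \<omega>) x b}
      = {\<omega> \<in> space M. \<forall>l\<in>T. \<exists>j\<in>{1..k}. (\<lambda>j\<in>{1..k}. Z (Cut l j) \<omega>) j \<in> {x..<x + b}}"
      using 2 by (auto simp: left_hit_def right_hit_def)
    ultimately show ?thesis using 2 by (simp add: hit_bound_def \<phi>_def)
  next
    case 3
    have "prob {\<omega> \<in> space M. \<forall>l\<in>T. \<exists>j\<in>{1..k}. (\<lambda>j\<in>{1..k}. Z (Cut l j) \<omega>) j \<in> {x - a..<x}} \<le> \<phi> a ^ card T"
      using hit[of _ "x - a" a] 3 ab x \<delta>x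
      by (intro prob_trees[OF T], measurable)
    moreover have "{\<omega> \<in> space M. left_hit T (the_cuts \<omega>) x a \<and> right_hit T (the_cuts \<omega>) x b}
      = {\<omega> \<in> space M. \<forall>l\<in>T. \<exists>j\<in>{1..k}. (\<lambda>j\<in>{1..k}. Z (Cut l j) \<omega>) j \<in> {x - a..<x}}"
      using 3 by (auto simp: left_hit_def right_hit_def)
    ultimately show ?thesis using 3 by (simp add: hit_bound_def \<phi>_def)
  next
    case 4
    let ?Q = "\<lambda>u. (\<exists>j\<in>{1..k}. u j \<in> {x - a..<x}) \<and> (\<exists>j\<in>{1..k}. u j \<in> {x..<x + b})"
    have "prob {\<omega> \<in> space M. ?Q (\<lambda>j. Z (Cut l j) \<omega>)} \<le> \<phi> a * \<phi> b" if "l \<in> T" for l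
    proof -
      have "prob {\<omega> \<in> space M. ?Q (\<lambda>j. Z (Cut l j) \<omega>)} \<le>
          (1 - (1 - measure lborel {x - a..<x}) ^ card {1..k}) * (1 - (1 - measure lborel {x..<x + b}) ^ card {1..k})"
        using T that 4 x ab \<delta>x by (intro prob_hit_both tree_indep unif) auto
      also have "\<dots> \<le> \<phi> a * \<phi> b"
        using le\<phi>[of a] le\<phi>[of b] ab 4 \<delta>x x \<phi>01[of a]
        by (intro mult_mono) (auto simp: power_le_one)
      finally show ?thesis .
    qed
    then have "prob {\<omega> \<in> space M. \<forall>l\<in>T. ?Q (\<lambda>j\<in>{1..k}. Z (Cut l j) \<omega>)} \<le> (\<phi> a * \<phi> b) ^ card T"
      by (intro prob_trees[OF T], measurable)
    moreover have "{\<omega> \<in> space M. left_hit T (the_cuts \<omega>) x a \<and> right_hit T (the_cuts \<omega>) x b}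
      = {\<omega> \<in> space M. \<forall>l\<in>T. ?Q (\<lambda>j\<in>{1..k}. Z (Cut l j) \<omega>)}"
      using 4 by (auto simp: left_hit_def right_hit_def)
    ultimately show ?thesis
      using 4 by (simp add: hit_bound_def \<phi>_def power_mult_distrib)
  qed
qed

definition layered :: "real \<Rightarrow> (real \<Rightarrow> bool) \<Rightarrow> ennreal" where
  "layered t P = (\<integral>\<^sup>+a\<in>{0<..}. ennreal (t * exp (- t * a)) * indicator {a. P a} a \<partial>lborel)"

text \<open>\<open>h\<close> dominates the Laplace transform of the maximum of \<open>r\<close> exponential variables. Keeping \<open>h\<close>
  abstract serves one tree and two trees at once.\<close>
definition laplace_bound :: "nat \<Rightarrow> (real \<Rightarrow> real) \<Rightarrow> bool" where
  "laplace_bound r h \<longleftrightarrow> h \<in> borel_measurable borel \<and> (\<forall>t\<ge>0. 0 \<le> h t) \<and>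
    (\<forall>t>0. (\<integral>\<^sup>+a\<in>{0..}. ennreal (t * exp (- t * a) * (1 - exp (- rate * a)) ^ r) \<partial>lborel) \<le> ennreal (h t))"

lemma laplace_bound_1: "laplace_bound 1 (exp_laplace rate)"
  using exp_laplace_eq rate_pos unfolding laplace_bound_def
  by (auto simp: exp_laplace_def[abs_def])

lemma laplace_bound_2: "laplace_bound 2 (max_exp_laplace rate)"
  using max_exp_laplace_eq rate_pos unfolding laplace_bound_def
  by (auto simp: max_exp_laplace_def[abs_def])

text \<open>Bound for the Laplace transform of the truncated length of a merged cell at \<open>x\<close>; the exponential
  summands come from the truncation.\<close>
definition gap_laplace :: "(real \<Rightarrow> real) \<Rightarrow> real \<Rightarrow> real \<Rightarrow> real" where
  "gap_laplace h t x = (h t + exp (- t * (\<delta> * x))) * (h t + exp (- t * (\<delta> * (1 - x))))"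

lemma nn_integral_hit_bound_le:
  assumes h: "laplace_bound r h" and t: "0 < t" and "0 \<le> c"
  shows "(\<integral>\<^sup>+a\<in>{0<..}. ennreal (t * exp (- t * a)) * ennreal (hit_bound r c a) \<partial>lborel)
    \<le> ennreal (h t + exp (- t * c))"
proof -
  have "(\<integral>\<^sup>+a\<in>{0<..}. ennreal (t * exp (- t * a)) * ennreal (hit_bound r c a) \<partial>lborel) \<le>
      (\<integral>\<^sup>+a. ennreal (t * exp (- t * a) * (1 - exp (- rate * a)) ^ r) * indicator {0..} a
        + ennreal (t * exp (- t * a)) * indicator {c..} a \<partial>lborel)"
    using t rate_pos \<open>0 \<le> c\<close>
    by (intro nn_integral_mono) (auto simp: hit_bound_def indicator_def ennreal_mult[symmetric])
  also have "\<dots> = (\<integral>\<^sup>+a\<in>{0..}. ennreal (t * exp (- t * a) * (1 - exp (- rate * a)) ^ r) \<partial>lborel)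
      + ennreal (exp (- t * c))"
    using nn_integral_exp_tail[OF t, of c] by (subst nn_integral_add) auto
  also have "\<dots> \<le> ennreal (h t) + ennreal (exp (- t * c))"
    using h t by (intro add_right_mono) (auto simp: laplace_bound_def)
  also have "\<dots> = ennreal (h t + exp (- t * c))"
    using h t by (simp add: laplace_bound_def)
  finally show ?thesis .
qed

lemma layered_cuts_le:
  assumes T: "T \<subseteq> {1..q}" and x: "0 \<le> x" "x \<le> 1" and h: "laplace_bound (card T) h" and t: "0 < t"
  shows "(\<integral>\<^sup>+\<omega>. layered t (left_hit T (the_cuts \<omega>) x) * layered t (right_hit T (the_cuts \<omega>) x) \<partial>M)
    \<le> ennreal (gap_laplace h t x)"
proof -
  note [measurable] = cut_measurable
  have fin: "finite T" using T finite_subset by auto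
  have [measurable]: "hit_bound r c \<in> borel_measurable borel" for r c
    unfolding hit_bound_def[abs_def] by measurable
  have pos: "0 \<le> hit_bound r c a" if "0 < a" for r c a
    using that rate_pos by (auto simp: hit_bound_def)
  have [measurable]: "(\<lambda>z. Z (Cut l j) (fst z)) \<in> borel_measurable (M \<Otimes>\<^sub>M borel)" if "l \<in> T" "j \<in> {1..k}" for l j
    using T that by (intro measurable_compose[OF measurable_fst cut_measurable]) auto
  have "(\<integral>\<^sup>+\<omega>. layered t (left_hit T (the_cuts \<omega>) x) * layered t (right_hit T (the_cuts \<omega>) x) \<partial>M)
    \<le> (\<integral>\<^sup>+a\<in>{0<..}. ennreal (t * exp (- t * a)) * ennreal (hit_bound (card T) (\<delta> * x) a) \<partial>lborel) *
      (\<integral>\<^sup>+b\<in>{0<..}. ennreal (t * exp (- t * b)) * ennreal (hit_bound (card T) (\<delta> * (1 - x)) b) \<partial>lborel)"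
    unfolding layered_def
  proof (rule nn_integral_mult_layers)
    show "Measurable.pred (M \<Otimes>\<^sub>M borel) (\<lambda>(\<omega>, a). left_hit T (the_cuts \<omega>) x a)"
      unfolding left_hit_def case_prod_beta using fin by measurable
    show "Measurable.pred (M \<Otimes>\<^sub>M borel) (\<lambda>(\<omega>, a). right_hit T (the_cuts \<omega>) x a)"
      unfolding right_hit_def case_prod_beta using fin by measurable
  qed (use hit_prob_le[OF T x] pos in auto)
  also have "\<dots> \<le> ennreal (h t + exp (- t * (\<delta> * x))) * ennreal (h t + exp (- t * (\<delta> * (1 - x))))"
    using x scale by (intro mult_mono nn_integral_hit_bound_le[OF h t]) auto
  also have "\<dots> = ennreal (gap_laplace h t x)"
    using h t unfolding gap_laplace_def laplace_bound_def by (intro ennreal_mult[symmetric]) auto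
  finally show ?thesis .
qed

end

section \<open>Observations in merged cells\<close>

lemma power_count_eq_prod:
  fixes v :: real
  shows "(1 - v) ^ count_in n x I = (\<Prod>i\<in>{1..n}. 1 - v * indicator I (x i))"
proof -
  have "(\<Prod>i\<in>{1..n}. 1 - v * indicator I (x i)) = (\<Prod>i\<in>{1..n}. if x i \<in> I then 1 - v else 1)"
    by (intro prod.cong) auto
  also have "\<dots> = (1 - v) ^ count_in n x I"
    by (simp only: prod.inter_filter[symmetric] finite_atLeastAtMost prod_constant)
  finally show ?thesis ..
qed

context forest_model
begin

lemma design_indep: "indep_vars (\<lambda>_. borel) (\<lambda>i. Z (Design i)) {1..n}"
proof -
  have "indep_vars (\<lambda>i. PiM {Design i} (\<lambda>_. borel)) (\<lambda>i \<omega>. restrict (\<lambda>v. Z v \<omega>) {Design i}) {1..n}"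
    using indep by (intro indep_vars_restrict) (auto simp: sources_def disjoint_family_on_def)
  then have "indep_vars (\<lambda>_. borel) (\<lambda>i \<omega>. (\<lambda>f. f (Design i)) (restrict (\<lambda>v. Z v \<omega>) {Design i})) {1..n}"
    by (rule indep_vars_compose2) simp
  then show ?thesis by simp
qed

abbreviation left_length :: "nat set \<Rightarrow> (nat \<Rightarrow> nat \<Rightarrow> real) \<Rightarrow> real \<Rightarrow> real" where
  "left_length T u x \<equiv> measure lborel (left_part T u x)"

abbreviation right_length :: "nat set \<Rightarrow> (nat \<Rightarrow> nat \<Rightarrow> real) \<Rightarrow> real \<Rightarrow> real" where
  "right_length T u x \<equiv> measure lborel (right_part T u x)"

text \<open>Inside the truncation window the density is at least \<open>9 / 10 \<mu> x\<close>.\<close>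
lemma design_prob_ge:
  assumes x: "0 \<le> x" "x \<le> 1" and T: "finite T" and i: "i \<in> {1..n}"
  shows "9 / 10 * \<mu> x * (left_length T u x + right_length T u x)
    \<le> prob (Z (Design i) -` merged_cell T u x \<inter> space M)"
proof -
  have [measurable]: "left_part T u x \<in> sets borel" "right_part T u x \<in> sets borel"
    using fmeasurableD[OF left_part_fmeasurable[OF T]] fmeasurableD[OF right_part_fmeasurable[OF T]] by auto
  have close: "9 / 10 * \<mu> x \<le> \<mu> y \<and> y \<in> {0..1} \<and> y \<in> merged_cell T u x"
    if "y \<in> left_part T u x \<union> right_part T u x" for y
  proof -
    have "\<delta> * x \<le> \<delta>" "\<delta> * (1 - x) \<le> \<delta>"
      using x scale mult_left_mono[of x 1 \<delta>] mult_left_mono[of "1 - x" 1 \<delta>] by auto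
    then have "\<bar>x - y\<bar> \<le> \<delta>"
      using that by (auto simp: left_part_def right_part_def)
    then show ?thesis
      using density_local[of x y] that
      by (auto simp: left_part_def right_part_def merged_cell_def cell_of_def)
  qed
  have "ennreal (9 / 10 * \<mu> x * (left_length T u x + right_length T u x))
      = ennreal (9 / 10 * \<mu> x) * emeasure lborel (left_part T u x \<union> right_part T u x)"
  proof -
    have "emeasure lborel (left_part T u x \<union> right_part T u x)
        = emeasure lborel (left_part T u x) + emeasure lborel (right_part T u x)"
      using left_part_fmeasurable[OF T, of u x] right_part_fmeasurable[OF T, of u x]
      by (intro plus_emeasure[symmetric]) (auto simp: left_part_def right_part_def)
    also have "\<dots> = ennreal (left_length T u x + right_length T u x)"
      using left_part_fmeasurable[OF T, of u x] right_part_fmeasurable[OF T, of u x]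
      by (simp add: emeasure_eq_measure2)
    finally have "emeasure lborel (left_part T u x \<union> right_part T u x)
        = ennreal (left_length T u x + right_length T u x)" .
    then show ?thesis
      using density_gt_0[of x] by (simp only:) (intro ennreal_mult, auto)
  qed
  also have "\<dots> = (\<integral>\<^sup>+y. ennreal (9 / 10 * \<mu> x) * indicator (left_part T u x \<union> right_part T u x) y \<partial>lborel)"
    using left_part_fmeasurable[OF T, of u x] right_part_fmeasurable[OF T, of u x]
    by (intro nn_integral_cmult_indicator[symmetric]) auto
  also have "\<dots> \<le> (\<integral>\<^sup>+y. ennreal (\<mu> y * indicator {0..1} y) * indicator (merged_cell T u x) y \<partial>lborel)"
    using close by (intro nn_integral_mono) (auto simp: indicator_def intro!: ennreal_leI)
  also have "\<dots> = emeasure M (Z (Design i) -` merged_cell T u x \<inter> space M)"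
    using merged_cell_borel[OF T] by (subst distributed_emeasure[OF design_density[OF i]]) auto
  finally show ?thesis
    by (simp add: emeasure_eq_measure)
qed

text \<open>The observations are independent, and \<open>1 - v p \<le> exp (- v p)\<close> for the mass \<open>p\<close> of the cell.\<close>
lemma sample_power_le:
  assumes x: "0 \<le> x" "x \<le> 1" and T: "finite T" and v: "0 \<le> v" "v \<le> 1"
  defines "t \<equiv> real n * v * (9 / 10 * \<mu> x)"
  shows "(\<integral>\<^sup>+\<omega>. ennreal ((1 - v) ^ count_in n (the_design \<omega>) (merged_cell T u x)) \<partial>M)
    \<le> ennreal (exp (- t * left_length T u x) * exp (- t * right_length T u x))"
proof -
  define I where "I = merged_cell T u x"
  define d where "d = left_length T u x + right_length T u x"
  have [measurable]: "I \<in> sets borel" using merged_cell_borel[OF T] by (simp add: I_def)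
  have one: "(\<integral>\<^sup>+\<omega>. ennreal (1 - v * indicator I (Z (Design i) \<omega>)) \<partial>M) \<le> ennreal (exp (- (v * (9 / 10 * \<mu> x) * d)))"
    if i: "i \<in> {1..n}" for i
  proof -
    note [measurable] = design_measurable[OF i]
    have "(\<integral>\<^sup>+\<omega>. ennreal (1 - v * indicator I (Z (Design i) \<omega>)) \<partial>M)
        = ennreal (expectation (\<lambda>\<omega>. 1 - v * indicator I (Z (Design i) \<omega>)))"
      using v by (intro nn_integral_eq_integral integrable_const_bound[where B = 1])
        (auto simp: indicator_def)
    also have "expectation (\<lambda>\<omega>. 1 - v * indicator I (Z (Design i) \<omega>))
        = expectation (\<lambda>\<omega>. 1 - v * indicator (Z (Design i) -` I \<inter> space M) \<omega>)"
      by (intro Bochner_Integration.integral_cong) (auto simp: indicator_def)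
    also have "\<dots> = 1 - v * prob (Z (Design i) -` I \<inter> space M)"
      by (subst Bochner_Integration.integral_diff) (auto simp: prob_space emeasure_eq_measure)
    also have "\<dots> \<le> 1 - v * (9 / 10 * \<mu> x * d)"
      using design_prob_ge[OF x T i, of u] v
      by (intro diff_left_mono mult_left_mono) (auto simp: I_def d_def)
    also have "\<dots> \<le> exp (- (v * (9 / 10 * \<mu> x) * d))"
      using exp_ge_add_one_self[of "- (v * (9 / 10 * \<mu> x) * d)"] by (simp add: mult.assoc)
    finally show ?thesis by (simp add: ennreal_leI)
  qed
  have "(\<integral>\<^sup>+\<omega>. ennreal ((1 - v) ^ count_in n (the_design \<omega>) I) \<partial>M)
      = (\<integral>\<^sup>+\<omega>. (\<Prod>i\<in>{1..n}. ennreal (1 - v * indicator I (Z (Design i) \<omega>))) \<partial>M)"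
    unfolding power_count_eq_prod using v
    by (intro nn_integral_cong prod_ennreal[symmetric]) (auto simp: indicator_def)
  also have "\<dots> = (\<Prod>i\<in>{1..n}. \<integral>\<^sup>+\<omega>. ennreal (1 - v * indicator I (Z (Design i) \<omega>)) \<partial>M)"
  proof (rule indep_vars_nn_integral)
    show "indep_vars (\<lambda>_. borel) (\<lambda>i \<omega>. ennreal (1 - v * indicator I (Z (Design i) \<omega>))) {1..n}"
      by (rule indep_vars_compose2[OF design_indep, of "\<lambda>_ y. ennreal (1 - v * indicator I y)"]) measurable
  qed auto
  also have "\<dots> \<le> (\<Prod>i\<in>{1..n}. ennreal (exp (- (v * (9 / 10 * \<mu> x) * d))))"
    by (intro prod_mono_ennreal one)
  also have "\<dots> = ennreal (exp (- (v * (9 / 10 * \<mu> x) * d)) ^ n)"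
    by (simp add: ennreal_power)
  also have "exp (- (v * (9 / 10 * \<mu> x) * d)) ^ n = exp (- t * left_length T u x) * exp (- t * right_length T u x)"
    by (simp add: exp_of_nat_mult[symmetric] exp_add[symmetric] t_def d_def algebra_simps)
  finally show ?thesis by (simp add: I_def)
qed

lemma merged_cell_cong:
  "(\<And>l j. l \<in> T \<Longrightarrow> j \<in> {1..k} \<Longrightarrow> u l j = u' l j) \<Longrightarrow> merged_cell T u x = merged_cell T u' x"
  by (simp add: merged_cell_def cell_of_def)

lemma left_hit_cong:
  "(\<And>l j. l \<in> T \<Longrightarrow> j \<in> {1..k} \<Longrightarrow> u l j = u' l j) \<Longrightarrow> left_hit T u x = left_hit T u' x"
  by (simp add: left_hit_def fun_eq_iff)

lemma right_hit_cong:
  "(\<And>l j. l \<in> T \<Longrightarrow> j \<in> {1..k} \<Longrightarrow> u l j = u' l j) \<Longrightarrow> right_hit T u x = right_hit T u' x"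
  by (simp add: right_hit_def fun_eq_iff)

lemma pred_merged_cell:
  assumes "finite T" "\<And>l j. l \<in> T \<Longrightarrow> j \<in> {1..k} \<Longrightarrow> (\<lambda>z. u z l j) \<in> borel_measurable N"
    and [measurable]: "x \<in> borel_measurable N" "y \<in> borel_measurable N"
  shows "Measurable.pred N (\<lambda>z. y z \<in> merged_cell T (u z) (x z))"
proof -
  note [measurable] = assms(2)
  show ?thesis unfolding merged_cell_def cell_of_def using assms(1) by simp measurable
qed

lemma layered_measurable:
  assumes [measurable]: "t \<in> borel_measurable N" "Measurable.pred (N \<Otimes>\<^sub>M borel) (\<lambda>(z, a). P z a)"
  shows "(\<lambda>z. layered (t z) (P z)) \<in> borel_measurable N"
  unfolding layered_def indicator_def by measurable

lemma layered_left_measurable: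
  assumes "finite T" "\<And>l j. l \<in> T \<Longrightarrow> j \<in> {1..k} \<Longrightarrow> (\<lambda>z. u z l j) \<in> borel_measurable N"
    and [measurable]: "x \<in> borel_measurable N" "t \<in> borel_measurable N"
  shows "(\<lambda>z. layered (t z) (left_hit T (u z) (x z))) \<in> borel_measurable N"
proof (rule layered_measurable)
  have [measurable]: "(\<lambda>z. u (fst z) l j) \<in> borel_measurable (N \<Otimes>\<^sub>M borel)" if "l \<in> T" "j \<in> {1..k}" for l j
    using assms(2)[OF that] by measurable
  show "Measurable.pred (N \<Otimes>\<^sub>M borel) (\<lambda>(z, a). left_hit T (u z) (x z) a)"
    unfolding left_hit_def case_prod_beta using assms(1) by measurable
qed measurable

lemma layered_right_measurable:
  assumes "finite T" "\<And>l j. l \<in> T \<Longrightarrow> j \<in> {1..k} \<Longrightarrow> (\<lambda>z. u z l j) \<in> borel_measurable N"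
    and [measurable]: "x \<in> borel_measurable N" "t \<in> borel_measurable N"
  shows "(\<lambda>z. layered (t z) (right_hit T (u z) (x z))) \<in> borel_measurable N"
proof (rule layered_measurable)
  have [measurable]: "(\<lambda>z. u (fst z) l j) \<in> borel_measurable (N \<Otimes>\<^sub>M borel)" if "l \<in> T" "j \<in> {1..k}" for l j
    using assms(2)[OF that] by measurable
  show "Measurable.pred (N \<Otimes>\<^sub>M borel) (\<lambda>(z, a). right_hit T (u z) (x z) a)"
    unfolding right_hit_def case_prod_beta using assms(1) by measurable
qed measurable

lemma AE_point_unit: "AE \<omega> in M. 0 \<le> Z New_Point \<omega> \<and> Z New_Point \<omega> \<le> 1"
  by (subst distributed_AE2[OF point_density]) (auto simp: indicator_def intro!: AE_I2)

lemma gap_laplace_measurable: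
  assumes [measurable]: "h \<in> borel_measurable borel" "t \<in> borel_measurable N" "x \<in> borel_measurable N"
  shows "(\<lambda>z. gap_laplace h (t z) (x z)) \<in> borel_measurable N"
  unfolding gap_laplace_def by measurable

text \<open>The sources are averaged out one group after the other: the design for fixed cuts and new point,
  then the cuts for a fixed new point, then the new point. For \<open>v = 1\<close> the left-hand side is the
  probability that the merged cell contains no observation.\<close>
lemma void_power_le:
  assumes T: "T \<subseteq> {1..q}" and h: "laplace_bound (card T) h" and v: "0 < v" "v \<le> 1"
  shows "(\<integral>\<^sup>+\<omega>. ennreal ((1 - v) ^ count_in n (the_design \<omega>) (merged_cell T (the_cuts \<omega>) (Z New_Point \<omega>))) \<partial>M)
    \<le> (\<integral>\<^sup>+x\<in>{0..1}. ennreal (\<mu> x * gap_laplace h (real n * v * (9 / 10 * \<mu> x)) x) \<partial>lborel)"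
proof -
  have fin: "finite T" using T finite_subset by auto
  define t where "t x = real n * v * (9 / 10 * \<mu> x)" for x
  have t_pos: "0 < t x" for x
    using size_pos v density_gt_0 by (simp add: t_def)
  have [measurable]: "t \<in> borel_measurable borel"
    unfolding t_def[abs_def] by measurable
  note [measurable] = gap_laplace_measurable
  have [measurable]: "h \<in> borel_measurable borel" using h by (simp add: laplace_bound_def)
  let ?A = "insert New_Point (cuts T)" and ?B = "Design ` {1..n}"
  let ?R = "\<lambda>D \<omega>. restrict (\<lambda>i. Z i \<omega>) D"
  define f where "f = (\<lambda>(a, b). ennreal (\<Prod>i\<in>{1..n}. 1 - v *
    indicator (merged_cell T (\<lambda>l j. a (Cut l j)) (a New_Point)) (b (Design i))))"
  have fst_proj: "(\<lambda>z. fst z i) \<in> borel_measurable (PiM A (\<lambda>_. borel) \<Otimes>\<^sub>M PiM B (\<lambda>_. borel))"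
    if "i \<in> A" for i :: source and A B :: "source set"
    using that by measurable
  have snd_proj: "(\<lambda>z. snd z i) \<in> borel_measurable (PiM A (\<lambda>_. borel) \<Otimes>\<^sub>M PiM B (\<lambda>_. borel))"
    if "i \<in> B" for i :: source and A B :: "source set"
    using that by measurable
  have f_meas: "f \<in> borel_measurable (PiM ?A (\<lambda>_. borel) \<Otimes>\<^sub>M PiM ?B (\<lambda>_. borel))"
  proof -
    have [measurable]: "Measurable.pred (PiM ?A (\<lambda>_. borel) \<Otimes>\<^sub>M PiM ?B (\<lambda>_. borel))
        (\<lambda>z. snd z (Design i) \<in> merged_cell T (\<lambda>l j. fst z (Cut l j)) (fst z New_Point))" if "i \<in> {1..n}" for i
      using that by (intro pred_merged_cell fin fst_proj snd_proj) (auto simp: cuts_def)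
    show ?thesis unfolding f_def case_prod_beta indicator_def by measurable
  qed
  have cong1: "merged_cell T (\<lambda>l j. ?R ?A \<omega> (Cut l j)) x = merged_cell T (the_cuts \<omega>) x" for \<omega> x
    by (rule merged_cell_cong) (auto simp: cuts_def)
  have f_eq: "f (?R ?A \<omega>, ?R ?B \<omega>') =
      ennreal ((1 - v) ^ count_in n (the_design \<omega>') (merged_cell T (the_cuts \<omega>) (Z New_Point \<omega>)))" for \<omega> \<omega>'
    unfolding f_def power_count_eq_prod prod.case cong1 by simp
  have "(\<integral>\<^sup>+\<omega>. ennreal ((1 - v) ^ count_in n (the_design \<omega>) (merged_cell T (the_cuts \<omega>) (Z New_Point \<omega>))) \<partial>M)
      = (\<integral>\<^sup>+\<omega>. \<integral>\<^sup>+\<omega>'. ennreal ((1 - v) ^ count_in n (the_design \<omega>') (merged_cell T (the_cuts \<omega>) (Z New_Point \<omega>))) \<partial>M \<partial>M)"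
    unfolding f_eq[symmetric]
    by (rule nn_integral_indep_var[OF indep_var_restrict[OF indep] f_meas])
       (use T in \<open>auto simp: sources_def cuts_def\<close>)
  also have "\<dots> \<le> (\<integral>\<^sup>+\<omega>. layered (t (Z New_Point \<omega>)) (left_hit T (the_cuts \<omega>) (Z New_Point \<omega>)) *
      layered (t (Z New_Point \<omega>)) (right_hit T (the_cuts \<omega>) (Z New_Point \<omega>)) \<partial>M)"
    using AE_point_unit
  proof (intro nn_integral_mono_AE, eventually_elim)
    case (elim \<omega>)
    let ?x = "Z New_Point \<omega>" and ?u = "the_cuts \<omega>"
    have "(\<integral>\<^sup>+\<omega>'. ennreal ((1 - v) ^ count_in n (the_design \<omega>') (merged_cell T ?u ?x)) \<partial>M)
        \<le> ennreal (exp (- t ?x * left_length T ?u ?x) * exp (- t ?x * right_length T ?u ?x))"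
      unfolding t_def using elim v fin by (intro sample_power_le) auto
    also have "\<dots> = ennreal (exp (- t ?x * left_length T ?u ?x)) * ennreal (exp (- t ?x * right_length T ?u ?x))"
      by (rule ennreal_mult) auto
    also have "\<dots> \<le> layered (t ?x) (left_hit T ?u ?x) * layered (t ?x) (right_hit T ?u ?x)"
      unfolding layered_def using t_pos fin elim
      by (intro mult_mono exp_length_le_layers left_length_hit right_length_hit) auto
    finally show ?case .
  qed
  also have "\<dots> = (\<integral>\<^sup>+\<omega>. \<integral>\<^sup>+\<omega>'. layered (t (Z New_Point \<omega>)) (left_hit T (the_cuts \<omega>') (Z New_Point \<omega>)) *
      layered (t (Z New_Point \<omega>)) (right_hit T (the_cuts \<omega>') (Z New_Point \<omega>)) \<partial>M \<partial>M)"
  proof -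
    define g where "g = (\<lambda>(a :: source \<Rightarrow> real, b :: source \<Rightarrow> real).
      layered (t (a New_Point)) (left_hit T (\<lambda>l j. b (Cut l j)) (a New_Point)) *
      layered (t (a New_Point)) (right_hit T (\<lambda>l j. b (Cut l j)) (a New_Point)))"
    have [measurable]: "(\<lambda>z. fst z New_Point) \<in> borel_measurable (PiM {New_Point} (\<lambda>_. borel) \<Otimes>\<^sub>M PiM (cuts T) (\<lambda>_. borel))"
      by (rule fst_proj) auto
    have g_meas: "g \<in> borel_measurable (PiM {New_Point} (\<lambda>_. borel) \<Otimes>\<^sub>M PiM (cuts T) (\<lambda>_. borel))"
      unfolding g_def case_prod_beta
      by (intro borel_measurable_times_ennreal layered_left_measurable layered_right_measurable fin snd_proj)
         (auto simp: cuts_def)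
    have hits: "left_hit T (\<lambda>l j. ?R (cuts T) \<omega> (Cut l j)) x = left_hit T (the_cuts \<omega>) x"
      "right_hit T (\<lambda>l j. ?R (cuts T) \<omega> (Cut l j)) x = right_hit T (the_cuts \<omega>) x" for \<omega> x
      by (rule left_hit_cong right_hit_cong; auto simp: cuts_def)+
    have g_eq: "g (?R {New_Point} \<omega>, ?R (cuts T) \<omega>') =
      layered (t (Z New_Point \<omega>)) (left_hit T (the_cuts \<omega>') (Z New_Point \<omega>)) *
      layered (t (Z New_Point \<omega>)) (right_hit T (the_cuts \<omega>') (Z New_Point \<omega>))" for \<omega> \<omega>'
      unfolding g_def prod.case hits by simp
    show ?thesis
      unfolding g_eq[symmetric]
      by (rule nn_integral_indep_var[OF indep_var_restrict[OF indep] g_meas])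
         (use T in \<open>auto simp: sources_def cuts_def\<close>)
  qed
  also have "\<dots> \<le> (\<integral>\<^sup>+\<omega>. ennreal (gap_laplace h (t (Z New_Point \<omega>)) (Z New_Point \<omega>)) \<partial>M)"
    using AE_point_unit
  proof (intro nn_integral_mono_AE, eventually_elim)
    case (elim \<omega>)
    then show ?case by (intro layered_cuts_le[OF T _ _ h t_pos]) auto
  qed
  also have "\<dots> = (\<integral>\<^sup>+x. ennreal (\<mu> x * indicator {0..1} x) * ennreal (gap_laplace h (t x) x) \<partial>lborel)"
    by (rule distributed_nn_integral[OF point_density, symmetric]) measurable
  also have "\<dots> = (\<integral>\<^sup>+x\<in>{0..1}. ennreal (\<mu> x * gap_laplace h (t x) x) \<partial>lborel)"
    using density_gt_0 by (intro nn_integral_cong) (auto simp: indicator_def ennreal_mult' less_imp_le)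
  finally show ?thesis by (simp only: t_def)
qed

end

section \<open>Mean inverse counts\<close>

lemma nn_integral_exp_positive:
  assumes "0 < c"
  shows "(\<integral>\<^sup>+t\<in>{0<..}. ennreal (exp (- t * c)) \<partial>lborel) \<le> ennreal (1 / c)"
proof -
  have "(\<integral>\<^sup>+t\<in>{0<..}. ennreal (exp (- t * c)) \<partial>lborel) \<le>
      (\<integral>\<^sup>+t. ennreal (1 / c) * (ennreal (c * exp (- c * t)) * indicator {0..} t) \<partial>lborel)"
    using assms by (intro nn_integral_mono) (auto simp: indicator_def ennreal_mult[symmetric] mult.commute)
  also have "\<dots> = ennreal (1 / c)"
    using nn_integral_exp_tail[OF assms, of 0] by (subst nn_integral_cmult) auto
  finally show ?thesis .
qed

lemma ennreal_weighted_sum: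
  assumes "0 \<le> c" "0 \<le> a" "0 \<le> e" "0 \<le> b" "0 \<le> r"
  shows "ennreal (c * (a + e * b + 4 * r)) = ennreal c * (ennreal a + ennreal e * ennreal b + 4 * ennreal r)"
proof -
  have "ennreal (c * (a + e * b + 4 * r)) = ennreal c * ennreal (a + e * b + 4 * r)"
    using assms by (intro ennreal_mult) auto
  also have "ennreal (a + e * b + 4 * r) = ennreal a + ennreal (e * b) + ennreal (4 * r)"
    using assms by simp
  also have "ennreal (4 * r) = 4 * ennreal r"
    by (simp add: ennreal_mult')
  finally show ?thesis using assms by (simp add: ennreal_mult)
qed

lemma ennreal_pull_factor:
  "0 \<le> c \<Longrightarrow> ennreal p * i * ennreal c = ennreal (c * p) * i"
  by (simp add: ennreal_mult' mult_ac)

context forest_model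
begin

text \<open>Bound for the mean of \<open>exp (- t \<delta> x)\<close> over \<open>x\<close> in the unit interval.\<close>
definition edge :: "real \<Rightarrow> real" where
  "edge t = min 1 (1 / (t * \<delta>))"

definition mean_gap :: "(real \<Rightarrow> real) \<Rightarrow> real \<Rightarrow> real" where
  "mean_gap h t = (h t)\<^sup>2 + 2 * (h t * edge t) + exp (- t * \<delta>)"

text \<open>The product of the two truncation terms is \<open>exp (- t \<delta>)\<close> for every \<open>x\<close>, and the mixed terms
  have the same mean by the symmetry \<open>x \<mapsto> 1 - x\<close>.\<close>
lemma nn_integral_gap_laplace_le:
  assumes t: "0 < t" and h: "0 \<le> h t"
  shows "(\<integral>\<^sup>+x\<in>{0..1}. ennreal (gap_laplace h t x) \<partial>lborel) \<le> ennreal (mean_gap h t)"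
proof -
  let ?E = "\<lambda>x. ennreal (exp (- t * (\<delta> * x)))"
  have "(\<integral>\<^sup>+x\<in>{0..1}. ennreal (gap_laplace h t x) \<partial>lborel) =
      (\<integral>\<^sup>+x. ennreal ((h t)\<^sup>2 + exp (- t * \<delta>)) * indicator {0..1} x + 
         ennreal (h t) * (?E x * indicator {0..1} x) + ennreal (h t) * (?E (1 - x) * indicator {0..1} x) \<partial>lborel)"
  proof (intro nn_integral_cong)
    fix x :: real
    have "exp (- t * (\<delta> * x)) * exp (- t * (\<delta> * (1 - x))) = exp (- t * \<delta>)"
      by (simp add: exp_add[symmetric] algebra_simps)
    then have "gap_laplace h t x = ((h t)\<^sup>2 + exp (- t * \<delta>)) + h t * exp (- t * (\<delta> * x)) + h t * exp (- t * (\<delta> * (1 - x)))"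
      by (simp add: gap_laplace_def algebra_simps power2_eq_square)
    then show "ennreal (gap_laplace h t x) * indicator {0..1} x =
      ennreal ((h t)\<^sup>2 + exp (- t * \<delta>)) * indicator {0..1} x + 
         ennreal (h t) * (?E x * indicator {0..1} x) + ennreal (h t) * (?E (1 - x) * indicator {0..1} x)"
      using h by (auto simp: indicator_def ennreal_mult[symmetric] ennreal_plus[symmetric] simp del: ennreal_plus)
  qed
  also have "\<dots> = ennreal ((h t)\<^sup>2 + exp (- t * \<delta>)) + ennreal (h t) * (\<integral>\<^sup>+x\<in>{0..1}. ?E x \<partial>lborel)
      + ennreal (h t) * (\<integral>\<^sup>+x\<in>{0..1}. ?E (1 - x) \<partial>lborel)"
    by (subst nn_integral_add, measurable, subst nn_integral_add, measurable)
       (simp add: nn_integral_cmult)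
  also have "(\<integral>\<^sup>+x\<in>{0..1}. ?E (1 - x) \<partial>lborel) = (\<integral>\<^sup>+x\<in>{0..1}. ?E x \<partial>lborel)"
    by (rule nn_integral_reflect_unit) measurable
  also have "ennreal ((h t)\<^sup>2 + exp (- t * \<delta>)) + ennreal (h t) * (\<integral>\<^sup>+x\<in>{0..1}. ?E x \<partial>lborel)
      + ennreal (h t) * (\<integral>\<^sup>+x\<in>{0..1}. ?E x \<partial>lborel) \<le>
      ennreal ((h t)\<^sup>2 + exp (- t * \<delta>)) + ennreal (h t) * ennreal (edge t) + ennreal (h t) * ennreal (edge t)"
    unfolding edge_def using t scale
    by (intro add_mono mult_left_mono order_refl nn_integral_exp_unit_le) auto
  also have "\<dots> = ennreal (mean_gap h t)"
    using h t scale
    by (simp add: mean_gap_def edge_def ennreal_mult[symmetric] ennreal_plus[symmetric] algebra_simps del: ennreal_plus)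
  finally show ?thesis .
qed

definition sample_rate :: real where "sample_rate = real n * (9 / 10 * m)"

lemma sample_rate_pos: "0 < sample_rate"
  using size_pos density_pos by (simp add: sample_rate_def)

text \<open>The factor \<open>1 + 3 v\<close> after the substitution \<open>t = 9 / 10 n \<mu> x v\<close>, bounded uniformly in \<open>x\<close>.\<close>
definition correction :: "real \<Rightarrow> real" where
  "correction t = 1 + 3 * min 1 (t / sample_rate)"

abbreviation cell_count :: "nat set \<Rightarrow> 'w \<Rightarrow> nat" where
  "cell_count T \<omega> \<equiv> count_in n (the_design \<omega>) (merged_cell T (the_cuts \<omega>) (Z New_Point \<omega>))"

lemma pred_design_in_cell:
  assumes "T \<subseteq> {1..q}" "i \<in> {1..n}"
  shows "Measurable.pred M (\<lambda>\<omega>. Z (Design i) \<omega> \<in> merged_cell T (the_cuts \<omega>) (Z New_Point \<omega>))"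
  using assms finite_subset[OF assms(1)]
  by (intro pred_merged_cell cut_measurable point_measurable design_measurable) auto

text \<open>The substitution \<open>t = 9 / 10 n \<mu> x v\<close> replaces \<open>\<mu> x dv\<close> by \<open>10 / (9 n) dt\<close>: points of low
  density see fewer observations but are also less likely, and the two effects cancel.\<close>
lemma rescale_le:
  assumes [measurable]: "h \<in> borel_measurable borel" and h: "\<And>t. 0 \<le> t \<Longrightarrow> 0 \<le> h t"
  shows "(\<integral>\<^sup>+v\<in>{0..1}. ennreal ((1 + 3 * v) * (\<mu> x * gap_laplace h (real n * v * (9 / 10 * \<mu> x)) x)) \<partial>lborel)
    \<le> (\<integral>\<^sup>+t\<in>{0<..}. ennreal (10 / (9 * real n) * correction t * gap_laplace h t x) \<partial>lborel)"
proof -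
  note [measurable] = gap_laplace_measurable
  have [measurable]: "correction \<in> borel_measurable borel"
    unfolding correction_def[abs_def] by measurable
  define \<gamma> where "\<gamma> = real n * (9 / 10 * \<mu> x)"
  have \<gamma>: "0 < \<gamma>" "sample_rate \<le> \<gamma>"
    using size_pos density_gt_0 density_pos(2)[of x] by (auto simp: \<gamma>_def sample_rate_def)
  have gap: "0 \<le> gap_laplace h t x" if "0 \<le> t" for t
    using h[OF that] by (simp add: gap_laplace_def)
  let ?G = "\<lambda>t. ennreal (10 / (9 * real n) * correction t * gap_laplace h t x) * indicator {0<..} t"
  have "(\<integral>\<^sup>+v\<in>{0..1}. ennreal ((1 + 3 * v) * (\<mu> x * gap_laplace h (real n * v * (9 / 10 * \<mu> x)) x)) \<partial>lborel)
    \<le> (\<integral>\<^sup>+v. ennreal \<gamma> * ?G (0 + \<gamma> * v) \<partial>lborel)"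
    using AE_lborel_singleton[of "0::real"]
  proof (intro nn_integral_mono_AE, eventually_elim)
    case (elim v)
    show ?case
    proof (cases "0 < v \<and> v \<le> 1")
      case True
      \<comment> \<open>Since \<open>v \<le> 1\<close> and \<open>sample_rate \<le> \<gamma>\<close>, the truncated correction still dominates \<open>1 + 3 v\<close>.\<close>
      have "v \<le> \<gamma> * v / sample_rate"
        using True \<gamma> sample_rate_pos by (simp add: pos_le_divide_eq mult.commute)
      then have "1 + 3 * v \<le> correction (\<gamma> * v)"
        using True by (simp add: correction_def)
      then have "(1 + 3 * v) * (\<mu> x * gap_laplace h (\<gamma> * v) x) \<le> correction (\<gamma> * v) * (\<mu> x * gap_laplace h (\<gamma> * v) x)"
        using True \<gamma> gap[of "\<gamma> * v"] density_gt_0[of x] by (intro mult_right_mono) auto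
      also have "\<dots> = \<gamma> * (10 / (9 * real n) * correction (\<gamma> * v) * gap_laplace h (\<gamma> * v) x)"
        using size_pos by (simp add: \<gamma>_def field_simps)
      finally show ?thesis
        using True \<gamma> by (simp add: ennreal_mult'[symmetric] \<gamma>_def mult_ac ennreal_leI)
    qed (use elim in \<open>auto simp: indicator_def\<close>)
  qed
  also have "\<dots> = ennreal \<bar>\<gamma>\<bar> * (\<integral>\<^sup>+v. ?G (0 + \<gamma> * v) \<partial>lborel)"
    using \<gamma> by (subst nn_integral_cmult) auto
  also have "\<dots> = (\<integral>\<^sup>+t. ?G t \<partial>lborel)"
    using \<gamma> by (intro nn_integral_real_affine[symmetric]) auto
  finally show ?thesis .
qed

text \<open>Combination of the integral representation of \<open>1 / N\<close>, the bound for powers of counts and the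
  substitution; the order of integration is changed so that \<open>t\<close> comes last.\<close>
lemma mean_inverse_count_le:
  assumes T: "T \<subseteq> {1..q}" and h: "laplace_bound (card T) h"
  shows "(\<integral>\<^sup>+\<omega>. ennreal (1 / real (cell_count T \<omega>)) \<partial>M)
    \<le> (\<integral>\<^sup>+t\<in>{0<..}. ennreal (10 / (9 * real n) * correction t * mean_gap h t) \<partial>lborel)"
proof -
  interpret L: pair_sigma_finite M lborel ..
  note [measurable] = gap_laplace_measurable
  have [measurable]: "correction \<in> borel_measurable borel"
    unfolding correction_def[abs_def] by measurable
  have [measurable]: "h \<in> borel_measurable borel" and h0: "\<And>t. 0 \<le> t \<Longrightarrow> 0 \<le> h t"
    using h by (auto simp: laplace_bound_def)
  have gap: "0 \<le> gap_laplace h t x" if "0 \<le> t" for t x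
    using h0[OF that] by (simp add: gap_laplace_def)
  have corr: "1 \<le> correction t" if "0 \<le> t" for t
    using that sample_rate_pos by (simp add: correction_def)
  have [measurable]: "Measurable.pred (M \<Otimes>\<^sub>M borel)
      (\<lambda>z. Z (Design i) (fst z) \<in> merged_cell T (the_cuts (fst z)) (Z New_Point (fst z)))" if "i \<in> {1..n}" for i
    using pred_design_in_cell[OF T that] by measurable
  have count_meas [measurable]: "(\<lambda>(\<omega>, v). ennreal ((1 + 3 * v) * (1 - v) ^ cell_count T \<omega>) * indicator {0..1} v)
      \<in> borel_measurable (M \<Otimes>\<^sub>M borel)"
    unfolding power_count_eq_prod case_prod_beta indicator_def by measurable
  have [measurable]: "(\<lambda>\<omega>. ennreal ((1 - v) ^ cell_count T \<omega>)) \<in> borel_measurable M" for v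
  proof -
    have [measurable]: "Measurable.pred M (\<lambda>\<omega>. Z (Design i) \<omega> \<in> merged_cell T (the_cuts \<omega>) (Z New_Point \<omega>))"
      if "i \<in> {1..n}" for i
      using pred_design_in_cell[OF T that] .
    show ?thesis unfolding power_count_eq_prod indicator_def by measurable
  qed
  let ?H = "\<lambda>v x. ennreal ((1 + 3 * v) * (\<mu> x * gap_laplace h (real n * v * (9 / 10 * \<mu> x)) x))"
  have "(\<integral>\<^sup>+\<omega>. ennreal (1 / real (cell_count T \<omega>)) \<partial>M)
      \<le> (\<integral>\<^sup>+\<omega>. (\<integral>\<^sup>+v\<in>{0..1}. ennreal ((1 + 3 * v) * (1 - v) ^ cell_count T \<omega>) \<partial>lborel) \<partial>M)"
    by (intro nn_integral_mono inverse_le_integral_power)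
  also have "\<dots> = (\<integral>\<^sup>+v. \<integral>\<^sup>+\<omega>. ennreal ((1 + 3 * v) * (1 - v) ^ cell_count T \<omega>) * indicator {0..1} v \<partial>M \<partial>lborel)"
    by (rule L.Fubini'[symmetric]) measurable
  also have "\<dots> = (\<integral>\<^sup>+v. (\<integral>\<^sup>+\<omega>. ennreal ((1 - v) ^ cell_count T \<omega>) \<partial>M) * (ennreal (1 + 3 * v) * indicator {0..1} v) \<partial>lborel)"
  proof (intro nn_integral_cong)
    fix v :: real
    have "ennreal ((1 + 3 * v) * p) * indicator {0..1} v = ennreal p * (ennreal (1 + 3 * v) * indicator {0..1} v)"
      for p :: real
      using ennreal_pull_factor[of "1 + 3 * v" p 1]
      by (cases "v \<in> {0..1}") (simp_all del: ennreal_plus)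
    then show "(\<integral>\<^sup>+\<omega>. ennreal ((1 + 3 * v) * (1 - v) ^ cell_count T \<omega>) * indicator {0..1} v \<partial>M)
      = (\<integral>\<^sup>+\<omega>. ennreal ((1 - v) ^ cell_count T \<omega>) \<partial>M) * (ennreal (1 + 3 * v) * indicator {0..1} v)"
      by (simp only:) (rule nn_integral_multc, measurable)
  qed
  also have "\<dots> \<le> (\<integral>\<^sup>+v. \<integral>\<^sup>+x. ?H v x * indicator {0..1} x * indicator {0..1} v \<partial>lborel \<partial>lborel)"
    using AE_lborel_singleton[of "0::real"]
  proof (intro nn_integral_mono_AE, eventually_elim)
    case (elim v)
    show ?case
    proof (cases "0 < v \<and> v \<le> 1")
      case True
      have "(\<integral>\<^sup>+\<omega>. ennreal ((1 - v) ^ cell_count T \<omega>) \<partial>M) * ennreal (1 + 3 * v) \<le>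
          (\<integral>\<^sup>+x\<in>{0..1}. ennreal (\<mu> x * gap_laplace h (real n * v * (9 / 10 * \<mu> x)) x) \<partial>lborel) * ennreal (1 + 3 * v)"
        using True by (intro mult_right_mono void_power_le T h) auto
      also have "\<dots> = (\<integral>\<^sup>+x. ?H v x * indicator {0..1} x \<partial>lborel)"
        using True density_gt_0
        by (subst nn_integral_multc[symmetric], measurable)
           (intro nn_integral_cong ennreal_pull_factor, simp)
      finally show ?thesis using True by simp
    qed (use elim in \<open>auto simp: indicator_def\<close>)
  qed
  also have "\<dots> = (\<integral>\<^sup>+x. \<integral>\<^sup>+v. ?H v x * indicator {0..1} x * indicator {0..1} v \<partial>lborel \<partial>lborel)"
    by (rule lborel_pair.Fubini') measurable
  also have "\<dots> = (\<integral>\<^sup>+x. (\<integral>\<^sup>+v\<in>{0..1}. ?H v x \<partial>lborel) * indicator {0..1} x \<partial>lborel)"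
    by (intro nn_integral_cong, subst nn_integral_multc[symmetric], measurable) (simp add: mult_ac)
  also have "\<dots> \<le> (\<integral>\<^sup>+x. (\<integral>\<^sup>+t\<in>{0<..}. ennreal (10 / (9 * real n) * correction t * gap_laplace h t x) \<partial>lborel) * indicator {0..1} x \<partial>lborel)"
    by (intro nn_integral_mono mult_right_mono rescale_le h0) auto
  also have "\<dots> = (\<integral>\<^sup>+x. \<integral>\<^sup>+t. ennreal (10 / (9 * real n) * correction t * gap_laplace h t x) * indicator {0<..} t * indicator {0..1} x \<partial>lborel \<partial>lborel)"
    by (intro nn_integral_cong, subst nn_integral_multc[symmetric], measurable)
  also have "\<dots> = (\<integral>\<^sup>+t. \<integral>\<^sup>+x. ennreal (10 / (9 * real n) * correction t * gap_laplace h t x) * indicator {0<..} t * indicator {0..1} x \<partial>lborel \<partial>lborel)"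
    by (rule lborel_pair.Fubini') measurable
  also have "\<dots> \<le> (\<integral>\<^sup>+t\<in>{0<..}. ennreal (10 / (9 * real n) * correction t * mean_gap h t) \<partial>lborel)"
  proof (intro nn_integral_mono)
    fix t :: real
    show "(\<integral>\<^sup>+x. ennreal (10 / (9 * real n) * correction t * gap_laplace h t x) * indicator {0<..} t * indicator {0..1} x \<partial>lborel)
      \<le> ennreal (10 / (9 * real n) * correction t * mean_gap h t) * indicator {0<..} t"
    proof (cases "0 < t")
      case True
      have "(\<integral>\<^sup>+x. ennreal (10 / (9 * real n) * correction t * gap_laplace h t x) * indicator {0<..} t * indicator {0..1} x \<partial>lborel)
        = ennreal (10 / (9 * real n) * correction t) * (\<integral>\<^sup>+x\<in>{0..1}. ennreal (gap_laplace h t x) \<partial>lborel)"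
        using True corr[of t] gap[of t]
        by (subst nn_integral_cmult[symmetric], measurable, intro nn_integral_cong)
           (auto simp: indicator_def ennreal_mult[symmetric])
      also have "\<dots> \<le> ennreal (10 / (9 * real n) * correction t) * ennreal (mean_gap h t)"
        using True h0 by (intro mult_left_mono nn_integral_gap_laplace_le) auto
      also have "\<dots> = ennreal (10 / (9 * real n) * correction t * mean_gap h t)"
        using True corr[of t] by (intro ennreal_mult'[symmetric]) auto
      finally show ?thesis using True by simp
    qed auto
  qed
  finally show ?thesis .
qed

definition edge_total :: real where
  "edge_total = 2 * (1 + sqrt rate / \<delta>) + 1 / \<delta>"

text \<open>All terms due to truncation and to the ends of the unit interval together are of order
  \<open>sqrt k\<close>.\<close>
lemma nn_integral_edge_le:
  assumes h: "\<And>t. 0 < t \<Longrightarrow> 0 \<le> h t \<and> h t \<le> exp_laplace rate t" and [measurable]: "h \<in> borel_measurable borel"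
  shows "(\<integral>\<^sup>+t\<in>{0<..}. ennreal (2 * (h t * edge t) + exp (- t * \<delta>)) \<partial>lborel) \<le> ennreal edge_total"
proof -
  have [measurable]: "exp_laplace rate \<in> borel_measurable borel" "edge \<in> borel_measurable borel"
    unfolding exp_laplace_def[abs_def] edge_def[abs_def] by measurable
  have edge: "0 \<le> edge t" if "0 < t" for t using that scale by (simp add: edge_def)
  have "(\<integral>\<^sup>+t\<in>{0<..}. ennreal (2 * (h t * edge t) + exp (- t * \<delta>)) \<partial>lborel) \<le>
      (\<integral>\<^sup>+t. 2 * (ennreal (exp_laplace rate t * edge t) * indicator {0<..} t)
         + ennreal (exp (- t * \<delta>)) * indicator {0<..} t \<partial>lborel)"
  proof (intro nn_integral_mono)
    fix t :: real
    have "ennreal (2 * (h t * edge t) + exp (- t * \<delta>)) \<le> ennreal (2 * (exp_laplace rate t * edge t) + exp (- t * \<delta>))"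
      if "0 < t"
      using h[OF that] edge[OF that] by (intro ennreal_leI add_mono mult_left_mono mult_right_mono) auto
    also have "ennreal (2 * (exp_laplace rate t * edge t) + exp (- t * \<delta>))
        = 2 * ennreal (exp_laplace rate t * edge t) + ennreal (exp (- t * \<delta>))" if "0 < t"
      using h[OF that] edge[OF that] by (simp add: ennreal_mult' del: times_divide_eq_left)
    finally show "ennreal (2 * (h t * edge t) + exp (- t * \<delta>)) * indicator {0<..} t \<le>
       2 * (ennreal (exp_laplace rate t * edge t) * indicator {0<..} t) + ennreal (exp (- t * \<delta>)) * indicator {0<..} t"
      by (simp add: indicator_def)
  qed
  also have "\<dots> = 2 * (\<integral>\<^sup>+t\<in>{0<..}. ennreal (exp_laplace rate t * edge t) \<partial>lborel)
      + (\<integral>\<^sup>+t\<in>{0<..}. ennreal (exp (- t * \<delta>)) \<partial>lborel)"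
    by (subst nn_integral_add, measurable, subst nn_integral_cmult, measurable)
  also have "\<dots> \<le> 2 * ennreal (1 + sqrt rate / \<delta>) + ennreal (1 / \<delta>)"
    unfolding edge_def using rate_pos scale
    by (intro add_mono mult_left_mono nn_integral_exp_laplace_boundary nn_integral_exp_positive) auto
  also have "\<dots> = ennreal edge_total"
  proof -
    have eq: "2 * ennreal a + ennreal b = ennreal (2 * a + b)" if "0 \<le> a" "0 \<le> b" for a b
      using that by (simp add: ennreal_mult')
    show ?thesis unfolding edge_total_def using rate_pos scale by (intro eq) auto
  qed
  finally show ?thesis .
qed

lemma correction_bounds:
  assumes "0 < t"
  shows "0 \<le> correction t" "correction t \<le> 4" "correction t \<le> 1 + 3 / sample_rate * t"
  using assms sample_rate_pos by (auto simp: correction_def)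

text \<open>For one tree the order \<open>k / n\<close> is enough, so the correction factor is simply replaced by its
  bound 4.\<close>
lemma mean_inverse_count_single_le:
  assumes "l \<in> {1..q}"
  shows "(\<integral>\<^sup>+\<omega>. ennreal (1 / real (cell_count {l} \<omega>)) \<partial>M) \<le> ennreal (40 / (9 * real n) * (rate + edge_total))"
proof -
  let ?h = "exp_laplace rate"
  have [measurable]: "?h \<in> borel_measurable borel" "edge \<in> borel_measurable borel"
    unfolding exp_laplace_def[abs_def] edge_def[abs_def] by measurable
  have h: "0 \<le> ?h t \<and> ?h t \<le> exp_laplace rate t" if "0 < t" for t
    using that rate_pos by (simp add: exp_laplace_def)
  have edge: "0 \<le> edge t" if "0 < t" for t using that scale by (simp add: edge_def)
  have "(\<integral>\<^sup>+\<omega>. ennreal (1 / real (cell_count {l} \<omega>)) \<partial>M)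
    \<le> (\<integral>\<^sup>+t\<in>{0<..}. ennreal (10 / (9 * real n) * correction t * mean_gap ?h t) \<partial>lborel)"
    using assms laplace_bound_1 by (intro mean_inverse_count_le) auto
  also have "\<dots> \<le> (\<integral>\<^sup>+t. ennreal (40 / (9 * real n)) * (ennreal ((?h t)\<^sup>2) * indicator {0..} t +
      ennreal (2 * (?h t * edge t) + exp (- t * \<delta>)) * indicator {0<..} t) \<partial>lborel)"
  proof (intro nn_integral_mono)
    fix t :: real
    have "10 / (9 * real n) * correction t * mean_gap ?h t \<le>
        10 / (9 * real n) * 4 * ((?h t)\<^sup>2 + (2 * (?h t * edge t) + exp (- t * \<delta>)))" if "0 < t"
      unfolding mean_gap_def add.assoc using correction_bounds[OF that] h[OF that] edge[OF that]
      by (intro mult_right_mono mult_left_mono) auto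
    then show "ennreal (10 / (9 * real n) * correction t * mean_gap ?h t) * indicator {0<..} t \<le>
      ennreal (40 / (9 * real n)) * (ennreal ((?h t)\<^sup>2) * indicator {0..} t +
      ennreal (2 * (?h t * edge t) + exp (- t * \<delta>)) * indicator {0<..} t)"
      using h[of t] edge[of t]
      by (auto simp: indicator_def ennreal_mult'[symmetric] ennreal_plus[symmetric] simp del: ennreal_plus intro!: ennreal_leI)
  qed
  also have "\<dots> = ennreal (40 / (9 * real n)) * ((\<integral>\<^sup>+t\<in>{0..}. ennreal ((?h t)\<^sup>2) \<partial>lborel) +
      (\<integral>\<^sup>+t\<in>{0<..}. ennreal (2 * (?h t * edge t) + exp (- t * \<delta>)) \<partial>lborel))"
    by (subst nn_integral_cmult, measurable, subst nn_integral_add, measurable)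
  also have "\<dots> \<le> ennreal (40 / (9 * real n)) * (ennreal rate + ennreal edge_total)"
    using h nn_integral_exp_laplace_square[OF rate_pos]
    by (intro mult_left_mono add_mono nn_integral_edge_le) auto
  also have "\<dots> = ennreal (40 / (9 * real n) * (rate + edge_total))"
    using rate_pos scale by (simp add: edge_total_def ennreal_mult'[symmetric] ennreal_plus[symmetric] del: ennreal_plus)
  finally show ?thesis .
qed

text \<open>For two trees the main term must keep its constant; the correction factor is bounded by 4 only in
  the negligible terms.\<close>
lemma mean_inverse_count_pair_le:
  assumes "l \<in> {1..q}" "l' \<in> {1..q}" "l \<noteq> l'"
  shows "(\<integral>\<^sup>+\<omega>. ennreal (1 / real (cell_count {l, l'} \<omega>)) \<partial>M)
    \<le> ennreal (10 / (9 * real n) * (9 / 16 * rate + 3 / sample_rate * (9 / 8 * rate\<^sup>2) + 4 * edge_total))"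
proof -
  let ?h = "max_exp_laplace rate"
  have [measurable]: "?h \<in> borel_measurable borel" "edge \<in> borel_measurable borel"
    unfolding max_exp_laplace_def[abs_def] edge_def[abs_def] by measurable
  have h: "0 \<le> ?h t \<and> ?h t \<le> exp_laplace rate t" if "0 < t" for t
    using that rate_pos max_exp_laplace_le_exp_laplace[of t rate] by (simp add: max_exp_laplace_def)
  have edge: "0 \<le> edge t" if "0 < t" for t using that scale by (simp add: edge_def)
  have "(\<integral>\<^sup>+\<omega>. ennreal (1 / real (cell_count {l, l'} \<omega>)) \<partial>M)
    \<le> (\<integral>\<^sup>+t\<in>{0<..}. ennreal (10 / (9 * real n) * correction t * mean_gap ?h t) \<partial>lborel)"
    using assms laplace_bound_2 by (intro mean_inverse_count_le) (auto simp: numeral_2_eq_2)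
  also have "\<dots> \<le> (\<integral>\<^sup>+t. ennreal (10 / (9 * real n)) * (ennreal ((?h t)\<^sup>2) * indicator {0..} t +
      ennreal (3 / sample_rate) * (ennreal (t * (?h t)\<^sup>2) * indicator {0..} t) +
      4 * (ennreal (2 * (?h t * edge t) + exp (- t * \<delta>)) * indicator {0<..} t)) \<partial>lborel)"
  proof (intro nn_integral_mono)
    fix t :: real
    define r where "r = 2 * (?h t * edge t) + exp (- t * \<delta>)"
    show "ennreal (10 / (9 * real n) * correction t * mean_gap ?h t) * indicator {0<..} t \<le>
      ennreal (10 / (9 * real n)) * (ennreal ((?h t)\<^sup>2) * indicator {0..} t +
      ennreal (3 / sample_rate) * (ennreal (t * (?h t)\<^sup>2) * indicator {0..} t) +
      4 * (ennreal (2 * (?h t * edge t) + exp (- t * \<delta>)) * indicator {0<..} t))"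
    proof (cases "0 < t")
      case True
      have r: "0 \<le> r" using h[OF True] edge[OF True] by (simp add: r_def)
      have "correction t * mean_gap ?h t = correction t * (?h t)\<^sup>2 + correction t * r"
        by (simp add: mean_gap_def r_def algebra_simps)
      also have "\<dots> \<le> (1 + 3 / sample_rate * t) * (?h t)\<^sup>2 + 4 * r"
        using correction_bounds[OF True] r by (intro add_mono mult_right_mono) auto
      finally have "10 / (9 * real n) * (correction t * mean_gap ?h t)
          \<le> 10 / (9 * real n) * ((?h t)\<^sup>2 + 3 / sample_rate * (t * (?h t)\<^sup>2) + 4 * r)"
        by (intro mult_left_mono) (auto simp: algebra_simps)
      then have "ennreal (10 / (9 * real n) * correction t * mean_gap ?h t)
          \<le> ennreal (10 / (9 * real n) * ((?h t)\<^sup>2 + 3 / sample_rate * (t * (?h t)\<^sup>2) + 4 * r))"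
        by (intro ennreal_leI) (simp add: mult.assoc)
      also have "\<dots> = ennreal (10 / (9 * real n)) *
          (ennreal ((?h t)\<^sup>2) + ennreal (3 / sample_rate) * ennreal (t * (?h t)\<^sup>2) + 4 * ennreal r)"
        using r True sample_rate_pos by (intro ennreal_weighted_sum) auto
      finally show ?thesis using True by (simp add: r_def)
    qed auto
  qed
  also have "\<dots> = ennreal (10 / (9 * real n)) * ((\<integral>\<^sup>+t\<in>{0..}. ennreal ((?h t)\<^sup>2) \<partial>lborel) +
      ennreal (3 / sample_rate) * (\<integral>\<^sup>+t\<in>{0..}. ennreal (t * (?h t)\<^sup>2) \<partial>lborel) +
      4 * (\<integral>\<^sup>+t\<in>{0<..}. ennreal (2 * (?h t * edge t) + exp (- t * \<delta>)) \<partial>lborel))"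
    by (simp add: nn_integral_cmult nn_integral_add)
  also have "\<dots> \<le> ennreal (10 / (9 * real n)) * (ennreal (9 / 16 * rate) +
      ennreal (3 / sample_rate) * ennreal (9 / 8 * rate\<^sup>2) + 4 * ennreal edge_total)"
    using h nn_integral_max_exp_laplace_square[OF rate_pos]
    by (intro mult_left_mono add_mono nn_integral_edge_le) auto
  also have "\<dots> = ennreal (10 / (9 * real n) * (9 / 16 * rate + 3 / sample_rate * (9 / 8 * rate\<^sup>2) + 4 * edge_total))"
    using rate_pos sample_rate_pos scale
    by (intro ennreal_weighted_sum[symmetric]) (auto simp: edge_total_def)
  finally show ?thesis .
qed

lemma prob_empty_cell_le:
  assumes l: "l \<in> {1..q}" and M: "\<And>x. x \<in> {0..1} \<Longrightarrow> \<mu> x \<le> D"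
  shows "(\<integral>\<^sup>+\<omega>. ennreal (0 ^ cell_count {l} \<omega>) \<partial>M) \<le> ennreal (D * mean_gap (exp_laplace rate) sample_rate)"
proof -
  let ?h = "exp_laplace rate"
  have "0 < D" using M[of 0] density_gt_0[of 0] by simp
  have h: "0 \<le> ?h t" if "0 \<le> t" for t
    using that rate_pos by (simp add: exp_laplace_def)
  have [measurable]: "?h \<in> borel_measurable borel"
    unfolding exp_laplace_def[abs_def] by measurable
  have "(\<integral>\<^sup>+\<omega>. ennreal (0 ^ cell_count {l} \<omega>) \<partial>M) \<le>
      (\<integral>\<^sup>+x\<in>{0..1}. ennreal (\<mu> x * gap_laplace ?h (real n * 1 * (9 / 10 * \<mu> x)) x) \<partial>lborel)"
    using void_power_le[of "{l}" ?h 1] l laplace_bound_1 by simp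
  also have "\<dots> \<le> (\<integral>\<^sup>+x. ennreal D * (ennreal (gap_laplace ?h sample_rate x) * indicator {0..1} x) \<partial>lborel)"
  proof (intro nn_integral_mono)
    fix x :: real
    let ?t = "real n * 1 * (9 / 10 * \<mu> x)"
    have t: "sample_rate \<le> ?t"
      unfolding sample_rate_def mult_1_right using density_pos(2)[of x]
      by (intro mult_left_mono) auto
    have "?h ?t \<le> ?h sample_rate"
      unfolding exp_laplace_def using t rate_pos sample_rate_pos by (intro divide_left_mono) auto
    moreover have "exp (- ?t * (\<delta> * y)) \<le> exp (- sample_rate * (\<delta> * y))" if "0 \<le> y" for y
      using mult_right_mono[OF t, of "\<delta> * y"] that scale by simp
    ultimately have "gap_laplace ?h ?t x \<le> gap_laplace ?h sample_rate x" if "x \<in> {0..1}"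
      unfolding gap_laplace_def using that h[of ?t] h[of sample_rate] t sample_rate_pos
      by (intro mult_mono add_mono add_nonneg_nonneg) auto
    moreover have "0 \<le> gap_laplace ?h ?t x"
      using h[of ?t] t sample_rate_pos by (simp add: gap_laplace_def)
    ultimately have "\<mu> x * gap_laplace ?h ?t x \<le> D * gap_laplace ?h sample_rate x" if "x \<in> {0..1}"
      using that M[OF that] \<open>0 < D\<close> by (intro mult_mono) auto
    then show "ennreal (\<mu> x * gap_laplace ?h ?t x) * indicator {0..1} x \<le>
        ennreal D * (ennreal (gap_laplace ?h sample_rate x) * indicator {0..1} x)"
      using \<open>0 < D\<close> by (auto simp: indicator_def ennreal_mult'[symmetric] ennreal_leI)
  qed
  also have "\<dots> = ennreal D * (\<integral>\<^sup>+x\<in>{0..1}. ennreal (gap_laplace ?h sample_rate x) \<partial>lborel)"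
    unfolding gap_laplace_def by (subst nn_integral_cmult) auto
  also have "\<dots> \<le> ennreal D * ennreal (mean_gap ?h sample_rate)"
    using sample_rate_pos h by (intro mult_left_mono nn_integral_gap_laplace_le) auto
  also have "\<dots> = ennreal (D * mean_gap ?h sample_rate)"
    using \<open>0 < D\<close> by (intro ennreal_mult'[symmetric]) auto
  finally show ?thesis .
qed

end

section \<open>Mean squared extent of a cell\<close>

lemma nn_integral_moment_gap:
  "(\<integral>\<^sup>+a\<in>{0..1}. ennreal (2 * a * (1 - a) ^ k) \<partial>lborel) = ennreal (2 / ((real k + 1) * (real k + 2)))"
proof -
  define F where "F a = - 2 * (1 - a) ^ (k + 1) / (real k + 1) + 2 * (1 - a) ^ (k + 2) / (real k + 2)" for a :: real
  have der: "DERIV F a :> 2 * a * (1 - a) ^ k" for a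
  proof -
    have "DERIV F a :> 2 * (1 - a) ^ k - 2 * (1 - a) ^ (k + 1)"
      unfolding F_def
      by ((rule derivative_eq_intros refl | simp add: divide_simps)+) (simp add: algebra_simps)
    then show ?thesis by (simp add: algebra_simps)
  qed
  have "(\<integral>\<^sup>+a\<in>{0..1}. ennreal (2 * a * (1 - a) ^ k) \<partial>lborel) = ennreal (F 1 - F 0)"
    by (rule interval_FTC) (auto intro: der)
  also have "F 1 - F 0 = 2 / ((real k + 1) * (real k + 2))"
    by (simp add: F_def divide_simps)
  finally show ?thesis .
qed

text \<open>Bound for the squared distance from \<open>x\<close> to the points of its cell: the squared lengths of the two
  arms of the cell, in layer-cake form. It is a measurable function of the cuts by construction, and its
  mean reduces to probabilities that an interval contains no cut.\<close>
definition sq_reach :: "nat \<Rightarrow> (nat \<Rightarrow> real) \<Rightarrow> real \<Rightarrow> ennreal" where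
  "sq_reach k v x =
    (\<integral>\<^sup>+a. ennreal (2 * a) * indicator {a. \<forall>j\<in>{1..k}. v j \<notin> {x - a..<x}} a * indicator {0..x} a \<partial>lborel) +
    (\<integral>\<^sup>+b. ennreal (2 * b) * indicator {b. \<forall>j\<in>{1..k}. v j \<notin> {x..<x + b}} b * indicator {0..1 - x} b \<partial>lborel)"

lemma sq_reach_cong: "(\<And>j. j \<in> {1..k} \<Longrightarrow> v j = v' j) \<Longrightarrow> sq_reach k v x = sq_reach k v' x"
  by (simp add: sq_reach_def)

lemma nn_integral_double:
  fixes d :: real
  assumes "0 \<le> d"
  shows "(\<integral>\<^sup>+a\<in>{0..d}. ennreal (2 * a) \<partial>lborel) = ennreal (d\<^sup>2)"
proof -
  have "DERIV (\<lambda>a. a\<^sup>2) a :> 2 * a" for a :: real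
    by (auto intro!: derivative_eq_intros)
  then show ?thesis
    using interval_FTC[OF assms, of "\<lambda>a. 2 * a" "\<lambda>a. a\<^sup>2"] by simp
qed

text \<open>No cut lies between \<open>x\<close> and a point \<open>y\<close> of its cell, so all layers up to the distance of
  \<open>x\<close> and \<open>y\<close> contribute.\<close>
lemma square_dist_le_sq_reach:
  assumes y: "y \<in> cell_of k v x" and x: "0 \<le> x" "x \<le> 1"
  shows "ennreal ((y - x)\<^sup>2) \<le> sq_reach k v x"
proof (cases "y \<le> x")
  case True
  have "v j \<notin> {x - a..<x}" if "a \<le> x - y" "j \<in> {1..k}" for a j
    using y that by (auto simp: cell_of_def)
  then have "(\<integral>\<^sup>+a\<in>{0..x - y}. ennreal (2 * a) \<partial>lborel) \<le>
      (\<integral>\<^sup>+a. ennreal (2 * a) * indicator {a. \<forall>j\<in>{1..k}. v j \<notin> {x - a..<x}} a * indicator {0..x} a \<partial>lborel)"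
    using y by (intro nn_integral_mono) (auto simp: indicator_def cell_of_def)
  then show ?thesis
    using nn_integral_double[of "x - y"] True
    by (simp add: sq_reach_def power2_commute add_increasing2)
next
  case False
  have "v j \<notin> {x..<x + b}" if "b \<le> y - x" "j \<in> {1..k}" for b j
  proof -
    have "v j < x \<longleftrightarrow> v j < y" using y that(2) by (simp add: cell_of_def)
    then show ?thesis using that(1) by auto
  qed
  then have "(\<integral>\<^sup>+b\<in>{0..y - x}. ennreal (2 * b) \<partial>lborel) \<le>
      (\<integral>\<^sup>+b. ennreal (2 * b) * indicator {b. \<forall>j\<in>{1..k}. v j \<notin> {x..<x + b}} b * indicator {0..1 - x} b \<partial>lborel)"
    using y by (intro nn_integral_mono) (auto simp: indicator_def cell_of_def)
  then show ?thesis
    using nn_integral_double[of "y - x"] False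
    by (simp add: sq_reach_def add_increasing)
qed

lemma sq_reach_measurable:
  assumes "\<And>j. j \<in> {1..k} \<Longrightarrow> (\<lambda>z. v z j) \<in> borel_measurable N" and [measurable]: "x \<in> borel_measurable N"
  shows "(\<lambda>z. sq_reach k (v z) (x z)) \<in> borel_measurable N"
proof -
  have [measurable]: "(\<lambda>z. v (fst z) j) \<in> borel_measurable (N \<Otimes>\<^sub>M borel)" if "j \<in> {1..k}" for j
    using assms(1)[OF that] by measurable
  show ?thesis unfolding sq_reach_def indicator_def atLeastAtMost_iff atLeastLessThan_iff by measurable
qed

lemma (in prob_space) nn_integral_avoid_le:
  assumes V: "indep_vars (\<lambda>_. borel) V {1..k}"
    and unif: "\<And>j. j \<in> {1..k} \<Longrightarrow> distr M lborel (V j) = uniform_measure lborel {0..1::real}"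
    and S: "\<And>a. a \<in> {0..d} \<Longrightarrow> S a \<in> sets borel \<and> S a \<subseteq> {0..1} \<and> measure lborel (S a) = a"
    and meas: "Measurable.pred (M \<Otimes>\<^sub>M borel) (\<lambda>z. \<forall>j\<in>{1..k}. V j (fst z) \<notin> S (snd z))"
    and d: "d \<le> 1"
  shows "(\<integral>\<^sup>+\<omega>. (\<integral>\<^sup>+a. ennreal (2 * a) * indicator {a. \<forall>j\<in>{1..k}. V j \<omega> \<notin> S a} a * indicator {0..d} a \<partial>lborel) \<partial>M)
    \<le> ennreal (2 / ((real k + 1) * (real k + 2)))"
proof -
  interpret L: pair_sigma_finite M lborel ..
  note [measurable] = meas
  have "(\<integral>\<^sup>+\<omega>. (\<integral>\<^sup>+a. ennreal (2 * a) * indicator {a. \<forall>j\<in>{1..k}. V j \<omega> \<notin> S a} a * indicator {0..d} a \<partial>lborel) \<partial>M)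
    = (\<integral>\<^sup>+a. (\<integral>\<^sup>+\<omega>. ennreal (2 * a) * indicator {a. \<forall>j\<in>{1..k}. V j \<omega> \<notin> S a} a * indicator {0..d} a \<partial>M) \<partial>lborel)"
    unfolding indicator_def mem_Collect_eq by (rule L.Fubini'[symmetric]) measurable
  also have "\<dots> \<le> (\<integral>\<^sup>+a\<in>{0..1}. ennreal (2 * a * (1 - a) ^ k) \<partial>lborel)"
  proof (intro nn_integral_mono)
    fix a :: real
    show "(\<integral>\<^sup>+\<omega>. ennreal (2 * a) * indicator {a. \<forall>j\<in>{1..k}. V j \<omega> \<notin> S a} a * indicator {0..d} a \<partial>M)
      \<le> ennreal (2 * a * (1 - a) ^ k) * indicator {0..1} a"
    proof (cases "a \<in> {0..d}")
      case True
      let ?E = "{\<omega> \<in> space M. \<forall>j\<in>{1..k}. V j \<omega> \<notin> S a}"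
      have [measurable]: "V j \<in> borel_measurable M" if "j \<in> {1..k}" for j
        using V that by (auto simp: indep_vars_def)
      have [measurable]: "S a \<in> sets borel" using S[OF True] by simp
      have E: "?E \<in> events" by measurable
      have "(\<integral>\<^sup>+\<omega>. ennreal (2 * a) * indicator {a. \<forall>j\<in>{1..k}. V j \<omega> \<notin> S a} a * indicator {0..d} a \<partial>M)
          = (\<integral>\<^sup>+\<omega>. ennreal (2 * a) * indicator ?E \<omega> \<partial>M)"
        using True by (intro nn_integral_cong) (auto simp: indicator_def)
      also have "\<dots> = ennreal (2 * a) * ennreal (prob ?E)"
        using E by (simp add: nn_integral_cmult_indicator emeasure_eq_measure)
      also have "prob ?E = (1 - a) ^ k"
        using prob_avoid[OF V _ unif, of "S a"] S[OF True] by simp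
      also have "ennreal (2 * a) * ennreal ((1 - a) ^ k) = ennreal (2 * a * (1 - a) ^ k)"
        using True by (intro ennreal_mult'[symmetric]) auto
      finally show ?thesis using True d by simp
    qed auto
  qed
  also have "\<dots> = ennreal (2 / ((real k + 1) * (real k + 2)))"
    by (rule nn_integral_moment_gap)
  finally show ?thesis .
qed

context forest_model
begin

text \<open>Each side contributes at most the integral of \<open>2 a (1 - a) ^ k\<close> over the unit interval.\<close>
lemma mean_sq_reach_le:
  assumes l: "l \<in> {1..q}"
  shows "(\<integral>\<^sup>+\<omega>. sq_reach k (the_cuts \<omega> l) (Z New_Point \<omega>) \<partial>M) \<le> ennreal (4 / ((real k + 1) * (real k + 2)))"
proof -
  have fixed: "(\<integral>\<^sup>+\<omega>. sq_reach k (the_cuts \<omega> l) x \<partial>M) \<le> ennreal (4 / ((real k + 1) * (real k + 2)))"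
    if x: "0 \<le> x" "x \<le> 1" for x
  proof -
    have [measurable]: "(\<lambda>z. Z (Cut l j) (fst z)) \<in> borel_measurable (M \<Otimes>\<^sub>M borel)" if "j \<in> {1..k}" for j
      using l that by (intro measurable_compose[OF measurable_fst cut_measurable]) auto
    have [measurable]: "Z (Cut l j) \<in> borel_measurable M" if "j \<in> {1..k}" for j
      using l that cut_measurable by auto
    have "(\<integral>\<^sup>+\<omega>. sq_reach k (the_cuts \<omega> l) x \<partial>M) =
      (\<integral>\<^sup>+\<omega>. (\<integral>\<^sup>+a. ennreal (2 * a) * indicator {a. \<forall>j\<in>{1..k}. Z (Cut l j) \<omega> \<notin> {x - a..<x}} a * indicator {0..x} a \<partial>lborel) \<partial>M) +
      (\<integral>\<^sup>+\<omega>. (\<integral>\<^sup>+b. ennreal (2 * b) * indicator {b. \<forall>j\<in>{1..k}. Z (Cut l j) \<omega> \<notin> {x..<x + b}} b * indicator {0..1 - x} b \<partial>lborel) \<partial>M)"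
      unfolding sq_reach_def indicator_def atLeastAtMost_iff atLeastLessThan_iff
      by (rule nn_integral_add) measurable
    also have "\<dots> \<le> ennreal (2 / ((real k + 1) * (real k + 2))) + ennreal (2 / ((real k + 1) * (real k + 2)))"
    proof (intro add_mono nn_integral_avoid_le tree_indep[OF l])
      show "Measurable.pred (M \<Otimes>\<^sub>M borel) (\<lambda>z. \<forall>j\<in>{1..k}. Z (Cut l j) (fst z) \<notin> {x - snd z..<x})"
        "Measurable.pred (M \<Otimes>\<^sub>M borel) (\<lambda>z. \<forall>j\<in>{1..k}. Z (Cut l j) (fst z) \<notin> {x..<x + snd z})"
        unfolding atLeastLessThan_iff by measurable
    qed (use x l cut_uniform in auto)
    also have "\<dots> = ennreal (4 / ((real k + 1) * (real k + 2)))"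
      by (simp flip: ennreal_plus)
    finally show ?thesis .
  qed
  define f where "f = (\<lambda>(a :: source \<Rightarrow> real, b :: source \<Rightarrow> real). sq_reach k (\<lambda>j. b (Cut l j)) (a New_Point))"
  let ?R = "\<lambda>D \<omega>. restrict (\<lambda>i. Z i \<omega>) D"
  have f_meas: "f \<in> borel_measurable (PiM {New_Point} (\<lambda>_. borel) \<Otimes>\<^sub>M PiM (cuts {l}) (\<lambda>_. borel))"
    unfolding f_def case_prod_beta
  proof (rule sq_reach_measurable)
    show "(\<lambda>z. snd z (Cut l j)) \<in> borel_measurable (PiM {New_Point} (\<lambda>_. borel) \<Otimes>\<^sub>M PiM (cuts {l}) (\<lambda>_. borel))"
      if "j \<in> {1..k}" for j
    proof -
      have [measurable]: "Cut l j \<in> cuts {l}" using that by (auto simp: cuts_def)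
      show ?thesis by measurable
    qed
  qed measurable
  have "sq_reach k (\<lambda>j. ?R (cuts {l}) \<omega> (Cut l j)) x = sq_reach k (the_cuts \<omega> l) x" for \<omega> x
    by (rule sq_reach_cong) (auto simp: cuts_def)
  then have f_eq: "f (?R {New_Point} \<omega>, ?R (cuts {l}) \<omega>') = sq_reach k (the_cuts \<omega>' l) (Z New_Point \<omega>)" for \<omega> \<omega>'
    unfolding f_def by simp
  have "(\<integral>\<^sup>+\<omega>. sq_reach k (the_cuts \<omega> l) (Z New_Point \<omega>) \<partial>M)
      = (\<integral>\<^sup>+\<omega>. \<integral>\<^sup>+\<omega>'. sq_reach k (the_cuts \<omega>' l) (Z New_Point \<omega>) \<partial>M \<partial>M)"
    unfolding f_eq[symmetric]
    by (rule nn_integral_indep_var[OF indep_var_restrict[OF indep] f_meas])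
       (use l in \<open>auto simp: sources_def cuts_def\<close>)
  also have "\<dots> \<le> (\<integral>\<^sup>+\<omega>. ennreal (4 / ((real k + 1) * (real k + 2))) \<partial>M)"
    using AE_point_unit by (intro nn_integral_mono_AE, eventually_elim) (use fixed in blast)
  also have "\<dots> = ennreal (4 / ((real k + 1) * (real k + 2)))"
    by (simp add: emeasure_space_1)
  finally show ?thesis .
qed

end

section \<open>Bias and variance of the forest\<close>

lemma weight_nonneg: "0 \<le> weight n x A i"
  by (simp add: weight_eq)

lemma weight_measurable:
  assumes "\<And>i. i \<in> {1..n} \<Longrightarrow> Measurable.pred N (\<lambda>z. x z i \<in> A z)" "i \<in> {1..n}"
  shows "(\<lambda>z. weight n (x z) (A z) i) \<in> borel_measurable N"
proof -
  note [measurable] = assms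
  show ?thesis unfolding weight_def indicator_def by measurable
qed

text \<open>In a nonempty cell the weights sum to 1, and the deviation is at most \<open>C\<close> times the largest
  distance from \<open>t\<close> to an observation of the cell; in an empty cell the prediction is 0, and the power
  of 0 equals 1.\<close>
lemma weighted_deviation_le:
  fixes s :: "real \<Rightarrow> real"
  assumes lip: "\<And>x y. \<bar>s x - s y\<bar> \<le> C * \<bar>x - y\<bar>" and "0 \<le> C" and S: "\<And>x. \<bar>s x\<bar> \<le> S"
    and r: "\<And>i. i \<in> {1..n} \<Longrightarrow> x i \<in> A \<Longrightarrow> ennreal ((x i - t)\<^sup>2) \<le> r"
  shows "ennreal (((\<Sum>i\<in>{1..n}. weight n x A i * s (x i)) - s t)\<^sup>2)
    \<le> ennreal (C\<^sup>2) * r + ennreal (S\<^sup>2) * ennreal (0 ^ count_in n x A)"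
proof (cases "{i \<in> {1..n}. x i \<in> A} = {}")
  case True
  then have c: "count_in n x A = 0" by (simp only: card.empty)
  then have w: "(\<Sum>i\<in>{1..n}. weight n x A i * s (x i)) = 0"
    unfolding weight_eq by simp
  have "(s t)\<^sup>2 \<le> S\<^sup>2"
    using S[of t] by (simp add: abs_le_square_iff[symmetric])
  then show ?thesis unfolding w c by (simp add: ennreal_leI add_increasing)
next
  case False
  define J where "J = {i \<in> {1..n}. x i \<in> A}"
  have "finite J" "J \<noteq> {}" using False by (auto simp: J_def)
  have "Max ((\<lambda>i. \<bar>x i - t\<bar>) ` J) \<in> (\<lambda>i. \<bar>x i - t\<bar>) ` J"
    using \<open>finite J\<close> \<open>J \<noteq> {}\<close> by (intro Max_in) auto
  \<comment> \<open>The observation of the cell that is farthest from \<open>t\<close>.\<close>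
  then obtain i0 where i0_J: "i0 \<in> J" and i0_Max: "Max ((\<lambda>i. \<bar>x i - t\<bar>) ` J) = \<bar>x i0 - t\<bar>"
    by auto
  have i0: "i0 \<in> J" "\<And>i. i \<in> J \<Longrightarrow> \<bar>x i - t\<bar> \<le> \<bar>x i0 - t\<bar>"
    using i0_J \<open>finite J\<close> unfolding i0_Max[symmetric] by auto
  have w1: "(\<Sum>i\<in>{1..n}. weight n x A i) = 1"
    using False sum_weight[of n x A] by auto
  have "(\<Sum>i\<in>{1..n}. weight n x A i * s (x i)) - s t = (\<Sum>i\<in>{1..n}. weight n x A i * (s (x i) - s t))"
    using w1 by (simp add: right_diff_distrib sum_subtractf flip: sum_distrib_right)
  also have "\<bar>\<dots>\<bar> \<le> (\<Sum>i\<in>{1..n}. weight n x A i * (C * \<bar>x i0 - t\<bar>))"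
  proof (rule order_trans[OF sum_abs], rule sum_mono)
    fix i assume i: "i \<in> {1..n}"
    show "\<bar>weight n x A i * (s (x i) - s t)\<bar> \<le> weight n x A i * (C * \<bar>x i0 - t\<bar>)"
    proof (cases "x i \<in> A")
      case True
      then have "\<bar>s (x i) - s t\<bar> \<le> C * \<bar>x i0 - t\<bar>"
        using i i0(2)[of i] lip[of "x i" t] mult_left_mono[OF i0(2)[of i] \<open>0 \<le> C\<close>] by (auto simp: J_def)
      then show ?thesis by (simp add: abs_mult weight_nonneg mult_left_mono)
    qed (simp add: weight_eq)
  qed
  also have "\<dots> = C * \<bar>x i0 - t\<bar>"
    using w1 by (simp flip: sum_distrib_right)
  finally have "((\<Sum>i\<in>{1..n}. weight n x A i * s (x i)) - s t)\<^sup>2 \<le> (C * \<bar>x i0 - t\<bar>)\<^sup>2"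
    by (rule abs_le_square_iff[THEN iffD1, OF order_trans]) simp
  also have "(C * \<bar>x i0 - t\<bar>)\<^sup>2 = C\<^sup>2 * (x i0 - t)\<^sup>2" by (simp add: power_mult_distrib)
  finally have "ennreal (((\<Sum>i\<in>{1..n}. weight n x A i * s (x i)) - s t)\<^sup>2) \<le> ennreal (C\<^sup>2) * ennreal ((x i0 - t)\<^sup>2)"
    by (simp add: ennreal_mult'[symmetric] ennreal_leI)
  also have "\<dots> \<le> ennreal (C\<^sup>2) * r"
    using r[of i0] i0(1) by (intro mult_left_mono) (auto simp: J_def)
  also have "\<dots> \<le> ennreal (C\<^sup>2) * r + ennreal (S\<^sup>2) * ennreal (0 ^ count_in n x A)"
    by simp
  finally show ?thesis .
qed

lemma square_mean_le_mean_square: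
  fixes f :: "nat \<Rightarrow> real"
  assumes "1 \<le> q"
  shows "(1 / real q * (\<Sum>l\<in>{1..q}. f l))\<^sup>2 \<le> 1 / real q * (\<Sum>l\<in>{1..q}. (f l)\<^sup>2)"
proof -
  have "(\<Sum>l\<in>{1..q}. f l)\<^sup>2 \<le> (\<Sum>l\<in>{1..q}. (f l)\<^sup>2) * real q"
    using sum_squared_le_sum_of_squares[of f "{1..q}"] by simp
  then show ?thesis using assms by (simp add: power_mult_distrib power2_eq_square[of "real q"] field_simps)
qed

text \<open>The regression part of the model. Like the density, the regression function is taken to be defined,
  Lipschitz and bounded on the whole line.\<close>
locale forest_regression = forest_model +
  fixes s :: "real \<Rightarrow> real" and \<sigma> C S D :: real
  assumes s_measurable [measurable]: "s \<in> borel_measurable borel"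
    and s_lipschitz: "\<And>x y. \<bar>s x - s y\<bar> \<le> C * \<bar>x - y\<bar>" and C_nonneg: "0 \<le> C"
    and s_bounded: "\<And>x. \<bar>s x\<bar> \<le> S"
    and density_le: "\<And>x. x \<in> {0..1} \<Longrightarrow> \<mu> x \<le> D"
    and noise_square_integrable: "\<And>i. i \<in> {1..n} \<Longrightarrow> integrable M (\<lambda>\<omega>. (Z (Noise i) \<omega>)\<^sup>2)"
    and noise_centered: "\<And>i. i \<in> {1..n} \<Longrightarrow> expectation (Z (Noise i)) = 0"
    and noise_second_moment: "\<And>i. i \<in> {1..n} \<Longrightarrow> expectation (\<lambda>\<omega>. (Z (Noise i) \<omega>)\<^sup>2) = \<sigma>\<^sup>2"
begin

lemma noise_measurable [measurable]: "i \<in> {1..n} \<Longrightarrow> Z (Noise i) \<in> borel_measurable M"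
  by (rule source_measurable) (auto simp: sources_def)

lemma noise_integrable: "i \<in> {1..n} \<Longrightarrow> integrable M (Z (Noise i))"
  by (rule square_integrable_imp_integrable[OF noise_measurable noise_square_integrable])

lemma noise_indep:
  assumes "i \<in> {1..n}" "j \<in> {1..n}" "i \<noteq> j"
  shows "indep_var borel (Z (Noise i)) borel (Z (Noise j))"
proof -
  have "indep_var (PiM {Noise i} (\<lambda>_. borel)) (\<lambda>\<omega>. restrict (\<lambda>v. Z v \<omega>) {Noise i})
      (PiM {Noise j} (\<lambda>_. borel)) (\<lambda>\<omega>. restrict (\<lambda>v. Z v \<omega>) {Noise j})"
    using assms by (intro indep_var_restrict[OF indep]) (auto simp: sources_def)
  then have "indep_var borel ((\<lambda>f. f (Noise i)) \<circ> (\<lambda>\<omega>. restrict (\<lambda>v. Z v \<omega>) {Noise i}))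
      borel ((\<lambda>f. f (Noise j)) \<circ> (\<lambda>\<omega>. restrict (\<lambda>v. Z v \<omega>) {Noise j}))"
    by (rule indep_var_compose) measurable
  then show ?thesis by (simp add: comp_def)
qed

lemma noise_product:
  assumes i: "i \<in> {1..n}" and j: "j \<in> {1..n}"
  shows "integrable M (\<lambda>\<omega>. Z (Noise i) \<omega> * Z (Noise j) \<omega>)"
    and "expectation (\<lambda>\<omega>. Z (Noise i) \<omega> * Z (Noise j) \<omega>) = (if i = j then \<sigma>\<^sup>2 else 0)"
proof -
  show "integrable M (\<lambda>\<omega>. Z (Noise i) \<omega> * Z (Noise j) \<omega>)"
  proof (cases "i = j")
    case True
    then show ?thesis using noise_square_integrable[OF i] by (simp add: power2_eq_square)
  next
    case False
    then show ?thesis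
      by (intro indep_var_integrable noise_indep noise_integrable i j)
  qed
  show "expectation (\<lambda>\<omega>. Z (Noise i) \<omega> * Z (Noise j) \<omega>) = (if i = j then \<sigma>\<^sup>2 else 0)"
  proof (cases "i = j")
    case True
    then show ?thesis using noise_second_moment[OF i] by (simp add: power2_eq_square)
  next
    case False
    then have "expectation (\<lambda>\<omega>. Z (Noise i) \<omega> * Z (Noise j) \<omega>) = expectation (Z (Noise i)) * expectation (Z (Noise j))"
      by (intro indep_var_lebesgue_integral noise_indep noise_integrable i j)
    then show ?thesis using False noise_centered[OF i] by simp
  qed
qed

text \<open>The linear term vanishes since the noise is centred, the off-diagonal products since it is
  independent.\<close>
lemma shifted_noise_second_moment:
  "(\<integral>\<^sup>+\<omega>. ennreal ((d + (\<Sum>i\<in>{1..n}. w i * Z (Noise i) \<omega>))\<^sup>2) \<partial>M)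
    = ennreal (d\<^sup>2 + \<sigma>\<^sup>2 * (\<Sum>i\<in>{1..n}. (w i)\<^sup>2))"
proof -
  define L where "L \<omega> = (\<Sum>i\<in>{1..n}. w i * Z (Noise i) \<omega>)" for \<omega>
  define R where "R i \<omega> = (\<Sum>j\<in>{1..n}. w i * w j * (Z (Noise i) \<omega> * Z (Noise j) \<omega>))" for i \<omega>
  have sq: "(d + L \<omega>)\<^sup>2 = d\<^sup>2 + 2 * d * L \<omega> + (\<Sum>i\<in>{1..n}. R i \<omega>)" for \<omega>
  proof -
    have "L \<omega> * L \<omega> = (\<Sum>i\<in>{1..n}. R i \<omega>)"
      unfolding L_def R_def sum_product by (intro sum.cong refl) simp
    then show ?thesis by (simp add: power2_sum power2_eq_square algebra_simps)
  qed
  have int_L: "integrable M L"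
    unfolding L_def[abs_def]
    by (rule Bochner_Integration.integrable_sum, rule integrable_mult_right, rule noise_integrable)
  have E_L: "expectation L = 0"
  proof -
    have "expectation L = (\<Sum>i\<in>{1..n}. expectation (\<lambda>\<omega>. w i * Z (Noise i) \<omega>))"
      unfolding L_def[abs_def]
      by (rule Bochner_Integration.integral_sum, rule integrable_mult_right, rule noise_integrable)
    also have "\<dots> = 0"
      by (rule sum.neutral) (simp add: noise_centered)
    finally show ?thesis .
  qed
  have int_R: "integrable M (R i)" if "i \<in> {1..n}" for i
    unfolding R_def[abs_def]
    by (rule Bochner_Integration.integrable_sum, rule integrable_mult_right, rule noise_product(1)[OF that])
  have E_R: "expectation (R i) = \<sigma>\<^sup>2 * (w i)\<^sup>2" if i: "i \<in> {1..n}" for i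
  proof -
    have "expectation (R i) = (\<Sum>j\<in>{1..n}. expectation (\<lambda>\<omega>. w i * w j * (Z (Noise i) \<omega> * Z (Noise j) \<omega>)))"
      unfolding R_def[abs_def]
      by (rule Bochner_Integration.integral_sum, rule integrable_mult_right, rule noise_product(1)[OF i])
    also have "\<dots> = (\<Sum>j\<in>{1..n}. if i = j then w i * w j * \<sigma>\<^sup>2 else 0)"
      using i by (intro sum.cong refl) (simp add: noise_product)
    also have "\<dots> = \<sigma>\<^sup>2 * (w i)\<^sup>2" using i by (simp add: power2_eq_square)
    finally show ?thesis .
  qed
  have int_sum: "integrable M (\<lambda>\<omega>. \<Sum>i\<in>{1..n}. R i \<omega>)"
    by (rule Bochner_Integration.integrable_sum) (rule int_R)
  have int_aff: "integrable M (\<lambda>\<omega>. d\<^sup>2 + 2 * d * L \<omega>)"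
    using int_L by simp
  have int_sq: "integrable M (\<lambda>\<omega>. (d + L \<omega>)\<^sup>2)"
    unfolding sq using int_aff int_sum by (rule Bochner_Integration.integrable_add)
  have "expectation (\<lambda>\<omega>. (d + L \<omega>)\<^sup>2) = expectation (\<lambda>\<omega>. d\<^sup>2 + 2 * d * L \<omega>) + expectation (\<lambda>\<omega>. \<Sum>i\<in>{1..n}. R i \<omega>)"
    unfolding sq using int_aff int_sum by (rule Bochner_Integration.integral_add)
  also have "expectation (\<lambda>\<omega>. d\<^sup>2 + 2 * d * L \<omega>) = d\<^sup>2"
    using int_L E_L by (simp add: prob_space)
  also have "expectation (\<lambda>\<omega>. \<Sum>i\<in>{1..n}. R i \<omega>) = (\<Sum>i\<in>{1..n}. expectation (R i))"
    by (rule Bochner_Integration.integral_sum) (rule int_R)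
  also have "\<dots> = \<sigma>\<^sup>2 * (\<Sum>i\<in>{1..n}. (w i)\<^sup>2)"
    unfolding sum_distrib_left by (intro sum.cong refl E_R)
  finally have "(\<integral>\<^sup>+\<omega>. ennreal ((d + L \<omega>)\<^sup>2) \<partial>M) = ennreal (d\<^sup>2 + \<sigma>\<^sup>2 * (\<Sum>i\<in>{1..n}. (w i)\<^sup>2))"
    using nn_integral_eq_integral[OF int_sq] by simp
  then show ?thesis by (simp only: L_def)
qed

text \<open>From here on, quantities of the forest are functions of the values of all sources, so that they
  can be evaluated at \<open>the_sources \<omega>\<close> and also at a restricted family of sources.\<close>
definition cell_at :: "nat \<Rightarrow> (source \<Rightarrow> real) \<Rightarrow> real set" where
  "cell_at l a = cell_of k (\<lambda>j. a (Cut l j)) (a New_Point)"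

definition weight_at :: "nat \<Rightarrow> (source \<Rightarrow> real) \<Rightarrow> nat \<Rightarrow> real" where
  "weight_at l a i = weight n (\<lambda>i. a (Design i)) (cell_at l a) i"

definition tree_bias :: "nat \<Rightarrow> (source \<Rightarrow> real) \<Rightarrow> real" where
  "tree_bias l a = (\<Sum>i\<in>{1..n}. weight_at l a i * s (a (Design i))) - s (a New_Point)"

definition forest_bias :: "(source \<Rightarrow> real) \<Rightarrow> real" where
  "forest_bias a = 1 / real q * (\<Sum>l\<in>{1..q}. tree_bias l a)"

definition forest_weight :: "(source \<Rightarrow> real) \<Rightarrow> nat \<Rightarrow> real" where
  "forest_weight a i = 1 / real q * (\<Sum>l\<in>{1..q}. weight_at l a i)"

text \<open>The sources on which the bias and the weights depend; the noise is independent of them.\<close>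
definition observed :: "source set" where
  "observed = sources n k q - range Noise"

lemma observed_mem:
  "New_Point \<in> observed" "i \<in> {1..n} \<Longrightarrow> Design i \<in> observed"
  "l \<in> {1..q} \<Longrightarrow> j \<in> {1..k} \<Longrightarrow> Cut l j \<in> observed"
  by (auto simp: observed_def sources_def)

lemma weight_at_cong:
  assumes "\<And>v. v \<in> observed \<Longrightarrow> a v = b v" "l \<in> {1..q}" "i \<in> {1..n}"
  shows "weight_at l a i = weight_at l b i"
proof -
  have "cell_at l a = cell_at l b"
    using assms by (simp add: cell_at_def cell_of_def observed_mem)
  then show ?thesis
    using assms by (simp add: weight_at_def weight_def observed_mem)
qed

lemma forest_cong:
  assumes ab: "\<And>v. v \<in> observed \<Longrightarrow> a v = b v"
  shows "forest_bias a = forest_bias b" "i \<in> {1..n} \<Longrightarrow> forest_weight a i = forest_weight b i"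
  unfolding forest_bias_def forest_weight_def tree_bias_def
  by (auto intro!: arg_cong2[of _ _ _ _ "(*)"] sum.cong arg_cong2[of _ _ _ _ "(-)"] weight_at_cong ab
      simp: ab observed_mem)

lemma weight_at_measurable:
  assumes a: "\<And>v. v \<in> observed \<Longrightarrow> (\<lambda>z. a z v) \<in> borel_measurable N" and "l \<in> {1..q}" "i \<in> {1..n}"
  shows "(\<lambda>z. weight_at l (a z) i) \<in> borel_measurable N"
proof -
  have "Measurable.pred N (\<lambda>z. a z (Design i) \<in> merged_cell {l} (\<lambda>l j. a z (Cut l j)) (a z New_Point))"
    if "i \<in> {1..n}" for i
    using that assms(2) by (intro pred_merged_cell a observed_mem) auto
  then show ?thesis
    unfolding weight_at_def cell_at_def using assms(3)
    by (intro weight_measurable) (auto simp: merged_cell_def)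
qed

lemma forest_bias_measurable:
  assumes a: "\<And>v. v \<in> observed \<Longrightarrow> (\<lambda>z. a z v) \<in> borel_measurable N"
  shows "(\<lambda>z. forest_bias (a z)) \<in> borel_measurable N"
proof -
  note [measurable] = weight_at_measurable[OF a] a
  note [simp] = observed_mem
  have [measurable]: "(\<lambda>z. s (a z (Design i))) \<in> borel_measurable N" if "i \<in> {1..n}" for i
    using a[of "Design i"] that by (auto intro!: measurable_compose[OF _ s_measurable])
  have [measurable]: "(\<lambda>z. s (a z New_Point)) \<in> borel_measurable N"
    using a[of New_Point] by (auto intro!: measurable_compose[OF _ s_measurable])
  show ?thesis unfolding forest_bias_def tree_bias_def by measurable
qed

lemma forest_weight_measurable:
  assumes a: "\<And>v. v \<in> observed \<Longrightarrow> (\<lambda>z. a z v) \<in> borel_measurable N" and "i \<in> {1..n}"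
  shows "(\<lambda>z. forest_weight (a z) i) \<in> borel_measurable N"
proof -
  note [measurable] = weight_at_measurable[OF a _ assms(2)]
  show ?thesis unfolding forest_weight_def by measurable
qed

abbreviation the_sources :: "'a \<Rightarrow> source \<Rightarrow> real" where
  "the_sources \<omega> \<equiv> \<lambda>v. Z v \<omega>"

definition response :: "'a \<Rightarrow> nat \<Rightarrow> real" where
  "response \<omega> i = s (Z (Design i) \<omega>) + Z (Noise i) \<omega>"

abbreviation forest_error :: "'a \<Rightarrow> real" where
  "forest_error \<omega> \<equiv>
    forest_est n (the_design \<omega>) (response \<omega>) k q (the_cuts \<omega>) (Z New_Point \<omega>) -
      s (Z New_Point \<omega>)"

lemma AE_cuts_unit: "AE \<omega> in M. \<forall>l\<in>{1..q}. \<forall>j\<in>{1..k}. Z (Cut l j) \<omega> \<in> {0..1}"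
proof -
  have "AE \<omega> in M. Z (Cut l j) \<omega> \<in> {0..1}" if "l \<in> {1..q}" "j \<in> {1..k}" for l j
  proof -
    have [measurable]: "Z (Cut l j) \<in> borel_measurable M" using cut_measurable that by auto
    have "AE x in distr M lborel (Z (Cut l j)). x \<in> {0..1}"
      unfolding cut_uniform[OF that] by (intro AE_uniform_measureI AE_I2) auto
    then show ?thesis by (subst (asm) AE_distr_iff) auto
  qed
  then show ?thesis by (simp add: AE_finite_all)
qed

lemma AE_point_pos: "AE \<omega> in M. 0 < Z New_Point \<omega> \<and> Z New_Point \<omega> \<le> 1"
  using AE_lborel_singleton[of "0::real"]
  by (subst distributed_AE2[OF point_density]) (auto elim!: eventually_mono simp: indicator_def)

text \<open>The exceptional null set consists of cuts outside the unit interval and of the new point 0, which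
  belongs to no cell.\<close>
lemma AE_forest_error:
  "AE \<omega> in M. forest_error \<omega>
    = forest_bias (the_sources \<omega>) + (\<Sum>i\<in>{1..n}. forest_weight (the_sources \<omega>) i * Z (Noise i) \<omega>)"
  using AE_cuts_unit AE_point_pos
proof eventually_elim
  case (elim \<omega>)
  let ?a = "the_sources \<omega>"
  have tree: "tree_est n (the_design \<omega>) (response \<omega>) k (the_cuts \<omega> l) (Z New_Point \<omega>)
      = tree_bias l ?a + s (Z New_Point \<omega>) + (\<Sum>i\<in>{1..n}. weight_at l ?a i * Z (Noise i) \<omega>)"
    if "l \<in> {1..q}" for l
  proof -
    have "tree_est n (the_design \<omega>) (response \<omega>) k (the_cuts \<omega> l) (Z New_Point \<omega>)
        = (\<Sum>i\<in>{1..n}. weight_at l ?a i * response \<omega> i)"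
      using elim that
      by (subst tree_est_eq_cell_mean) (auto simp: cell_mean_eq_weights weight_at_def cell_at_def)
    then show ?thesis
      by (simp add: tree_bias_def response_def distrib_left sum.distrib)
  qed
  have "(\<Sum>i\<in>{1..n}. forest_weight ?a i * Z (Noise i) \<omega>) =
      1 / real q * (\<Sum>l\<in>{1..q}. \<Sum>i\<in>{1..n}. weight_at l ?a i * Z (Noise i) \<omega>)"
    unfolding forest_weight_def sum.swap[of _ "{1..n}"]
    by (simp add: sum_distrib_left sum_distrib_right sum_divide_distrib sum.swap[of _ "{1..q}"])
  moreover have "forest_est n (the_design \<omega>) (response \<omega>) k q (the_cuts \<omega>) (Z New_Point \<omega>) =
    1 / real q * ((\<Sum>l\<in>{1..q}. tree_bias l ?a) + real q * s (Z New_Point \<omega>)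
      + (\<Sum>l\<in>{1..q}. \<Sum>i\<in>{1..n}. weight_at l ?a i * Z (Noise i) \<omega>))"
    unfolding forest_est_def using tree by (simp add: sum.distrib)
  ultimately show ?case
    using size_pos by (simp add: forest_bias_def field_simps)
qed

text \<open>Decomposition into squared bias and variance, by averaging over the noise for fixed values of all
  other sources.\<close>
lemma risk_eq:
  "(\<integral>\<^sup>+\<omega>. ennreal ((forest_error \<omega>)\<^sup>2) \<partial>M)
    = (\<integral>\<^sup>+\<omega>. ennreal ((forest_bias (the_sources \<omega>))\<^sup>2 + \<sigma>\<^sup>2 * (\<Sum>i\<in>{1..n}. (forest_weight (the_sources \<omega>) i)\<^sup>2)) \<partial>M)"
proof -
  let ?B = "Noise ` {1..n}" and ?R = "\<lambda>D \<omega>. restrict (\<lambda>i. Z i \<omega>) D"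
  define f where "f = (\<lambda>(a, b :: source \<Rightarrow> real).
    ennreal ((forest_bias a + (\<Sum>i\<in>{1..n}. forest_weight a i * b (Noise i)))\<^sup>2))"
  have f_meas: "f \<in> borel_measurable (PiM observed (\<lambda>_. borel) \<Otimes>\<^sub>M PiM ?B (\<lambda>_. borel))"
  proof -
    have proj: "(\<lambda>z. fst z v) \<in> borel_measurable (PiM observed (\<lambda>_. borel) \<Otimes>\<^sub>M PiM ?B (\<lambda>_. borel))"
      if "v \<in> observed" for v
      using that by measurable
    note [measurable] = forest_bias_measurable[OF proj] forest_weight_measurable[OF proj]
    have [measurable]: "(\<lambda>z. snd z (Noise i)) \<in> borel_measurable (PiM observed (\<lambda>_. borel) \<Otimes>\<^sub>M PiM ?B (\<lambda>_. borel))"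
      if "i \<in> {1..n}" for i
    proof -
      have [measurable]: "Noise i \<in> ?B" using that by simp
      show ?thesis by measurable
    qed
    show ?thesis unfolding f_def case_prod_beta by measurable
  qed
  have bias_R: "forest_bias (?R observed \<omega>) = forest_bias (the_sources \<omega>)" for \<omega>
    by (rule forest_cong) simp
  have weight_R: "forest_weight (?R observed \<omega>) i = forest_weight (the_sources \<omega>) i" if "i \<in> {1..n}" for \<omega> i
    by (rule forest_cong) (use that in simp_all)
  have f_eq: "f (?R observed \<omega>, ?R ?B \<omega>') = ennreal ((forest_bias (the_sources \<omega>) +
      (\<Sum>i\<in>{1..n}. forest_weight (the_sources \<omega>) i * Z (Noise i) \<omega>'))\<^sup>2)" for \<omega> \<omega>'
    unfolding f_def prod.case bias_R using weight_R by (simp cong: sum.cong_simp)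
  have "(\<integral>\<^sup>+\<omega>. ennreal ((forest_error \<omega>)\<^sup>2) \<partial>M)
      = (\<integral>\<^sup>+\<omega>. f (?R observed \<omega>, ?R ?B \<omega>) \<partial>M)"
    unfolding f_eq using AE_forest_error by (intro nn_integral_cong_AE) (auto elim!: eventually_mono)
  also have "\<dots> = (\<integral>\<^sup>+\<omega>. \<integral>\<^sup>+\<omega>'. f (?R observed \<omega>, ?R ?B \<omega>') \<partial>M \<partial>M)"
    by (rule nn_integral_indep_var[OF indep_var_restrict[OF indep] f_meas])
       (auto simp: sources_def observed_def)
  finally show ?thesis
    unfolding f_eq shifted_noise_second_moment .
qed


lemma empty_bound_nonneg: "0 \<le> D * mean_gap (exp_laplace rate) sample_rate"
proof -
  have "0 \<le> D" using density_le[of 0] density_gt_0[of 0] by simp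
  moreover have "0 \<le> exp_laplace rate sample_rate" "0 \<le> edge sample_rate"
    using sample_rate_pos rate_pos scale by (simp_all add: exp_laplace_def edge_def)
  ultimately show ?thesis
    unfolding mean_gap_def by (intro mult_nonneg_nonneg add_nonneg_nonneg) auto
qed

text \<open>The square is convex, so the mean over the trees is bounded by the bias of a single tree.\<close>
lemma mean_forest_bias_square_le:
  "(\<integral>\<^sup>+\<omega>. ennreal ((forest_bias (the_sources \<omega>))\<^sup>2) \<partial>M)
    \<le> ennreal (4 * C\<^sup>2 / ((real k + 1) * (real k + 2)) + S\<^sup>2 * (D * mean_gap (exp_laplace rate) sample_rate))"
    (is "_ \<le> ennreal ?b")
proof -
  have merged: "merged_cell {l} (the_cuts \<omega>) (Z New_Point \<omega>) = cell_at l (the_sources \<omega>)" for l \<omega>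
    by (simp add: merged_cell_def cell_at_def)
  have tree_meas: "(\<lambda>\<omega>. tree_bias l (the_sources \<omega>)) \<in> borel_measurable M" if "l \<in> {1..q}" for l
  proof -
    have src: "Z v \<in> borel_measurable M" if "v \<in> observed" for v
      using that source_measurable by (auto simp: observed_def)
    note [measurable] = weight_at_measurable[of "\<lambda>\<omega>. the_sources \<omega>", OF src that]
    show ?thesis unfolding tree_bias_def by measurable
  qed
  note gap0 = empty_bound_nonneg
  have tree: "(\<integral>\<^sup>+\<omega>. ennreal ((tree_bias l (the_sources \<omega>))\<^sup>2) \<partial>M) \<le> ennreal ?b" if l: "l \<in> {1..q}" for l
  proof -
    have reach_meas: "(\<lambda>\<omega>. sq_reach k (the_cuts \<omega> l) (Z New_Point \<omega>)) \<in> borel_measurable M"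
      using cut_measurable l by (intro sq_reach_measurable) auto
    have empty_meas: "(\<lambda>\<omega>. ennreal (0 ^ cell_count {l} \<omega>)) \<in> borel_measurable M"
    proof -
      have [measurable]: "Measurable.pred M (\<lambda>\<omega>. Z (Design i) \<omega> \<in> merged_cell {l} (the_cuts \<omega>) (Z New_Point \<omega>))"
        if "i \<in> {1..n}" for i
        using pred_design_in_cell[of "{l}" i] l that by simp
      have "(\<lambda>\<omega>. ennreal ((1 - v) ^ cell_count {l} \<omega>)) \<in> borel_measurable M" for v :: real
        unfolding power_count_eq_prod indicator_def by measurable
      from this[of 1] show ?thesis by (simp only: diff_self)
    qed
    have "(\<integral>\<^sup>+\<omega>. ennreal ((tree_bias l (the_sources \<omega>))\<^sup>2) \<partial>M) \<le>
        (\<integral>\<^sup>+\<omega>. ennreal (C\<^sup>2) * sq_reach k (the_cuts \<omega> l) (Z New_Point \<omega>)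
          + ennreal (S\<^sup>2) * ennreal (0 ^ cell_count {l} \<omega>) \<partial>M)"
      using AE_point_unit
    proof (intro nn_integral_mono_AE, eventually_elim)
      case (elim \<omega>)
      show ?case
        unfolding tree_bias_def weight_at_def merged
        using s_lipschitz C_nonneg s_bounded elim
        by (intro weighted_deviation_le square_dist_le_sq_reach) (auto simp: cell_at_def)
    qed
    also have "\<dots> = ennreal (C\<^sup>2) * (\<integral>\<^sup>+\<omega>. sq_reach k (the_cuts \<omega> l) (Z New_Point \<omega>) \<partial>M)
          + ennreal (S\<^sup>2) * (\<integral>\<^sup>+\<omega>. ennreal (0 ^ cell_count {l} \<omega>) \<partial>M)"
      unfolding nn_integral_cmult[OF reach_meas, symmetric] nn_integral_cmult[OF empty_meas, symmetric]
      by (intro nn_integral_add borel_measurable_times_ennreal borel_measurable_const reach_meas empty_meas)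
    also have "\<dots> \<le> ennreal (C\<^sup>2) * ennreal (4 / ((real k + 1) * (real k + 2)))
          + ennreal (S\<^sup>2) * ennreal (D * mean_gap (exp_laplace rate) sample_rate)"
      using l density_le by (intro add_mono mult_left_mono mean_sq_reach_le prob_empty_cell_le) auto
    also have "\<dots> = ennreal ?b"
      using gap0 by (simp add: ennreal_mult'[symmetric] ennreal_plus[symmetric] mult.commute del: ennreal_plus)
    finally show ?thesis .
  qed
  have "(\<integral>\<^sup>+\<omega>. ennreal ((forest_bias (the_sources \<omega>))\<^sup>2) \<partial>M) \<le>
      (\<integral>\<^sup>+\<omega>. ennreal (1 / real q) * (\<Sum>l\<in>{1..q}. ennreal ((tree_bias l (the_sources \<omega>))\<^sup>2)) \<partial>M)"
    using square_mean_le_mean_square[OF size_pos(3)]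
    by (intro nn_integral_mono) (simp add: forest_bias_def ennreal_mult'[symmetric] ennreal_leI del: times_divide_eq_left)
  also have "\<dots> = ennreal (1 / real q) * (\<Sum>l\<in>{1..q}. \<integral>\<^sup>+\<omega>. ennreal ((tree_bias l (the_sources \<omega>))\<^sup>2) \<partial>M)"
  proof -
    note [measurable] = tree_meas
    have "(\<integral>\<^sup>+\<omega>. (\<Sum>l\<in>{1..q}. ennreal ((tree_bias l (the_sources \<omega>))\<^sup>2)) \<partial>M)
        = (\<Sum>l\<in>{1..q}. \<integral>\<^sup>+\<omega>. ennreal ((tree_bias l (the_sources \<omega>))\<^sup>2) \<partial>M)"
      by (rule nn_integral_sum) measurable
    moreover have "(\<integral>\<^sup>+\<omega>. ennreal (1 / real q) * (\<Sum>l\<in>{1..q}. ennreal ((tree_bias l (the_sources \<omega>))\<^sup>2)) \<partial>M)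
        = ennreal (1 / real q) * (\<integral>\<^sup>+\<omega>. (\<Sum>l\<in>{1..q}. ennreal ((tree_bias l (the_sources \<omega>))\<^sup>2)) \<partial>M)"
      by (rule nn_integral_cmult) measurable
    ultimately show ?thesis by (simp only:)
  qed
  also have "\<dots> \<le> ennreal (1 / real q) * (\<Sum>l\<in>{1..q}. ennreal ?b)"
    by (intro mult_left_mono sum_mono tree) auto
  also have "\<dots> = ennreal ?b"
  proof -
    have "ennreal (1 / real q) * (\<Sum>l\<in>{1..q}. ennreal B) = ennreal B" for B
    proof -
      have "(\<Sum>l\<in>{1..q}. ennreal B) = ennreal (real q * B)"
        by (simp add: ennreal_of_nat_eq_real_of_nat ennreal_mult')
      moreover have "ennreal (1 / real q) * ennreal (real q * B) = ennreal (1 / real q * (real q * B))"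
        by (rule ennreal_mult'[symmetric]) simp
      moreover have "1 / real q * (real q * B) = B" using size_pos by simp
      ultimately show ?thesis by (simp only:)
    qed
    then show ?thesis .
  qed
  finally show ?thesis .
qed

definition diagonal_bound :: real where
  "diagonal_bound = 40 / (9 * real n) * (rate + edge_total)"

definition pair_bound :: real where
  "pair_bound = 10 / (9 * real n) * (9 / 16 * rate + 3 / sample_rate * (9 / 8 * rate\<^sup>2) + 4 * edge_total)"

lemma bounds_nonneg: "0 \<le> diagonal_bound" "0 \<le> pair_bound"
  using rate_pos scale sample_rate_pos
  by (auto simp: diagonal_bound_def pair_bound_def edge_total_def)

text \<open>Among the \<open>q\<^sup>2\<close> pairs of trees only \<open>q\<close> are diagonal; their larger bound is divided by \<open>q\<close>.\<close>
lemma mean_forest_weight_square_le: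
  "(\<integral>\<^sup>+\<omega>. ennreal (\<Sum>i\<in>{1..n}. (forest_weight (the_sources \<omega>) i)\<^sup>2) \<partial>M)
    \<le> ennreal (diagonal_bound / real q + pair_bound)"
proof -
  let ?total = "\<Sum>l\<in>{1..q}. \<Sum>l'\<in>{1..q}. if l = l' then diagonal_bound else pair_bound"
  define r where "r l l' \<omega> = 1 / real (cell_count {l, l'} \<omega>)" for l l' \<omega>
  have r_meas [measurable]: "r l l' \<in> borel_measurable M" if "l \<in> {1..q}" "l' \<in> {1..q}" for l l'
  proof -
    have [measurable]: "Measurable.pred M (\<lambda>\<omega>. Z (Design i) \<omega> \<in> merged_cell {l, l'} (the_cuts \<omega>) (Z New_Point \<omega>))"
      if "i \<in> {1..n}" for i
      using pred_design_in_cell[of "{l, l'}" i] \<open>l \<in> {1..q}\<close> \<open>l' \<in> {1..q}\<close> that by simp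
    show ?thesis unfolding r_def[abs_def] real_count_in indicator_def by measurable
  qed
  have pointwise: "(\<Sum>i\<in>{1..n}. (forest_weight (the_sources \<omega>) i)\<^sup>2)
      \<le> 1 / (real q)\<^sup>2 * (\<Sum>l\<in>{1..q}. \<Sum>l'\<in>{1..q}. r l l' \<omega>)" for \<omega>
  proof -
    let ?w = "\<lambda>l i. weight_at l (the_sources \<omega>) i"
    have "(\<Sum>i\<in>{1..n}. (forest_weight (the_sources \<omega>) i)\<^sup>2)
        = 1 / (real q)\<^sup>2 * (\<Sum>i\<in>{1..n}. \<Sum>l\<in>{1..q}. \<Sum>l'\<in>{1..q}. ?w l i * ?w l' i)"
      unfolding forest_weight_def power_mult_distrib power2_eq_square[of "sum _ _"] sum_product
      by (simp add: sum_distrib_left power_divide)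
    also have "(\<Sum>i\<in>{1..n}. \<Sum>l\<in>{1..q}. \<Sum>l'\<in>{1..q}. ?w l i * ?w l' i)
        = (\<Sum>l\<in>{1..q}. \<Sum>l'\<in>{1..q}. \<Sum>i\<in>{1..n}. ?w l i * ?w l' i)"
      by (subst sum.swap, intro sum.cong refl sum.swap)
    also have "1 / (real q)\<^sup>2 * \<dots> \<le> 1 / (real q)\<^sup>2 * (\<Sum>l\<in>{1..q}. \<Sum>l'\<in>{1..q}. r l l' \<omega>)"
    proof (intro mult_left_mono sum_mono)
      fix l l'
      show "(\<Sum>i\<in>{1..n}. ?w l i * ?w l' i) \<le> r l l' \<omega>"
        using sum_weight_mult_le[of n "the_design \<omega>" "cell_at l (the_sources \<omega>)" "cell_at l' (the_sources \<omega>)"]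
        by (simp add: weight_at_def r_def merged_cell_def cell_at_def)
    qed simp
    finally show ?thesis .
  qed
  have pair: "(\<integral>\<^sup>+\<omega>. ennreal (r l l' \<omega>) \<partial>M) \<le> ennreal (if l = l' then diagonal_bound else pair_bound)"
    if "l \<in> {1..q}" "l' \<in> {1..q}" for l l'
    using mean_inverse_count_single_le[of l] mean_inverse_count_pair_le[of l l'] that
    by (auto simp: r_def diagonal_bound_def pair_bound_def)
  have r0: "0 \<le> r l l' \<omega>" for l l' \<omega> by (simp add: r_def)
  have "(\<integral>\<^sup>+\<omega>. ennreal (\<Sum>i\<in>{1..n}. (forest_weight (the_sources \<omega>) i)\<^sup>2) \<partial>M) \<le>
      (\<integral>\<^sup>+\<omega>. ennreal (1 / (real q)\<^sup>2) * (\<Sum>l\<in>{1..q}. \<Sum>l'\<in>{1..q}. ennreal (r l l' \<omega>)) \<partial>M)"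
    using pointwise r0
    by (intro nn_integral_mono) (simp add: ennreal_mult'[symmetric] ennreal_leI sum_nonneg del: times_divide_eq_left)
  also have "\<dots> = ennreal (1 / (real q)\<^sup>2) * (\<Sum>l\<in>{1..q}. \<Sum>l'\<in>{1..q}. \<integral>\<^sup>+\<omega>. ennreal (r l l' \<omega>) \<partial>M)"
  proof -
    have "(\<integral>\<^sup>+\<omega>. (\<Sum>l\<in>{1..q}. \<Sum>l'\<in>{1..q}. ennreal (r l l' \<omega>)) \<partial>M)
        = (\<Sum>l\<in>{1..q}. \<integral>\<^sup>+\<omega>. (\<Sum>l'\<in>{1..q}. ennreal (r l l' \<omega>)) \<partial>M)"
      by (rule nn_integral_sum) measurable
    also have "\<dots> = (\<Sum>l\<in>{1..q}. \<Sum>l'\<in>{1..q}. \<integral>\<^sup>+\<omega>. ennreal (r l l' \<omega>) \<partial>M)"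
      by (intro sum.cong refl nn_integral_sum) measurable
    finally show ?thesis by (subst nn_integral_cmult) (simp, measurable)
  qed
  also have "\<dots> \<le> ennreal (1 / (real q)\<^sup>2) * (\<Sum>l\<in>{1..q}. \<Sum>l'\<in>{1..q}. ennreal (if l = l' then diagonal_bound else pair_bound))"
    by (intro mult_left_mono sum_mono pair) auto
  also have "\<dots> = ennreal (1 / (real q)\<^sup>2 * ?total)"
  proof -
    have "(\<Sum>l\<in>{1..q}. \<Sum>l'\<in>{1..q}. ennreal (if l = l' then diagonal_bound else pair_bound))
        = ennreal ?total"
      using bounds_nonneg by (simp add: sum_ennreal sum_nonneg)
    then show ?thesis by (simp only:) (intro ennreal_mult'[symmetric], simp)
  qed
  also have "\<dots> \<le> ennreal (diagonal_bound / real q + pair_bound)"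
  proof (intro ennreal_leI)
    have "?total
        \<le> (\<Sum>l\<in>{1..q}. \<Sum>l'\<in>{1..q}. (if l = l' then diagonal_bound else 0) + pair_bound)"
      using bounds_nonneg by (intro sum_mono) auto
    also have "\<dots> = real q * diagonal_bound + (real q)\<^sup>2 * pair_bound"
      by (simp add: sum.distrib power2_eq_square algebra_simps)
    finally have "1 / (real q)\<^sup>2 * ?total
        \<le> 1 / (real q)\<^sup>2 * (real q * diagonal_bound + (real q)\<^sup>2 * pair_bound)"
      by (rule mult_left_mono) simp
    also have "\<dots> = diagonal_bound / real q + pair_bound"
      using size_pos by (simp add: divide_simps power2_eq_square algebra_simps)
    finally show "1 / (real q)\<^sup>2 * ?total
        \<le> diagonal_bound / real q + pair_bound" .
  qed
  finally show ?thesis .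
qed

lemma risk_le:
  "expectation (\<lambda>\<omega>. (forest_error \<omega>)\<^sup>2)
    \<le> 4 * C\<^sup>2 / ((real k + 1) * (real k + 2)) + S\<^sup>2 * (D * mean_gap (exp_laplace rate) sample_rate)
      + \<sigma>\<^sup>2 * (diagonal_bound / real q + pair_bound)"
    (is "_ \<le> ?b + \<sigma>\<^sup>2 * ?v")
proof (rule integral_real_bounded)
  have src: "Z v \<in> borel_measurable M" if "v \<in> observed" for v
    using that source_measurable by (auto simp: observed_def)
  note [measurable] = forest_bias_measurable[of "\<lambda>\<omega>. the_sources \<omega>", OF src]
    forest_weight_measurable[of "\<lambda>\<omega>. the_sources \<omega>", OF src]
  have b0: "0 \<le> ?b"
    by (intro add_nonneg_nonneg mult_nonneg_nonneg empty_bound_nonneg divide_nonneg_nonneg) auto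
  have v0: "0 \<le> ?v" using bounds_nonneg by simp
  show "0 \<le> ?b + \<sigma>\<^sup>2 * ?v" by (intro add_nonneg_nonneg mult_nonneg_nonneg b0 v0) simp
  have "(\<integral>\<^sup>+\<omega>. ennreal ((forest_error \<omega>)\<^sup>2) \<partial>M)
    = (\<integral>\<^sup>+\<omega>. ennreal ((forest_bias (the_sources \<omega>))\<^sup>2)
      + ennreal (\<sigma>\<^sup>2) * ennreal (\<Sum>i\<in>{1..n}. (forest_weight (the_sources \<omega>) i)\<^sup>2) \<partial>M)"
    unfolding risk_eq by (intro nn_integral_cong) (simp add: ennreal_mult' sum_nonneg)
  also have "\<dots> = (\<integral>\<^sup>+\<omega>. ennreal ((forest_bias (the_sources \<omega>))\<^sup>2) \<partial>M)
      + ennreal (\<sigma>\<^sup>2) * (\<integral>\<^sup>+\<omega>. ennreal (\<Sum>i\<in>{1..n}. (forest_weight (the_sources \<omega>) i)\<^sup>2) \<partial>M)"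
    by (simp add: nn_integral_add nn_integral_cmult)
  also have "\<dots> \<le> ennreal ?b + ennreal (\<sigma>\<^sup>2) * ennreal ?v"
    by (intro add_mono mult_left_mono mean_forest_bias_square_le mean_forest_weight_square_le) auto
  also have "\<dots> = ennreal (?b + \<sigma>\<^sup>2 * ?v)"
    using b0 v0 by (simp add: ennreal_mult'[symmetric] ennreal_plus[symmetric] del: ennreal_plus)
  finally show "(\<integral>\<^sup>+\<omega>. ennreal ((forest_error \<omega>)\<^sup>2) \<partial>M)
    \<le> ennreal (?b + \<sigma>\<^sup>2 * ?v)" .
qed


section \<open>Order of the error terms\<close>

text \<open>All terms of smaller order are at most \<open>remainder_const * (k / n) * small_factor\<close>, where the
  constant depends neither on \<open>n\<close> nor on \<open>k\<close> and \<open>q\<close>.\<close>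
definition remainder_const :: real where
  "remainder_const =
    S\<^sup>2 * (D * (4 / (9 / 10 * m)\<^sup>2 + 4 / ((9 / 10 * m)\<^sup>2 * \<delta>) + 2 / ((9 / 10 * m)\<^sup>2 * \<delta>\<^sup>2)))
    + \<sigma>\<^sup>2 * (40 / 9 * (4 + 5 / \<delta>) + 15 / (9 / 10 * m) + 40 / 9 * (2 + 5 / \<delta>))"

definition small_factor :: real where
  "small_factor = real k / real n + 1 / real n + 1 / real q + 1 / sqrt (real k)"

text \<open>A probability density on an interval of length 1 cannot stay below 1.\<close>
lemma density_upper_ge_1: "1 \<le> D"
proof -
  have "1 = emeasure M (Z New_Point -` UNIV \<inter> space M)"
    by (simp add: emeasure_space_1)
  also have "\<dots> = (\<integral>\<^sup>+x. ennreal (\<mu> x * indicator {0..1} x) * indicator UNIV x \<partial>lborel)"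
    by (rule distributed_emeasure[OF point_density]) simp
  also have "\<dots> \<le> (\<integral>\<^sup>+x. ennreal D * indicator {0..1::real} x \<partial>lborel)"
    using density_le by (intro nn_integral_mono) (auto simp: indicator_def intro!: ennreal_leI)
  also have "\<dots> = ennreal D" by (simp add: nn_integral_cmult_indicator)
  finally show ?thesis by simp
qed

lemma rate_le: "rate \<le> 10 / 9 * real k" "rate \<le> 2 * real k"
proof -
  have "real k / (1 - \<delta>) \<le> real k / (9 / 10)"
    using scale by (intro divide_left_mono) auto
  then show "rate \<le> 10 / 9 * real k" by (simp add: rate_def)
  then show "rate \<le> 2 * real k" using of_nat_0_le_iff[of k] by linarith
qed

lemma edge_total_le: "edge_total \<le> sqrt (real k) * (2 + 5 / \<delta>)"
proof -
  have k1: "1 \<le> sqrt (real k)" using size_pos by simp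
  have "sqrt rate \<le> sqrt (4 * real k)" using rate_le rate_pos by (intro real_sqrt_le_mono) simp
  also have "\<dots> = 2 * sqrt (real k)" by (simp add: real_sqrt_mult)
  finally have "2 * (sqrt rate / \<delta>) \<le> 4 * (sqrt (real k) / \<delta>)"
    using scale by (simp add: divide_right_mono)
  moreover have "1 / \<delta> \<le> sqrt (real k) / \<delta>" using k1 scale by (simp add: divide_right_mono)
  moreover have "edge_total = 2 + 2 * (sqrt rate / \<delta>) + 1 / \<delta>"
    by (simp add: edge_total_def)
  moreover have "sqrt (real k) * (2 + 5 / \<delta>) = 2 * sqrt (real k) + 4 * (sqrt (real k) / \<delta>) + sqrt (real k) / \<delta>"
    using scale by (simp add: field_simps)
  ultimately show ?thesis using k1 by linarith
qed

lemma small_factor_parts: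
  defines "b \<equiv> real k / real n"
  shows "b * (real k / real n) \<le> b * small_factor" "b * (1 / real n) \<le> b * small_factor"
    "b * (1 / real q) \<le> b * small_factor" "b * (1 / sqrt (real k)) \<le> b * small_factor"
  unfolding b_def small_factor_def by (intro mult_left_mono; simp)+

text \<open>The three terms of the mean gap are of order \<open>(k / n)\<^sup>2\<close>, \<open>k / n\<^sup>2\<close> and, by
  \<open>exp (- y) \<le> 2 / y\<^sup>2\<close>, \<open>1 / n\<^sup>2\<close>.\<close>
lemma empty_remainder_le:
  "mean_gap (exp_laplace rate) sample_rate
    \<le> (4 / (9 / 10 * m)\<^sup>2 + 4 / ((9 / 10 * m)\<^sup>2 * \<delta>) + 2 / ((9 / 10 * m)\<^sup>2 * \<delta>\<^sup>2)) * (real k / real n * small_factor)"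
proof -
  define a where "a = 9 / 10 * m"
  let ?b = "real k / real n"
  have a: "0 < a" using density_pos by (simp add: a_def)
  have n: "0 < real n" and k: "1 \<le> real k" using size_pos by auto
  have t: "sample_rate = a * real n" by (simp add: sample_rate_def a_def)
  have h0: "0 \<le> exp_laplace rate sample_rate"
    using rate_pos sample_rate_pos by (simp add: exp_laplace_def)
  have h: "exp_laplace rate sample_rate \<le> 2 * ?b / a"
  proof -
    have "exp_laplace rate sample_rate \<le> rate / sample_rate"
      unfolding exp_laplace_def using rate_pos sample_rate_pos by (intro divide_left_mono) auto
    also have "\<dots> \<le> 2 * real k / sample_rate"
      using rate_le sample_rate_pos by (intro divide_right_mono) auto
    finally show ?thesis by (simp add: t mult.commute)
  qed
  have "(exp_laplace rate sample_rate)\<^sup>2 \<le> (2 * ?b / a)\<^sup>2" using h h0 by (rule power_mono)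
  also have "\<dots> = 4 / a\<^sup>2 * (?b * (real k / real n))" by (simp add: power2_eq_square)
  also have "\<dots> \<le> 4 / a\<^sup>2 * (?b * small_factor)"
    by (rule mult_left_mono[OF small_factor_parts(1)]) simp
  finally have 1: "(exp_laplace rate sample_rate)\<^sup>2 \<le> 4 / a\<^sup>2 * (?b * small_factor)" .
  \<comment> \<open>Here \<open>edge\<close> contributes a second factor \<open>1 / n\<close>.\<close>
  have "exp_laplace rate sample_rate * edge sample_rate \<le> (2 * ?b / a) * (1 / (sample_rate * \<delta>))"
    using h h0 scale sample_rate_pos by (intro mult_mono) (auto simp: edge_def)
  then have "2 * (exp_laplace rate sample_rate * edge sample_rate) \<le> 2 * ((2 * ?b / a) * (1 / (sample_rate * \<delta>)))"
    by (rule mult_left_mono) simp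
  also have "\<dots> = 4 / (a\<^sup>2 * \<delta>) * (?b * (1 / real n))"
    by (simp add: t power2_eq_square mult_ac)
  also have "\<dots> \<le> 4 / (a\<^sup>2 * \<delta>) * (?b * small_factor)"
    using scale by (intro mult_left_mono[OF small_factor_parts(2)]) simp
  finally have 2: "2 * (exp_laplace rate sample_rate * edge sample_rate) \<le> 4 / (a\<^sup>2 * \<delta>) * (?b * small_factor)" .
  have "exp (- sample_rate * \<delta>) \<le> 2 / (sample_rate * \<delta>)\<^sup>2"
  proof -
    have "exp (- y) \<le> 2 / y\<^sup>2" if "0 < y" for y :: real
    proof -
      have "y\<^sup>2 / 2 \<le> exp y" using exp_lower_Taylor_quadratic[of y] that by simp
      then show ?thesis using that by (simp add: exp_minus field_simps)
    qed
    from this[of "sample_rate * \<delta>"] show ?thesis using sample_rate_pos scale by simp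
  qed
  also have "\<dots> = 2 / (a\<^sup>2 * \<delta>\<^sup>2) * (1 / real n * (1 / real n))"
    by (simp add: t power2_eq_square mult_ac)
  also have "\<dots> \<le> 2 / (a\<^sup>2 * \<delta>\<^sup>2) * (?b * (1 / real n))"
    using k n by (intro mult_left_mono mult_right_mono) (auto simp: divide_right_mono)
  also have "\<dots> \<le> 2 / (a\<^sup>2 * \<delta>\<^sup>2) * (?b * small_factor)"
    using scale by (intro mult_left_mono[OF small_factor_parts(2)]) simp
  finally have 3: "exp (- sample_rate * \<delta>) \<le> 2 / (a\<^sup>2 * \<delta>\<^sup>2) * (?b * small_factor)" .
  show ?thesis
    unfolding mean_gap_def a_def[symmetric] distrib_right by (rule add_mono[OF add_mono[OF 1 2] 3])
qed

lemma diagonal_remainder_le: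
  "diagonal_bound / real q \<le> 40 / 9 * (4 + 5 / \<delta>) * (real k / real n * small_factor)"
proof -
  have "sqrt (real k) * 1 \<le> sqrt (real k) * sqrt (real k)" using size_pos by (intro mult_left_mono) auto
  then have "sqrt (real k) * (2 + 5 / \<delta>) \<le> real k * (2 + 5 / \<delta>)"
    using scale by (intro mult_right_mono) auto
  then have "rate + edge_total \<le> real k * (4 + 5 / \<delta>)"
    using rate_le(2) edge_total_le by (simp add: algebra_simps)
  then have "40 / (9 * real n) * (rate + edge_total) / real q \<le> 40 / (9 * real n) * (real k * (4 + 5 / \<delta>)) / real q"
    by (intro divide_right_mono mult_left_mono) auto
  also have "\<dots> = 40 / 9 * (4 + 5 / \<delta>) * (real k / real n * (1 / real q))"
    using scale by (simp add: field_simps)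
  also have "\<dots> \<le> 40 / 9 * (4 + 5 / \<delta>) * (real k / real n * small_factor)"
    using scale by (intro mult_left_mono[OF small_factor_parts(3)]) simp
  finally show ?thesis by (simp only: diagonal_bound_def)
qed

text \<open>Main term of the variance, with constant \<open>10 / 9 * 9 / 16 * 10 / 9 = 25 / 36 < 3 / 4\<close>. The first
  factor comes from the variation of the density, the last one from \<open>rate \<le> 10 / 9 k\<close>.\<close>
lemma pair_remainder_le:
  "pair_bound \<le> 3 / 4 * (real (k + 1) / real n)
    + (15 / (9 / 10 * m) + 40 / 9 * (2 + 5 / \<delta>)) * (real k / real n * small_factor)"
proof -
  define a where "a = 9 / 10 * m"
  have a: "0 < a" using density_pos by (simp add: a_def)
  have n: "0 < real n" using size_pos by auto
  have t: "sample_rate = a * real n" by (simp add: sample_rate_def a_def)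
  have 1: "10 / (9 * real n) * (9 / 16 * rate) \<le> 3 / 4 * (real (k + 1) / real n)"
  proof -
    have "10 / (9 * real n) * (9 / 16 * rate) \<le> 10 / (9 * real n) * (9 / 16 * (10 / 9 * real k))"
      using rate_le by (intro mult_left_mono) auto
    also have "\<dots> \<le> 3 / 4 * (real (k + 1) / real n)" using n by (simp add: field_simps)
    finally show ?thesis .
  qed
  have "rate\<^sup>2 \<le> (2 * real k)\<^sup>2" using rate_le rate_pos by (intro power_mono) auto
  then have "10 / (9 * real n) * (3 / sample_rate * (9 / 8 * rate\<^sup>2)) \<le> 10 / (9 * real n) * (3 / sample_rate * (9 / 8 * (2 * real k)\<^sup>2))"
    using sample_rate_pos by (intro mult_left_mono) auto
  also have "\<dots> = 15 / a * (real k / real n * (real k / real n))"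
    using n a by (simp add: t power2_eq_square field_simps)
  also have "\<dots> \<le> 15 / a * (real k / real n * small_factor)"
    using a by (intro mult_left_mono[OF small_factor_parts(1)]) simp
  finally have 2: "10 / (9 * real n) * (3 / sample_rate * (9 / 8 * rate\<^sup>2)) \<le> 15 / a * (real k / real n * small_factor)" .
  have "10 / (9 * real n) * (4 * edge_total) \<le> 10 / (9 * real n) * (4 * (sqrt (real k) * (2 + 5 / \<delta>)))"
    using edge_total_le by (intro mult_left_mono) auto
  also have "\<dots> = 40 / 9 * (2 + 5 / \<delta>) * (real k / real n * (1 / sqrt (real k)))"
  proof -
    have "real k / real n * (1 / sqrt (real k)) = (real k / sqrt (real k)) / real n" by simp
    also have "\<dots> = sqrt (real k) / real n" by (simp add: real_div_sqrt)
    finally show ?thesis using scale by (simp add: field_simps)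
  qed
  also have "\<dots> \<le> 40 / 9 * (2 + 5 / \<delta>) * (real k / real n * small_factor)"
    using scale by (intro mult_left_mono[OF small_factor_parts(4)]) simp
  finally have 3: "10 / (9 * real n) * (4 * edge_total) \<le> 40 / 9 * (2 + 5 / \<delta>) * (real k / real n * small_factor)" .
  show ?thesis
    using add_mono[OF add_mono[OF 1 2] 3]
    by (simp only: pair_bound_def a_def distrib_left distrib_right add.assoc)
qed

lemma risk_asymptotic_bound:
  "expectation (\<lambda>\<omega>. (forest_error \<omega>)\<^sup>2)
    \<le> 3 / 4 * (\<sigma>\<^sup>2 * real (k + 1) / real n) + 6 * D * C\<^sup>2 / (real (k + 1))\<^sup>2
      + remainder_const * (real k / real n * small_factor)"
proof -
  define A where "A = 4 / (9 / 10 * m)\<^sup>2 + 4 / ((9 / 10 * m)\<^sup>2 * \<delta>) + 2 / ((9 / 10 * m)\<^sup>2 * \<delta>\<^sup>2)"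
  define r where "r = real k / real n * small_factor"
  have bias: "4 * C\<^sup>2 / ((real k + 1) * (real k + 2)) \<le> 6 * D * C\<^sup>2 / (real (k + 1))\<^sup>2"
  proof -
    have "4 * C\<^sup>2 / ((real k + 1) * (real k + 2)) \<le> 4 * C\<^sup>2 / ((real k + 1) * (real k + 1))"
      by (intro divide_left_mono mult_left_mono) auto
    also have "\<dots> \<le> 6 * D * C\<^sup>2 / ((real k + 1) * (real k + 1))"
      using density_upper_ge_1 by (intro divide_right_mono mult_right_mono) auto
    finally show ?thesis by (simp add: power2_eq_square add.commute)
  qed
  have empty: "S\<^sup>2 * (D * mean_gap (exp_laplace rate) sample_rate) \<le> S\<^sup>2 * (D * (A * r))"
    using empty_remainder_le density_upper_ge_1 unfolding A_def r_def by (intro mult_left_mono) auto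
  have noise: "\<sigma>\<^sup>2 * (diagonal_bound / real q + pair_bound) \<le>
      \<sigma>\<^sup>2 * (40 / 9 * (4 + 5 / \<delta>) * r + (3 / 4 * (real (k + 1) / real n) + (15 / (9 / 10 * m) + 40 / 9 * (2 + 5 / \<delta>)) * r))"
    unfolding r_def by (intro mult_left_mono add_mono diagonal_remainder_le pair_remainder_le) simp
  have "4 * C\<^sup>2 / ((real k + 1) * (real k + 2)) + S\<^sup>2 * (D * mean_gap (exp_laplace rate) sample_rate)
      + \<sigma>\<^sup>2 * (diagonal_bound / real q + pair_bound)
    \<le> 6 * D * C\<^sup>2 / (real (k + 1))\<^sup>2 + S\<^sup>2 * (D * (A * r))
      + \<sigma>\<^sup>2 * (40 / 9 * (4 + 5 / \<delta>) * r + (3 / 4 * (real (k + 1) / real n) + (15 / (9 / 10 * m) + 40 / 9 * (2 + 5 / \<delta>)) * r))"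
    by (rule add_mono[OF add_mono[OF bias empty] noise])
  also have "\<dots> = 3 / 4 * (\<sigma>\<^sup>2 * real (k + 1) / real n) + 6 * D * C\<^sup>2 / (real (k + 1))\<^sup>2 + remainder_const * r"
    unfolding remainder_const_def A_def[symmetric] by (simp add: distrib_left distrib_right mult.assoc mult.left_commute)
  finally show ?thesis using risk_le unfolding r_def by linarith
qed

end

section \<open>Risk bound for growing samples\<close>

text \<open>Precomposition with the projection onto the unit interval extends the density and the regression
  function to the line; their values on the unit interval are unchanged.\<close>
definition clamp_unit :: "real \<Rightarrow> real" where
  "clamp_unit x = max 0 (min 1 x)"

lemma clamp_unit_mem: "clamp_unit x \<in> {0..1}"
  by (simp add: clamp_unit_def)

lemma clamp_unit_id: "x \<in> {0..1} \<Longrightarrow> clamp_unit x = x"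
  by (simp add: clamp_unit_def)

lemma clamp_unit_contraction: "\<bar>clamp_unit x - clamp_unit y\<bar> \<le> \<bar>x - y\<bar>"
  by (auto simp: clamp_unit_def max_def min_def)

lemma borel_measurable_clamp_unit:
  assumes "continuous_on {0..1} f"
  shows "(\<lambda>x. f (clamp_unit x)) \<in> borel_measurable borel"
proof -
  have "continuous_on UNIV clamp_unit"
    unfolding clamp_unit_def by (intro continuous_intros)
  then have "continuous_on UNIV (\<lambda>x. f (clamp_unit x))"
    using clamp_unit_mem by (intro continuous_on_compose2[OF assms]) blast+
  then show ?thesis by (rule borel_measurable_continuous_onI)
qed

lemma forest_est_cong:
  assumes "\<And>i. i \<in> {1..n} \<Longrightarrow> y i = y' i"
  shows "forest_est n x y k q u t = forest_est n x y' k q u t"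
  using assms by (simp add: forest_est_def tree_est_def cell_mean_eq_weights)

text \<open>Uniform continuity with tolerance a tenth of the minimum.\<close>
lemma positive_continuous_locally_comparable:
  fixes f :: "real \<Rightarrow> real"
  assumes cont: "continuous_on {0..1} f" and pos: "\<And>x. x \<in> {0..1} \<Longrightarrow> 0 < f x"
  obtains m \<delta> where "0 < m" "\<And>x. x \<in> {0..1} \<Longrightarrow> m \<le> f x" "0 < \<delta>" "\<delta> \<le> 1 / 10"
    "\<And>x y. x \<in> {0..1} \<Longrightarrow> y \<in> {0..1} \<Longrightarrow> \<bar>x - y\<bar> \<le> \<delta> \<Longrightarrow> 9 / 10 * f x \<le> f y"
proof -
  obtain x0 where x0: "x0 \<in> {0..1}" "\<And>x. x \<in> {0..1} \<Longrightarrow> f x0 \<le> f x"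
    using continuous_attains_inf[OF _ _ cont] by auto
  have "uniformly_continuous_on {0..1} f"
    using cont by (intro compact_uniformly_continuous) auto
  moreover have "0 < f x0 / 10" using pos[OF x0(1)] by simp
  ultimately obtain d where d: "0 < d"
    "\<And>x y. x \<in> {0..1} \<Longrightarrow> y \<in> {0..1} \<Longrightarrow> dist y x < d \<Longrightarrow> dist (f y) (f x) < f x0 / 10"
    unfolding uniformly_continuous_on_def by blast
  show thesis
  proof
    show "0 < f x0" "0 < min (d / 2) (1 / 10)" "min (d / 2) (1 / 10) \<le> 1 / 10"
      using pos[OF x0(1)] d(1) by auto
    show "f x0 \<le> f x" if "x \<in> {0..1}" for x using x0 that by blast
    show "9 / 10 * f x \<le> f y" if "x \<in> {0..1}" "y \<in> {0..1}" "\<bar>x - y\<bar> \<le> min (d / 2) (1 / 10)" for x y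
    proof -
      have "dist y x < d" using that(3) d(1) by (simp add: dist_real_def abs_minus_commute)
      then have "\<bar>f y - f x\<bar> < f x0 / 10" using d(2)[OF that(1,2)] by (simp add: dist_real_def)
      then show ?thesis using x0(2)[OF that(1)] by linarith
    qed
  qed
qed

text \<open>A bound that holds eventually is extended to all indices: the finitely many others are absorbed
  into the remainder.\<close>
lemma eventual_bound_imp_smallo:
  fixes a b g :: "nat \<Rightarrow> real"
  assumes bound: "eventually (\<lambda>n. a n \<le> b n + r n * g n) sequentially"
    and r: "eventually (\<lambda>n. 0 < r n) sequentially" and g: "g \<longlonglongrightarrow> 0"
  shows "\<exists>f. f \<in> o(r) \<and> (\<forall>n. a n \<le> b n + f n)"
proof -
  define f where "f n = max (a n - b n) (r n * g n)" for n
  have "eventually (\<lambda>n. f n = r n * g n) sequentially"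
    using bound by eventually_elim (simp add: f_def)
  moreover have "(\<lambda>n. r n * g n) \<in> o(r)"
  proof (rule smalloI_tendsto)
    show "eventually (\<lambda>n. r n \<noteq> 0) sequentially" using r by eventually_elim simp
    have "eventually (\<lambda>n. g n = r n * g n / r n) sequentially" using r by eventually_elim simp
    with g show "(\<lambda>n. r n * g n / r n) \<longlonglongrightarrow> 0" by (rule Lim_transform_eventually)
  qed
  ultimately have "f \<in> o(r)" by (subst landau_o.small.in_cong) auto
  moreover have "a n \<le> b n + f n" for n by (simp add: f_def)
  ultimately show ?thesis by blast
qed

theorem theorem3:
  fixes P :: "'w measure"
    and X Y \<epsilon> :: "nat \<Rightarrow> 'w \<Rightarrow> real"
    and X\<^sub>0 :: "'w \<Rightarrow> real"
    and U :: "nat \<Rightarrow> nat \<Rightarrow> nat \<Rightarrow> 'w \<Rightarrow> real"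
    and s \<mu> :: "real \<Rightarrow> real"
    and \<sigma> C M :: real
    and k q :: "nat \<Rightarrow> nat"
  assumes P: "prob_space P"
    and indep: "\<And>n. n \<ge> 1 \<Longrightarrow> prob_space.indep_vars P (\<lambda>_. borel)
      (\<lambda>v. case v of Design i \<Rightarrow> X i | Noise i \<Rightarrow> \<epsilon> i | Cut l j \<Rightarrow> U n l j | New_Point \<Rightarrow> X\<^sub>0)
      (sources n (k n) (q n))"
    and X_range: "\<And>i \<omega>. i \<ge> 1 \<Longrightarrow> \<omega> \<in> space P \<Longrightarrow> X i \<omega> \<in> {0..1}"
    and X_density: "\<And>i. i \<ge> 1 \<Longrightarrow>
      distributed P lborel (X i) (\<lambda>x. ennreal (\<mu> x * indicator {0..1} x))"
    and X\<^sub>0_range: "\<And>\<omega>. \<omega> \<in> space P \<Longrightarrow> X\<^sub>0 \<omega> \<in> {0..1}"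
    and X\<^sub>0_density: "distributed P lborel X\<^sub>0 (\<lambda>x. ennreal (\<mu> x * indicator {0..1} x))"
    and noise_ident: "\<And>i. i \<ge> 1 \<Longrightarrow> distr P borel (\<epsilon> i) = distr P borel (\<epsilon> 1)"
    and noise_sq_integrable: "integrable P (\<lambda>\<omega>. (\<epsilon> 1 \<omega>)\<^sup>2)"
    and noise_mean: "prob_space.expectation P (\<epsilon> 1) = 0"
    and noise_variance: "prob_space.variance P (\<epsilon> 1) = \<sigma>\<^sup>2"
    and Y: "\<And>i \<omega>. i \<ge> 1 \<Longrightarrow> \<omega> \<in> space P \<Longrightarrow> Y i \<omega> = s (X i \<omega>) + \<epsilon> i \<omega>"
    and U_uniform: "\<And>n l j. n \<ge> 1 \<Longrightarrow> l \<in> {1..q n} \<Longrightarrow> j \<in> {1..k n} \<Longrightarrow>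
      distr P lborel (U n l j) = uniform_measure lborel {0..1}"
    and \<mu>_cont: "continuous_on {0..1} \<mu>"
    and \<mu>_bounds: "\<And>x. x \<in> {0..1} \<Longrightarrow> 0 < \<mu> x \<and> \<mu> x \<le> M"
    and s_lipschitz: "C-lipschitz_on {0..1} s"
    and k_lim: "filterlim k at_top sequentially"
    and kn_lim: "(\<lambda>n. real (k n) / real n) \<longlonglongrightarrow> 0"
    and q_lim: "filterlim q at_top sequentially"
  shows "\<exists>f. f \<in> o(\<lambda>n. real (k n) / real n) \<and>
    (\<forall>n\<ge>1. prob_space.expectation P (\<lambda>\<omega>.
        (forest_est n (\<lambda>i. X i \<omega>) (\<lambda>i. Y i \<omega>) (k n) (q n) (\<lambda>l j. U n l j \<omega>) (X\<^sub>0 \<omega>)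
          - s (X\<^sub>0 \<omega>))\<^sup>2)
      \<le> 3 / 4 * (\<sigma>\<^sup>2 * real (k n + 1) / real n) + 6 * M * C\<^sup>2 / (real (k n + 1))\<^sup>2 + f n)"
proof -
  interpret prob_space P by (rule P)
  have C0: "0 \<le> C" using s_lipschitz by (rule lipschitz_on_nonneg)
  obtain m \<delta> where m: "0 < m" "\<And>x. x \<in> {0..1} \<Longrightarrow> m \<le> \<mu> x" and \<delta>: "0 < \<delta>" "\<delta> \<le> 1 / 10"
    and local: "\<And>x y. x \<in> {0..1} \<Longrightarrow> y \<in> {0..1} \<Longrightarrow> \<bar>x - y\<bar> \<le> \<delta> \<Longrightarrow> 9 / 10 * \<mu> x \<le> \<mu> y"
    using positive_continuous_locally_comparable[OF \<mu>_cont] \<mu>_bounds by metis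
  \<comment> \<open>Outside the unit interval nothing is known about \<open>s\<close> and \<open>\<mu>\<close>, not even measurability.\<close>
  define s' where "s' x = s (clamp_unit x)" for x
  define \<mu>' where "\<mu>' x = \<mu> (clamp_unit x)" for x
  define S where "S = \<bar>s 0\<bar> + C"
  have s'_eq: "s' x = s x" if "x \<in> {0..1}" for x using that by (simp add: s'_def clamp_unit_id)
  have density_eq: "(\<lambda>x. ennreal (\<mu>' x * indicator {0..1} x)) = (\<lambda>x. ennreal (\<mu> x * indicator {0..1} x))"
    by (auto simp: \<mu>'_def clamp_unit_id indicator_def)
  have s_lip: "\<bar>s x - s y\<bar> \<le> C * \<bar>x - y\<bar>" if "x \<in> {0..1}" "y \<in> {0..1}" for x y
    using lipschitz_onD[OF s_lipschitz that] by (simp add: dist_real_def)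
  have s'_lip: "\<bar>s' x - s' y\<bar> \<le> C * \<bar>x - y\<bar>" for x y
    unfolding s'_def
    using s_lip[OF clamp_unit_mem clamp_unit_mem, of x y]
      mult_left_mono[OF clamp_unit_contraction[of x y] C0] by linarith
  have s'_bound: "\<bar>s' x\<bar> \<le> S" for x
  proof -
    have "C * \<bar>clamp_unit x - 0\<bar> \<le> C * 1"
      using clamp_unit_mem[of x] C0 by (intro mult_left_mono) auto
    then show ?thesis
      using s_lip[OF clamp_unit_mem, of 0 x] by (simp add: s'_def S_def)
  qed
  define Z where "Z n v = (case v of Design i \<Rightarrow> X i | Noise i \<Rightarrow> \<epsilon> i | Cut l j \<Rightarrow> U n l j | New_Point \<Rightarrow> X\<^sub>0)" for n v
  have noise_meas: "\<epsilon> i \<in> borel_measurable P" if "1 \<le> i" for i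
  proof -
    have "Noise i \<in> sources i (k i) (q i)" using that by (auto simp: sources_def)
    then show ?thesis using indep[OF that] by (auto simp: indep_vars_def)
  qed
  have sq1: "integrable (distr P borel (\<epsilon> 1)) (\<lambda>x. x\<^sup>2)"
    using noise_sq_integrable noise_meas[of 1] by (subst integrable_distr_eq) auto
  have noise: "integrable P (\<lambda>\<omega>. (\<epsilon> i \<omega>)\<^sup>2)" "expectation (\<epsilon> i) = 0" "expectation (\<lambda>\<omega>. (\<epsilon> i \<omega>)\<^sup>2) = \<sigma>\<^sup>2"
    if i: "1 \<le> i" for i
  proof -
    have transfer: "expectation (\<lambda>\<omega>. f (\<epsilon> i \<omega>)) = expectation (\<lambda>\<omega>. f (\<epsilon> 1 \<omega>))"
      if "f \<in> borel_measurable borel" for f :: "real \<Rightarrow> real"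
      using integral_distr[OF noise_meas[OF i] that] integral_distr[OF noise_meas[of 1] that] noise_ident[OF i]
      by simp
    show "integrable P (\<lambda>\<omega>. (\<epsilon> i \<omega>)\<^sup>2)"
      using sq1 noise_meas[OF i] unfolding noise_ident[OF i, symmetric] by (subst (asm) integrable_distr_eq) auto
    show "expectation (\<epsilon> i) = 0" using transfer[of "\<lambda>x. x"] noise_mean by simp
    show "expectation (\<lambda>\<omega>. (\<epsilon> i \<omega>)\<^sup>2) = \<sigma>\<^sup>2"
      using transfer[of "\<lambda>x. x\<^sup>2"] noise_variance noise_mean by simp
  qed
  \<comment> \<open>The asymptotic bound applies as soon as there are a cut and a tree.\<close>
  have model: "forest_regression P (Z n) n (k n) (q n) \<mu>' m \<delta> s' \<sigma> C S M"
    if n: "1 \<le> n" "1 \<le> k n" "1 \<le> q n" for n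
  proof unfold_locales
    show "indep_vars (\<lambda>_. borel) (Z n) (sources n (k n) (q n))"
      using indep[OF n(1)] by (simp add: Z_def[abs_def])
    show "distributed P lborel (Z n (Design i)) (\<lambda>x. ennreal (\<mu>' x * indicator {0..1} x))" if "i \<in> {1..n}" for i
      unfolding density_eq using X_density[of i] that by (simp add: Z_def)
    show "distributed P lborel (Z n New_Point) (\<lambda>x. ennreal (\<mu>' x * indicator {0..1} x))"
      unfolding density_eq using X\<^sub>0_density by (simp add: Z_def)
    show "distr P lborel (Z n (Cut l j)) = uniform_measure lborel {0..1}" if "l \<in> {1..q n}" "j \<in> {1..k n}" for l j
      using U_uniform[OF n(1) that] by (simp add: Z_def)
    show "\<mu>' \<in> borel_measurable borel"
      unfolding \<mu>'_def[abs_def] using \<mu>_cont by (rule borel_measurable_clamp_unit)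
    show "m \<le> \<mu>' x" for x using m(2)[OF clamp_unit_mem] by (simp add: \<mu>'_def)
    show "9 / 10 * \<mu>' x \<le> \<mu>' y" if "\<bar>x - y\<bar> \<le> \<delta>" for x y
      unfolding \<mu>'_def using clamp_unit_contraction[of x y] that by (intro local clamp_unit_mem) linarith
    show "s' \<in> borel_measurable borel"
      unfolding s'_def[abs_def] using lipschitz_on_continuous_on[OF s_lipschitz] by (rule borel_measurable_clamp_unit)
    show "\<mu>' x \<le> M" if "x \<in> {0..1}" for x
      using \<mu>_bounds[OF clamp_unit_mem] by (simp add: \<mu>'_def)
    show "integrable P (\<lambda>\<omega>. (Z n (Noise i) \<omega>)\<^sup>2)" "expectation (Z n (Noise i)) = 0"
      "expectation (\<lambda>\<omega>. (Z n (Noise i) \<omega>)\<^sup>2) = \<sigma>\<^sup>2" if "i \<in> {1..n}" for i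
      using noise[of i] that by (simp_all add: Z_def)
  qed (use n m \<delta> s'_lip s'_bound C0 in auto)
  define risk where "risk n = expectation (\<lambda>\<omega>.
        (forest_est n (\<lambda>i. X i \<omega>) (\<lambda>i. Y i \<omega>) (k n) (q n) (\<lambda>l j. U n l j \<omega>) (X\<^sub>0 \<omega>) - s (X\<^sub>0 \<omega>))\<^sup>2)" for n
  define K where "K = S\<^sup>2 * (M * (4 / (9 / 10 * m)\<^sup>2 + 4 / ((9 / 10 * m)\<^sup>2 * \<delta>) + 2 / ((9 / 10 * m)\<^sup>2 * \<delta>\<^sup>2)))
    + \<sigma>\<^sup>2 * (40 / 9 * (4 + 5 / \<delta>) + 15 / (9 / 10 * m) + 40 / 9 * (2 + 5 / \<delta>))"
  define w where "w n = real (k n) / real n + 1 / real n + 1 / real (q n) + 1 / sqrt (real (k n))" for n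
  define main where "main n = 3 / 4 * (\<sigma>\<^sup>2 * real (k n + 1) / real n) + 6 * M * C\<^sup>2 / (real (k n + 1))\<^sup>2" for n
  have risk_le: "risk n \<le> main n + real (k n) / real n * (K * w n)" if n: "1 \<le> n" "1 \<le> k n" "1 \<le> q n" for n
  proof -
    interpret R: forest_regression P "Z n" n "k n" "q n" \<mu>' m \<delta> s' \<sigma> C S M
      by (rule model[OF n])
    have "risk n = expectation (\<lambda>\<omega>. (forest_est n (\<lambda>i. Z n (Design i) \<omega>) (R.response \<omega>) (k n) (q n)
        (\<lambda>l j. Z n (Cut l j) \<omega>) (Z n New_Point \<omega>) - s' (Z n New_Point \<omega>))\<^sup>2)"
      unfolding risk_def
    proof (rule Bochner_Integration.integral_cong)
      fix \<omega> assume \<omega>: "\<omega> \<in> space P"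
      have "forest_est n (\<lambda>i. X i \<omega>) (\<lambda>i. Y i \<omega>) (k n) (q n) (\<lambda>l j. U n l j \<omega>) (X\<^sub>0 \<omega>)
          = forest_est n (\<lambda>i. X i \<omega>) (R.response \<omega>) (k n) (q n) (\<lambda>l j. U n l j \<omega>) (X\<^sub>0 \<omega>)"
        using Y[OF _ \<omega>] s'_eq[OF X_range[OF _ \<omega>]] by (intro forest_est_cong) (simp add: R.response_def Z_def)
      then show "(forest_est n (\<lambda>i. X i \<omega>) (\<lambda>i. Y i \<omega>) (k n) (q n) (\<lambda>l j. U n l j \<omega>) (X\<^sub>0 \<omega>) - s (X\<^sub>0 \<omega>))\<^sup>2
          = (forest_est n (\<lambda>i. Z n (Design i) \<omega>) (R.response \<omega>) (k n) (q n)
            (\<lambda>l j. Z n (Cut l j) \<omega>) (Z n New_Point \<omega>) - s' (Z n New_Point \<omega>))\<^sup>2"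
        using s'_eq[OF X\<^sub>0_range[OF \<omega>]] by (simp add: Z_def)
    qed simp
    also have "\<dots> \<le> main n + R.remainder_const * (real (k n) / real n * R.small_factor)"
      unfolding main_def by (rule R.risk_asymptotic_bound)
    also have "R.remainder_const = K" by (simp only: R.remainder_const_def K_def)
    also have "R.small_factor = w n" by (simp only: R.small_factor_def w_def)
    finally show ?thesis by (simp only: mult.left_commute)
  qed
  have k1: "eventually (\<lambda>n. 1 \<le> k n) sequentially" and q1: "eventually (\<lambda>n. 1 \<le> q n) sequentially"
    using k_lim q_lim by (auto simp: filterlim_at_top)
  have "(\<lambda>n. 1 / sqrt (real (k n))) \<longlonglongrightarrow> 0"
    by (rule filterlim_compose[OF _ k_lim, of "\<lambda>n. 1 / sqrt (real n)"]) real_asymp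
  moreover have "(\<lambda>n. 1 / real (q n)) \<longlonglongrightarrow> 0"
    by (rule filterlim_compose[OF _ q_lim, of "\<lambda>n. 1 / real n"]) real_asymp
  moreover have "(\<lambda>n. 1 / real n) \<longlonglongrightarrow> 0" by real_asymp
  ultimately have "w \<longlonglongrightarrow> 0 + 0 + 0 + 0"
    unfolding w_def using kn_lim by (intro tendsto_add)
  then have g: "(\<lambda>n. K * w n) \<longlonglongrightarrow> 0" by (simp add: tendsto_mult_right_zero)
  have "eventually (\<lambda>n. risk n \<le> main n + real (k n) / real n * (K * w n)) sequentially"
    using eventually_ge_at_top[of 1] k1 q1 by eventually_elim (rule risk_le)
  moreover have "eventually (\<lambda>n. 0 < real (k n) / real n) sequentially"
    using eventually_ge_at_top[of 1] k1 by eventually_elim auto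
  ultimately have "\<exists>f. f \<in> o(\<lambda>n. real (k n) / real n) \<and> (\<forall>n. risk n \<le> main n + f n)"
    using g by (rule eventual_bound_imp_smallo)
  then show ?thesis unfolding risk_def main_def by blast
qed

end
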